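(* Let $m\ge1$ be an integer, $n=2m$, $0<\alpha<1$ and $0\le\gamma<\frac1\alpha-1$. Then $AD(2m,m,\beta,\alpha,\gamma)$ is not attained for all sufficiently small $\beta>0$; that is, there exists $\beta_*\in(0,\beta_0)$ such that for every $\beta\in(0,\beta_* )$ there is no $u\in W^{m,2}(\mathbb{R}^{2m})$ with $\|\nabla^m u\|_2^2+\|u\|_2^2\le1$ achieving the supremum defining $AD(2m,m,\beta,\alpha,\gamma)$.
   Context: $\|\cdot\|_2$ is the norm of $L^2(\mathbb{R}^{2m})$; $\nabla^m u=\Delta^{m/2}u$ if $m$ is even and $\nabla^m u=\nabla\Delta^{(m-1)/2}u$ if $m$ is odd. The supremum is $$AD(2m,m,\beta,\alpha,\gamma)=\sup_{\substack{u\in W^{m,2}(\mathbb{R}^{2m})\\ \|\nabla^m u\|_2^2+\|u\|_2^2\le1}}\int_{\mathbb{R}^{2m}}\left(\exp\left(\beta\,\frac{1+\alpha\|u\|_2^2}{1-\gamma\alpha\|u\|_2^2}\,u^2\right)-1\right)\mathrm{d}x ,$$ and $\beta_0=\beta_0(m,2m)=(4\pi)^m m!$ is the Adams critical constant for $n=2m$. *)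

theory Defs
  imports "HOL-Analysis.Analysis"
begin

definition partial_deriv :: "'n::finite \<Rightarrow> (real^'n \<Rightarrow> real) \<Rightarrow> real^'n \<Rightarrow> real" where
  "partial_deriv i f x = frechet_derivative f (at x) (axis i 1)"

text \<open>A derivative of order \<open>k\<close> is indexed by a list of \<open>k\<close> coordinates instead of a multi-index;
  it is only applied to smooth functions, where the order of differentiation is irrelevant.\<close>

definition iter_deriv :: "'n::finite list \<Rightarrow> (real^'n \<Rightarrow> real) \<Rightarrow> real^'n \<Rightarrow> real" where
  "iter_deriv \<nu> f = foldr partial_deriv \<nu> f"

text \<open>Differentiability of all iterated partial derivatives entails their continuity, so this is
  the usual space of compactly supported \<open>C\<^sup>\<infinity>\<close> functions.\<close>

definition test_function :: "(real^'n::finite \<Rightarrow> real) \<Rightarrow> bool" where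
  "test_function \<phi> \<longleftrightarrow>
     (\<forall>\<nu> x. iter_deriv \<nu> \<phi> differentiable (at x)) \<and>
     (\<exists>K. compact K \<and> (\<forall>x. x \<notin> K \<longrightarrow> \<phi> x = 0))"

definition locally_integrable :: "(real^'n::finite \<Rightarrow> real) \<Rightarrow> bool" where
  "locally_integrable f \<longleftrightarrow> (\<forall>K. compact K \<longrightarrow> set_integrable lebesgue K f)"

definition has_weak_deriv ::
  "'n::finite list \<Rightarrow> (real^'n \<Rightarrow> real) \<Rightarrow> (real^'n \<Rightarrow> real) \<Rightarrow> bool" where
  "has_weak_deriv \<nu> u v \<longleftrightarrow>
     locally_integrable u \<and> locally_integrable v \<and>
     (\<forall>\<phi>. test_function \<phi> \<longrightarrow>
        (LINT x|lebesgue. u x * iter_deriv \<nu> \<phi> x)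
          = (- 1) ^ length \<nu> * (LINT x|lebesgue. v x * \<phi> x))"

text \<open>Functions stand for their almost-everywhere classes. A weak derivative is unique almost
  everywhere, so the representative picked here does not affect any integral below.\<close>

definition weak_deriv :: "'n::finite list \<Rightarrow> (real^'n \<Rightarrow> real) \<Rightarrow> real^'n \<Rightarrow> real" where
  "weak_deriv \<nu> u = (SOME v. has_weak_deriv \<nu> u v)"

definition weak_grad :: "(real^'n::finite \<Rightarrow> real) \<Rightarrow> real^'n \<Rightarrow> real^'n" where
  "weak_grad u x = (\<chi> i. weak_deriv [i] u x)"

definition weak_laplacian :: "(real^'n::finite \<Rightarrow> real) \<Rightarrow> real^'n \<Rightarrow> real" where
  "weak_laplacian u x = (\<Sum>i\<in>UNIV. weak_deriv [i, i] u x)"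

definition square_integrable :: "(real^'n::finite \<Rightarrow> real) \<Rightarrow> bool" where
  "square_integrable f \<longleftrightarrow>
     f \<in> borel_measurable lebesgue \<and> integrable lebesgue (\<lambda>x. (f x)\<^sup>2)"

definition L2_norm :: "(real^'n::finite \<Rightarrow> real) \<Rightarrow> real" where
  "L2_norm f = sqrt (LINT x|lebesgue. (f x)\<^sup>2)"

text \<open>The real-valued Sobolev space \<open>W\<^sup>m\<^sup>,\<^sup>2\<close>.\<close>

definition sobolev :: "nat \<Rightarrow> (real^'n::finite \<Rightarrow> real) set" where
  "sobolev m = {u. square_integrable u \<and>
     (\<forall>\<nu>. length \<nu> \<le> m \<longrightarrow> (\<exists>v. has_weak_deriv \<nu> u v \<and> square_integrable v))}"

text \<open>The pointwise Euclidean length of \<open>\<nabla>\<^sup>m u\<close>, which is scalar for even \<open>m\<close> and a vector field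
  for odd \<open>m\<close>.\<close>

definition abs_nabla_pow :: "nat \<Rightarrow> (real^'n::finite \<Rightarrow> real) \<Rightarrow> real^'n \<Rightarrow> real" where
  "abs_nabla_pow m u x =
     (if even m then \<bar>(weak_laplacian ^^ (m div 2)) u x\<bar>
      else norm (weak_grad ((weak_laplacian ^^ ((m - 1) div 2)) u) x))"

definition admissible :: "nat \<Rightarrow> (real^'n::finite \<Rightarrow> real) set" where
  "admissible m = {u \<in> sobolev m. (L2_norm (abs_nabla_pow m u))\<^sup>2 + (L2_norm u)\<^sup>2 \<le> 1}"

text \<open>For \<open>\<beta> \<ge> 0\<close>, \<open>0 < \<alpha> < 1\<close> and \<open>0 \<le> \<gamma> < 1/\<alpha> - 1\<close> the denominator is positive on admissible
  functions and the integrand is nonnegative, so the integral is taken in the extended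
  nonnegative reals.\<close>

definition AD_functional :: "real \<Rightarrow> real \<Rightarrow> real \<Rightarrow> (real^'n::finite \<Rightarrow> real) \<Rightarrow> ennreal" where
  "AD_functional \<beta> \<alpha> \<gamma> u =
     (\<integral>\<^sup>+ x. ennreal (exp (\<beta> * ((1 + \<alpha> * (L2_norm u)\<^sup>2) / (1 - \<gamma> * \<alpha> * (L2_norm u)\<^sup>2)) * (u x)\<^sup>2) - 1)
        \<partial>lebesgue)"

definition AD :: "'n::finite itself \<Rightarrow> nat \<Rightarrow> real \<Rightarrow> real \<Rightarrow> real \<Rightarrow> ennreal" where
  "AD _ m \<beta> \<alpha> \<gamma> = (SUP u \<in> (admissible m :: (real^'n \<Rightarrow> real) set). AD_functional \<beta> \<alpha> \<gamma> u)"

definition adams_const :: "nat \<Rightarrow> real" where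
  "adams_const m = (4 * pi) ^ m * fact m"

end

theory Submission
  imports Defs "HOL-Computational_Algebra.Polynomial" "HOL-Real_Asymp.Real_Asymp"
begin

text \<open>
  Write \<open>s = \<parallel>u\<parallel>\<^sub>2\<^sup>2\<close>, \<open>g = \<parallel>\<nabla>\<^sup>m u\<parallel>\<^sub>2\<^sup>2\<close> and \<open>h(s) = (1 + \<alpha>s)/(1 - \<gamma>\<alpha>s)\<close>, an increasing function on
  \<open>[0,1]\<close>. The supremum is at least \<open>\<beta> h(1)\<close>: flattening a fixed bump keeps its \<open>L\<^sup>2\<close> norm while
  its \<open>m\<close>-th gradient tends to zero, and \<open>e\<^sup>y - 1 \<ge> y\<close> (\<open>AD_ge_vanishing_level\<close>). For small \<open>\<beta>\<close> every
  admissible function stays strictly below this level (\<open>AD_functional_less_vanishing_level\<close>). With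
  \<open>b = \<beta> h(s)\<close>, the linear part of the exponential contributes \<open>b s \<le> b (1 - g)\<close>, which falls
  short of \<open>\<beta> h(1)\<close> by at least \<open>b g\<close>, whereas the rest contributes at most \<open>A b\<^sup>2 g\<close>. The gain is of higher order in
  \<open>\<beta>\<close> and cannot make up for the loss once \<open>A b < 1\<close>. If \<open>g = 0\<close> the rest vanishes, so that \<open>s = 1\<close>
  would force \<open>u = 0\<close>.

  The substance is therefore the remainder estimate
  \<open>\<integral> (e\<^bsup>bu\<^sup>2\<^esup> - 1 - bu\<^sup>2) \<le> A b\<^sup>2 g\<close> (\<open>adams_remainder_bound\<close>), an Adams inequality of scale-invariant
  form with a non-sharp exponent. It comes from pointwise estimates. The definition of weak derivatives is tested directly on a compactly supported
  radial truncation of the fundamental solution of the polyharmonic operator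
  (\<open>truncated_fundamental_solution\<close>); at Lebesgue points this gives, for all \<open>r > 0\<close>,
  \<open>|u(x)| \<le> C (r\<^bsup>-2m\<^esup> \<integral>\<^bsub>B(x,r)\<^esub> |u| + \<integral>\<^bsub>B(x,r)\<^esub> f(y) |x - y|\<^bsup>-m\<^esup> dy)\<close> with \<open>f = |\<nabla>\<^sup>m u|\<close>
  (\<open>pointwise_potential_bound\<close>). Let \<open>\<mu>\<close> be the Hardy-Littlewood maximal function of \<open>f\<close> at \<open>x\<close>.
  Choosing \<open>r\<close> as Hedberg does yields \<open>u(x)\<^sup>2 \<le> D \<mu>\<close>, and splitting the potential at radius
  \<open>\<mu>\<^bsup>-1/m\<^esup>\<close> yields \<open>u(x)\<^sup>2 \<le> D (1 + log \<mu>)\<close> when \<open>\<mu> \<ge> 1\<close> (\<open>hedberg_pointwise\<close>). Both together bound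
  the integrand by \<open>12 (bD)\<^sup>2 \<mu>\<^sup>2\<close>, and the \<open>L\<^sup>2\<close> maximal inequality (\<open>hl_max_L2_bound\<close>) finishes the estimate.
\<close>

section \<open>Smooth functions of one variable\<close>

text \<open>Coinduction turns smoothness of a function into the task of exhibiting a family of functions
  that is closed under differentiation.\<close>

coinductive smooth1 :: "(real \<Rightarrow> real) \<Rightarrow> bool" where
  smooth1I: "(\<And>x. (H has_real_derivative H' x) (at x)) \<Longrightarrow> smooth1 H' \<Longrightarrow> smooth1 H"

lemma smooth1_has_deriv: "smooth1 H \<Longrightarrow> (H has_real_derivative deriv H x) (at x)"
  by (erule smooth1.cases) (metis DERIV_imp_deriv)

lemma smooth1_deriv: "smooth1 H \<Longrightarrow> smooth1 (deriv H)"
proof (erule smooth1.cases)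
  fix f f' assume "H = f" "\<And>x. (f has_real_derivative f' x) (at x)" "smooth1 f'"
  then show "smooth1 (deriv H)" using DERIV_imp_deriv[of f] by (metis ext)
qed

lemma smooth1_continuous_on: "smooth1 H \<Longrightarrow> continuous_on S H"
  by (meson DERIV_continuous continuous_at_imp_continuous_on smooth1_has_deriv)

lemma smooth1_coinduct:
  assumes "P H" and "\<And>H. P H \<Longrightarrow> \<exists>H'. (\<forall>x. (H has_real_derivative H' x) (at x)) \<and> P H'"
  shows "smooth1 H"
  using assms(1)
proof (coinduction arbitrary: H rule: smooth1.coinduct)
  case smooth1
  then show ?case using assms(2) by blast
qed

lemma smooth1_const: "smooth1 (\<lambda>x. c)"
  by (rule smooth1_coinduct[where P = "\<lambda>H. \<exists>c. H = (\<lambda>x. c)"]) (auto intro!: exI[of _ "\<lambda>x. 0"])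

lemma smooth1_add:
  assumes "smooth1 A" "smooth1 B"
  shows "smooth1 (\<lambda>x. A x + B x)"
proof (rule smooth1_coinduct[where P = "\<lambda>H. \<exists>A B. H = (\<lambda>x. A x + B x) \<and> smooth1 A \<and> smooth1 B"])
  fix H assume "\<exists>A B. H = (\<lambda>x. A x + B x) \<and> smooth1 A \<and> smooth1 B"
  then obtain A B where *: "H = (\<lambda>x. A x + B x)" "smooth1 A" "smooth1 B" by blast
  have "\<forall>x. (H has_real_derivative deriv A x + deriv B x) (at x)"
    unfolding *(1) by (intro allI DERIV_add smooth1_has_deriv *)
  then show "\<exists>H'. (\<forall>x. (H has_real_derivative H' x) (at x)) \<and>
      (\<exists>A B. H' = (\<lambda>x. A x + B x) \<and> smooth1 A \<and> smooth1 B)"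
    using smooth1_deriv[OF *(2)] smooth1_deriv[OF *(3)]
    by (intro exI[of _ "\<lambda>x. deriv A x + deriv B x"] conjI exI[of _ "deriv A"] exI[of _ "deriv B"]) auto
qed (use assms in blast)

lemma smooth1_affine:
  assumes "smooth1 A"
  shows "smooth1 (\<lambda>x. c * A (a + b * x))"
proof (rule smooth1_coinduct[where P = "\<lambda>H. \<exists>c A. H = (\<lambda>x. c * A (a + b * x)) \<and> smooth1 A"])
  fix H assume "\<exists>c A. H = (\<lambda>x. c * A (a + b * x)) \<and> smooth1 A"
  then obtain c A where *: "H = (\<lambda>x. c * A (a + b * x))" "smooth1 A" by blast
  have "(H has_real_derivative (c * b) * deriv A (a + b * x)) (at x)" for x
  proof -
    have "((\<lambda>x. a + b * x) has_real_derivative b) (at x)" by (auto intro!: derivative_eq_intros)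
    from DERIV_cmult[OF DERIV_chain2[OF smooth1_has_deriv[OF *(2)] this], of c]
    show ?thesis unfolding *(1) by (simp add: mult_ac)
  qed
  then show "\<exists>H'. (\<forall>x. (H has_real_derivative H' x) (at x)) \<and>
      (\<exists>c A. H' = (\<lambda>x. c * A (a + b * x)) \<and> smooth1 A)"
    using smooth1_deriv[OF *(2)]
    by (intro exI[of _ "\<lambda>x. (c * b) * deriv A (a + b * x)"] conjI exI[of _ "c * b"] exI[of _ "deriv A"]) auto
qed (use assms in blast)

text \<open>The closed family consists of all \<open>x A(x) + B(x)\<close>: differentiation only moves
  \<open>A\<close> into the second summand.\<close>

lemma smooth1_mult_id:
  assumes "smooth1 A"
  shows "smooth1 (\<lambda>x. x * A x)"
proof (rule smooth1_coinduct[where P = "\<lambda>H. \<exists>A B. H = (\<lambda>x. x * A x + B x) \<and> smooth1 A \<and> smooth1 B"])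
  fix H assume "\<exists>A B. H = (\<lambda>x. x * A x + B x) \<and> smooth1 A \<and> smooth1 B"
  then obtain A B where *: "H = (\<lambda>x. x * A x + B x)" "smooth1 A" "smooth1 B" by blast
  have "\<forall>x. (H has_real_derivative x * deriv A x + (A x + deriv B x)) (at x)"
  proof
    fix x
    show "(H has_real_derivative x * deriv A x + (A x + deriv B x)) (at x)"
      unfolding *(1) using smooth1_has_deriv[OF *(2), of x] smooth1_has_deriv[OF *(3), of x]
      by (auto intro!: derivative_eq_intros)
  qed
  moreover have "smooth1 (\<lambda>x. A x + deriv B x)"
    using * by (intro smooth1_add smooth1_deriv)
  ultimately show "\<exists>H'. (\<forall>x. (H has_real_derivative H' x) (at x)) \<and>
      (\<exists>A B. H' = (\<lambda>x. x * A x + B x) \<and> smooth1 A \<and> smooth1 B)"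
    using smooth1_deriv[OF *(2)]
    by (intro exI[of _ "\<lambda>x. x * deriv A x + (A x + deriv B x)"] conjI
        exI[of _ "deriv A"] exI[of _ "\<lambda>x. A x + deriv B x"]) auto
next
  show "\<exists>A' B. (\<lambda>x. x * A x) = (\<lambda>x. x * A' x + B x) \<and> smooth1 A' \<and> smooth1 B"
    using assms smooth1_const[of 0] by (intro exI[of _ A] exI[of _ "\<lambda>x. 0"]) auto
qed

lemma smooth1_cmult: "smooth1 A \<Longrightarrow> smooth1 (\<lambda>x. c * A x)"
  using smooth1_affine[of A c 0 1] by simp

lemma poly_exp_tendsto_0: "((\<lambda>x::real. poly p x * exp (- x)) \<longlongrightarrow> 0) at_top"
proof -
  have "((\<lambda>x::real. \<Sum>i\<le>degree p. coeff p i * (x ^ i / exp x)) \<longlongrightarrow> (\<Sum>i\<le>degree p. coeff p i * 0)) at_top"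
    by (intro tendsto_sum tendsto_mult tendsto_const tendsto_power_div_exp_0)
  moreover have "(\<Sum>i\<le>degree p. coeff p i * (x ^ i / exp x)) = poly p x * exp (- x)" for x
    by (simp add: poly_altdef sum_distrib_right exp_minus divide_inverse mult.assoc)
  ultimately show ?thesis by simp
qed

text \<open>The derivatives of \<open>e\<^bsup>-1/t\<^esup>\<close>, continued by zero to \<open>t \<le>
  0\<close>, are all of this form.\<close>

definition flat_exp :: "real poly \<Rightarrow> real \<Rightarrow> real" where
  "flat_exp p t = (if 0 < t then poly p (1 / t) * exp (- (1 / t)) else 0)"

text \<open>At \<open>t = 0\<close> the difference quotient from the right is \<open>p(1/t) (1/t)
  e\<^bsup>-1/t\<^esup>\<close>, which vanishes in the limit because the exponential beats
  every polynomial.\<close>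

lemma flat_exp_deriv:
  "(flat_exp p has_real_derivative flat_exp ([:0, 0, 1:] * (p - pderiv p)) t) (at t)"
proof -
  consider "0 < t" | "t < 0" | "t = 0" by linarith
  then show ?thesis
  proof cases
    case 1
    have "((\<lambda>t. poly p (1 / t) * exp (- (1 / t))) has_real_derivative
        flat_exp ([:0, 0, 1:] * (p - pderiv p)) t) (at t)"
      using 1 by (auto intro!: derivative_eq_intros DERIV_chain'[OF _ poly_DERIV]
          simp: flat_exp_def field_simps power2_eq_square)
    then show ?thesis
      by (rule has_field_derivative_transform_within_open[where S = "{0<..}"])
        (use 1 in \<open>auto simp: flat_exp_def\<close>)
  next
    case 2
    have "((\<lambda>t. 0) has_real_derivative flat_exp ([:0, 0, 1:] * (p - pderiv p)) t) (at t)"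
      using 2 by (auto simp: flat_exp_def)
    then show ?thesis
      by (rule has_field_derivative_transform_within_open[where S = "{..<0}"])
        (use 2 in \<open>auto simp: flat_exp_def\<close>)
  next
    case 3
    have "((\<lambda>x::real. poly ([:0, 1:] * p) x * exp (- x)) \<longlongrightarrow> 0) at_top"
      by (rule poly_exp_tendsto_0)
    then have "((\<lambda>h::real. poly ([:0, 1:] * p) (inverse h) * exp (- inverse h)) \<longlongrightarrow> 0) (at_right 0)"
      by (rule filterlim_compose[OF _ filterlim_inverse_at_top_right])
    then have R: "((\<lambda>h. (flat_exp p h - flat_exp p 0) / (h - 0)) \<longlongrightarrow> 0) (at_right 0)"
    proof (rule Lim_transform_eventually)
      show "\<forall>\<^sub>F h::real in at_right 0. poly ([:0, 1:] * p) (inverse h) * exp (- inverse h)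
          = (flat_exp p h - flat_exp p 0) / (h - 0)"
        by (auto simp: eventually_at_filter flat_exp_def field_simps)
    qed
    have L: "((\<lambda>h. (flat_exp p h - flat_exp p 0) / (h - 0)) \<longlongrightarrow> 0) (at_left 0)"
      by (rule Lim_transform_eventually[OF tendsto_const])
        (auto simp: eventually_at_filter flat_exp_def)
    have "((\<lambda>h. (flat_exp p h - flat_exp p 0) / (h - 0)) \<longlongrightarrow> 0) (at 0)"
      using L R by (rule filterlim_split_at)
    then have "(flat_exp p has_real_derivative 0) (at 0)"
      by (simp add: has_field_derivative_iff)
    then show ?thesis using 3 by (simp add: flat_exp_def)
  qed
qed

lemma smooth1_flat_exp: "smooth1 (flat_exp p)"
  by (rule smooth1_coinduct[where P = "\<lambda>H. \<exists>p. H = flat_exp p"]) (auto intro: flat_exp_deriv)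

definition bump_profile :: "real \<Rightarrow> real" where
  "bump_profile q = flat_exp 1 (1 - q)"

lemma smooth1_bump_profile: "smooth1 bump_profile"
  using smooth1_affine[OF smooth1_flat_exp, of 1 1 1 "-1"] by (simp add: bump_profile_def[abs_def])

lemma bump_profile_zero: "1 \<le> q \<Longrightarrow> bump_profile q = 0"
  by (simp add: bump_profile_def flat_exp_def)

lemma bump_profile_pos: "q < 1 \<Longrightarrow> 0 < bump_profile q"
  by (simp add: bump_profile_def flat_exp_def)

lemma deriv_bump_profile: "deriv bump_profile q = - flat_exp [:0, 0, 1:] (1 - q)"
proof -
  have "(flat_exp 1 has_real_derivative flat_exp [:0, 0, 1:] (1 - q)) (at (1 - q))"
    using flat_exp_deriv[of 1 "1 - q"] by simp
  moreover have "((\<lambda>q. 1 - q) has_real_derivative - 1) (at q)"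
    by (auto intro!: derivative_eq_intros)
  ultimately have "((\<lambda>q. flat_exp 1 (1 - q)) has_real_derivative flat_exp [:0, 0, 1:] (1 - q) * - 1) (at q)"
    by (rule DERIV_chain2)
  then have "(bump_profile has_real_derivative - flat_exp [:0, 0, 1:] (1 - q)) (at q)"
    by (simp add: bump_profile_def[abs_def])
  then show ?thesis by (rule DERIV_imp_deriv)
qed

lemma deriv_bump_profile_nonpos: "deriv bump_profile q \<le> 0"
  and deriv_bump_profile_neg: "q < 1 \<Longrightarrow> deriv bump_profile q < 0"
  by (auto simp: deriv_bump_profile flat_exp_def)

lemma smooth1_deriv_vanishes:
  assumes H: "smooth1 H" and z: "\<And>q. c \<le> q \<Longrightarrow> H q = 0" and "c \<le> q"
  shows "deriv H q = 0"
proof -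
  have gt: "deriv H t = 0" if "c < t" for t
  proof -
    have "((\<lambda>q. 0) has_real_derivative 0) (at t)" by simp
    then have "(H has_real_derivative 0) (at t)"
      by (rule has_field_derivative_transform_within_open[where S = "{c<..}"]) (use z that in auto)
    then show ?thesis by (rule DERIV_imp_deriv)
  qed
  have "isCont (deriv H) q"
    using smooth1_has_deriv[OF smooth1_deriv[OF H]] DERIV_isCont by blast
  then have "(deriv H \<longlongrightarrow> deriv H q) (at_right q)"
    by (simp add: isCont_def filterlim_at_split)
  moreover have "(deriv H \<longlongrightarrow> 0) (at_right q)"
    by (rule Lim_transform_eventually[OF tendsto_const])
      (use gt \<open>c \<le> q\<close> in \<open>auto simp: eventually_at_filter\<close>)
  ultimately show ?thesis by (rule tendsto_unique[rotated]) simp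
qed

text \<open>Only arguments \<open>q \<ge> 0\<close> matter, since profiles are evaluated at squared
  distances.\<close>

lemma smooth1_bounded:
  assumes H: "smooth1 H" and z: "\<And>q. c \<le> q \<Longrightarrow> H q = 0"
  obtains C where "0 < C" "\<And>q. 0 \<le> q \<Longrightarrow> \<bar>H q\<bar> \<le> C"
proof -
  have "compact (H ` {0..c})" by (intro compact_continuous_image smooth1_continuous_on[OF H]) simp
  then obtain B where B: "0 < B" "\<forall>y\<in>H ` {0..c}. norm y \<le> B"
    using compact_imp_bounded bounded_pos by metis
  have "\<bar>H q\<bar> \<le> B" if "0 \<le> q" for q
    using B that z[of q] by (cases "q \<le> c") auto
  then show ?thesis using that B(1) by blast
qed

section \<open>The Laplacian on radial profiles\<close>

text \<open>By the chain rule, the Laplacian of \<open>y \<mapsto> H(|y - x|\<^sup>2)\<close> in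
  dimension \<open>n\<close> is the radial function with this profile.\<close>

definition radial_lap :: "nat \<Rightarrow> (real \<Rightarrow> real) \<Rightarrow> real \<Rightarrow> real" where
  "radial_lap n H q = 4 * q * deriv (deriv H) q + 2 * real n * deriv H q"

lemma smooth1_radial_lap: "smooth1 H \<Longrightarrow> smooth1 (radial_lap n H)"
proof -
  assume H: "smooth1 H"
  have "smooth1 (\<lambda>q. 4 * (q * deriv (deriv H) q) + 2 * real n * deriv H q)"
    by (intro smooth1_add smooth1_cmult smooth1_mult_id smooth1_deriv H)
  then show ?thesis by (simp add: radial_lap_def[abs_def] mult.assoc)
qed

lemma smooth1_radial_lap_pow: "smooth1 H \<Longrightarrow> smooth1 ((radial_lap n ^^ j) H)"
  by (induction j) (auto intro: smooth1_radial_lap)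

lemma radial_lap_vanishes:
  assumes "smooth1 H" "\<And>q. c \<le> q \<Longrightarrow> H q = 0" "c \<le> q"
  shows "radial_lap n H q = 0"
  using smooth1_deriv_vanishes[OF assms(1,2)] assms(3)
    smooth1_deriv_vanishes[OF smooth1_deriv[OF assms(1)], of c q]
  by (auto simp: radial_lap_def)

lemma radial_lap_pow_vanishes:
  assumes "smooth1 H" "\<And>q. c \<le> q \<Longrightarrow> H q = 0" "c \<le> q"
  shows "(radial_lap n ^^ j) H q = 0"
  using assms(3)
proof (induction j arbitrary: q)
  case 0
  then show ?case using assms by simp
next
  case (Suc j)
  show ?case
    using radial_lap_vanishes[OF smooth1_radial_lap_pow[OF assms(1)] Suc.IH Suc.prems] by simp
qed

text \<open>Superposing dilates of a bump with a power weight gives a homogeneous function up to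
  truncation: with \<open>w(\<sigma>) = \<sigma>\<^bsup>k-1\<^esup>\<close> and the range
  \<open>(0,\<infinity>)\<close> it would be a multiple of \<open>q\<^bsup>-k\<^esup>\<close>.
  A finite range \<open>[a,b]\<close> smooths the singularity at scale \<open>1/b\<close> and
  cuts the tail off at \<open>1/a\<close>.\<close>

definition scale_avg :: "(real \<Rightarrow> real) \<Rightarrow> real \<Rightarrow> real \<Rightarrow> (real \<Rightarrow> real) \<Rightarrow> real \<Rightarrow> real" where
  "scale_avg w a b H q = integral {a..b} (\<lambda>\<sigma>. w \<sigma> * H (\<sigma> * q))"

lemma scale_avg_integrable:
  assumes "continuous_on {a..b} w" "smooth1 H"
  shows "(\<lambda>\<sigma>. w \<sigma> * H (\<sigma> * q)) integrable_on {a..b}"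
  by (intro integrable_continuous_real continuous_intros assms
      continuous_on_compose2[OF smooth1_continuous_on[OF assms(2), of UNIV]]) auto

lemma scale_avg_has_deriv:
  assumes w: "continuous_on {a..b} w" and H: "smooth1 H"
  shows "(scale_avg w a b H has_real_derivative scale_avg (\<lambda>\<sigma>. \<sigma> * w \<sigma>) a b (deriv H) q) (at q)"
proof -
  have "((\<lambda>q. integral (cbox a b) (\<lambda>\<sigma>. w \<sigma> * H (\<sigma> * q))) has_field_derivative
     integral (cbox a b) (\<lambda>\<sigma>. \<sigma> * w \<sigma> * deriv H (\<sigma> * q))) (at q within UNIV)"
  proof (rule leibniz_rule_field_derivative)
    fix x \<sigma> :: real
    show "((\<lambda>x. w \<sigma> * H (\<sigma> * x)) has_field_derivative \<sigma> * w \<sigma> * deriv H (\<sigma> * x)) (at x)"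
      by (auto intro!: derivative_eq_intros DERIV_chain'[OF _ smooth1_has_deriv[OF H]])
    show "(\<lambda>\<sigma>. w \<sigma> * H (\<sigma> * x)) integrable_on cbox a b"
      using scale_avg_integrable[OF w H] by simp
  next
    have "continuous_on (UNIV \<times> cbox a b) (\<lambda>z. snd z * w (snd z) * deriv H (snd z * fst z))"
      by (intro continuous_intros continuous_on_compose2[OF w]
          continuous_on_compose2[OF smooth1_continuous_on[OF smooth1_deriv[OF H], of UNIV]]) auto
    then show "continuous_on (UNIV \<times> cbox a b) (\<lambda>(x, \<sigma>). \<sigma> * w \<sigma> * deriv H (\<sigma> * x))"
      by (simp add: case_prod_beta)
  qed auto
  then show ?thesis by (simp add: scale_avg_def[abs_def])
qed

lemma smooth1_scale_avg:
  assumes "continuous_on {a..b} w" "smooth1 H"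
  shows "smooth1 (scale_avg w a b H)"
proof (rule smooth1_coinduct[where P =
      "\<lambda>F. \<exists>w H. F = scale_avg w a b H \<and> continuous_on {a..b} w \<and> smooth1 H"])
  fix F assume "\<exists>w H. F = scale_avg w a b H \<and> continuous_on {a..b} w \<and> smooth1 H"
  then obtain w H where *: "F = scale_avg w a b H" "continuous_on {a..b} w" "smooth1 H" by blast
  have "continuous_on {a..b} (\<lambda>\<sigma>. \<sigma> * w \<sigma>)" by (intro continuous_intros *)
  then show "\<exists>F'. (\<forall>x. (F has_real_derivative F' x) (at x)) \<and>
      (\<exists>w H. F' = scale_avg w a b H \<and> continuous_on {a..b} w \<and> smooth1 H)"
    unfolding *(1) using scale_avg_has_deriv[OF *(2,3)] smooth1_deriv[OF *(3)]
    by (intro exI[of _ "scale_avg (\<lambda>\<sigma>. \<sigma> * w \<sigma>) a b (deriv H)"] conjI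
        exI[of _ "\<lambda>\<sigma>. \<sigma> * w \<sigma>"] exI[of _ "deriv H"]) auto
qed (use assms in blast)

lemma deriv_scale_avg:
  assumes "continuous_on {a..b} w" "smooth1 H"
  shows "deriv (scale_avg w a b H) = scale_avg (\<lambda>\<sigma>. \<sigma> * w \<sigma>) a b (deriv H)"
  using DERIV_imp_deriv[OF scale_avg_has_deriv[OF assms]] by blast

text \<open>The operator scales like one power of \<open>\<sigma>\<close>, hence it passes under the
  integral at the price of one factor \<open>\<sigma>\<close>.\<close>

lemma radial_lap_scale_avg:
  assumes w: "continuous_on {a..b} w" and H: "smooth1 H"
  shows "radial_lap n (scale_avg w a b H) = scale_avg (\<lambda>\<sigma>. \<sigma> * w \<sigma>) a b (radial_lap n H)"
proof
  fix q
  have w': "continuous_on {a..b} (\<lambda>\<sigma>. \<sigma> * w \<sigma>)" by (intro continuous_intros w)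
  have w'': "continuous_on {a..b} (\<lambda>\<sigma>. \<sigma> * (\<sigma> * w \<sigma>))" by (intro continuous_intros w)
  have "radial_lap n (scale_avg w a b H) q = 4 * q * scale_avg (\<lambda>\<sigma>. \<sigma> * (\<sigma> * w \<sigma>)) a b (deriv (deriv H)) q
     + 2 * real n * scale_avg (\<lambda>\<sigma>. \<sigma> * w \<sigma>) a b (deriv H) q"
    by (simp add: radial_lap_def deriv_scale_avg[OF w H] deriv_scale_avg[OF w' smooth1_deriv[OF H]])
  also have "\<dots> = integral {a..b} (\<lambda>\<sigma>. 4 * q * (\<sigma> * (\<sigma> * w \<sigma>) * deriv (deriv H) (\<sigma> * q)))
      + integral {a..b} (\<lambda>\<sigma>. 2 * real n * (\<sigma> * w \<sigma> * deriv H (\<sigma> * q)))"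
    by (simp add: scale_avg_def)
  also have "\<dots> = integral {a..b} (\<lambda>\<sigma>. 4 * q * (\<sigma> * (\<sigma> * w \<sigma>) * deriv (deriv H) (\<sigma> * q))
      + 2 * real n * (\<sigma> * w \<sigma> * deriv H (\<sigma> * q)))"
    by (intro integral_add[symmetric] integrable_on_mult_right scale_avg_integrable w' w''
         smooth1_deriv H)
  also have "\<dots> = scale_avg (\<lambda>\<sigma>. \<sigma> * w \<sigma>) a b (radial_lap n H) q"
    unfolding scale_avg_def by (intro integral_cong) (simp add: radial_lap_def algebra_simps)
  finally show "radial_lap n (scale_avg w a b H) q = scale_avg (\<lambda>\<sigma>. \<sigma> * w \<sigma>) a b (radial_lap n H) q" .
qed

lemma radial_lap_pow_scale_avg:
  assumes w: "continuous_on {a..b} w" and H: "smooth1 H"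
  shows "(radial_lap n ^^ j) (scale_avg w a b H) = scale_avg (\<lambda>\<sigma>. \<sigma> ^ j * w \<sigma>) a b ((radial_lap n ^^ j) H)"
proof (induction j)
  case (Suc j)
  have "continuous_on {a..b} (\<lambda>\<sigma>. \<sigma> ^ j * w \<sigma>)" by (intro continuous_intros w)
  then show ?case
    using Suc radial_lap_scale_avg[OF _ smooth1_radial_lap_pow[OF H]] by (simp add: mult.assoc)
qed simp

text \<open>In dimension \<open>2m\<close> the weight \<open>\<sigma>\<^bsup>m-1\<^esup>\<close> makes
  the integrand the exact \<open>\<sigma>\<close>-derivative of \<open>4 \<sigma>\<^sup>m
  G'(\<sigma>q)\<close>. Only the two end points survive: an approximate identity at scale
  \<open>1/b\<close> and a smooth term at scale \<open>1/a\<close>. This is how the Dirac mass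
  of the fundamental solution appears.\<close>

lemma scale_avg_radial_lap_telescopes:
  assumes G: "smooth1 G" and m: "1 \<le> m" and ab: "a \<le> b"
  shows "scale_avg (\<lambda>\<sigma>. \<sigma> ^ (m - 1)) a b (radial_lap (2 * m) G) q
    = 4 * b ^ m * deriv G (b * q) - 4 * a ^ m * deriv G (a * q)"
proof -
  have "((\<lambda>\<sigma>. \<sigma> ^ (m - 1) * radial_lap (2 * m) G (\<sigma> * q)) has_integral
      4 * b ^ m * deriv G (b * q) - 4 * a ^ m * deriv G (a * q)) {a..b}"
  proof (rule fundamental_theorem_of_calculus[OF ab])
    fix \<sigma>
    have d: "((\<lambda>\<sigma>. deriv G (\<sigma> * q)) has_real_derivative deriv (deriv G) (\<sigma> * q) * q) (at \<sigma>)"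
      by (rule DERIV_chain2[OF smooth1_has_deriv[OF smooth1_deriv[OF G]]]) (auto intro!: derivative_eq_intros)
    have p: "\<sigma> ^ m = \<sigma> * \<sigma> ^ (m - 1)" using m by (cases m) auto
    have "((\<lambda>\<sigma>. 4 * \<sigma> ^ m * deriv G (\<sigma> * q)) has_real_derivative
       \<sigma> ^ (m - 1) * radial_lap (2 * m) G (\<sigma> * q)) (at \<sigma>)"
      by (rule derivative_eq_intros d refl)+ (simp add: radial_lap_def p algebra_simps)
    then show "((\<lambda>\<sigma>. 4 * \<sigma> ^ m * deriv G (\<sigma> * q)) has_vector_derivative
       \<sigma> ^ (m - 1) * radial_lap (2 * m) G (\<sigma> * q)) (at \<sigma> within {a..b})"
      by (simp add: has_real_derivative_iff_has_vector_derivative has_vector_derivative_at_within)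
  qed
  then show ?thesis unfolding scale_avg_def by (rule integral_unique)
qed

lemma scale_avg_vanishes:
  assumes z: "\<And>q. 1 \<le> q \<Longrightarrow> H q = 0" and a: "0 < a" and q: "1 \<le> a * q"
  shows "scale_avg w a b H q = 0"
proof -
  have "0 < q" using a q by (smt (verit) mult_nonneg_nonpos)
  then have "1 \<le> \<sigma> * q" if "a \<le> \<sigma>" for \<sigma>
    using q mult_right_mono[OF that, of q] by linarith
  then have "integral {a..b} (\<lambda>\<sigma>. w \<sigma> * H (\<sigma> * q)) = integral {a..b} (\<lambda>\<sigma>. 0)"
    by (intro integral_cong) (use z in auto)
  then show ?thesis by (simp add: scale_avg_def)
qed

text \<open>The integrand vanishes for \<open>\<sigma> \<ge> 1/q\<close>, so that the integral runs over
  an interval of length at most \<open>1/q\<close> on which \<open>\<sigma>\<^sup>j \<le>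
  (1/q)\<^sup>j\<close>. The bound does not depend on the cut-off \<open>b\<close>.\<close>

lemma scale_avg_power_bound:
  assumes H: "smooth1 H" and z: "\<And>q. 1 \<le> q \<Longrightarrow> H q = 0"
    and C: "\<And>q. 0 \<le> q \<Longrightarrow> \<bar>H q\<bar> \<le> C" and a: "0 < a" and q: "0 < q"
  shows "\<bar>scale_avg (\<lambda>\<sigma>. \<sigma> ^ j) a b H q\<bar> \<le> C * (1 / q) ^ Suc j"
proof -
  have C0: "0 \<le> C" using C[of 0] by linarith
  define c where "c = min b (1 / q)"
  have cont: "continuous_on S (\<lambda>\<sigma>. \<sigma> ^ j * H (\<sigma> * q))" for S
    by (intro continuous_intros
      continuous_on_compose2[OF smooth1_continuous_on[OF H, of UNIV]]) auto
  consider "1 / q \<le> a" | "b \<le> a" | "a < 1 / q" "a < b" by linarith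
  then show ?thesis
  proof cases
    case 1
    then have "1 \<le> a * q" using q by (simp add: field_simps)
    then show ?thesis using scale_avg_vanishes[OF z a] C0 q by simp
  next
    case 2
    then have "scale_avg (\<lambda>\<sigma>. \<sigma> ^ j) a b H q = 0"
      by (cases "a = b") (auto simp: scale_avg_def)
    then show ?thesis using C0 q by simp
  next
    case 3
    have ac: "a \<le> c" "c \<le> b" using 3 by (auto simp: c_def)
    have "scale_avg (\<lambda>\<sigma>. \<sigma> ^ j) a b H q = integral {a..c} (\<lambda>\<sigma>. \<sigma> ^ j * H (\<sigma> * q))"
    proof (cases "b \<le> 1 / q")
      case True
      then show ?thesis by (simp add: scale_avg_def c_def min_def)
    next
      case False
      then have c: "c = 1 / q" by (simp add: c_def)
      have "integral {c..b} (\<lambda>\<sigma>. \<sigma> ^ j * H (\<sigma> * q)) = integral {c..b} (\<lambda>\<sigma>. 0)"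
      proof (rule integral_cong)
        fix \<sigma> assume s: "\<sigma> \<in> {c..b}"
        then have "1 \<le> \<sigma> * q" using q by (auto simp: c field_simps)
        then show "\<sigma> ^ j * H (\<sigma> * q) = 0" using z by simp
      qed
      moreover have "integral {a..c} (\<lambda>\<sigma>. \<sigma> ^ j * H (\<sigma> * q)) + integral {c..b} (\<lambda>\<sigma>. \<sigma> ^ j * H (\<sigma> * q))
         = integral {a..b} (\<lambda>\<sigma>. \<sigma> ^ j * H (\<sigma> * q))"
        by (rule Henstock_Kurzweil_Integration.integral_combine[OF ac])
          (intro integrable_continuous_real cont)
      ultimately show ?thesis by (simp add: scale_avg_def)
    qed
    also have "norm \<dots> \<le> (C * (1 / q) ^ j) * (c - a)"
    proof (rule integral_bound[OF ac(1) cont])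
      fix \<sigma> assume s: "\<sigma> \<in> {a..c}"
      then have "0 \<le> \<sigma>" "\<sigma> \<le> 1 / q" using a by (auto simp: c_def)
      then show "norm (\<sigma> ^ j * H (\<sigma> * q)) \<le> C * (1 / q) ^ j"
        using C[of "\<sigma> * q"] q C0
        by (simp add: abs_mult mult.commute[of C]) (intro mult_mono power_mono; simp)
    qed
    also have "\<dots> \<le> (C * (1 / q) ^ j) * (1 / q)"
      using a C0 q by (intro mult_left_mono) (auto simp: c_def)
    finally show ?thesis by (simp add: mult_ac)
  qed
qed

text \<open>Up to a factor, the moment of order \<open>m - 1\<close> is the integral over
  \<open>\<real>\<^bsup>2m\<^esup>\<close> of the radial function with profile
  \<open>H\<close>, provided that \<open>H\<close> vanishes on \<open>[1,\<infinity>)\<close>.\<close>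

definition moment :: "nat \<Rightarrow> (real \<Rightarrow> real) \<Rightarrow> real" where
  "moment p H = integral {0..1} (\<lambda>q. q ^ p * H q)"

lemma moment_integrable: "smooth1 H \<Longrightarrow> (\<lambda>q. q ^ p * H q) integrable_on {0..1}"
  by (intro integrable_continuous_real continuous_intros smooth1_continuous_on)

lemma moment_deriv:
  assumes H: "smooth1 H" and z: "\<And>q. 1 \<le> q \<Longrightarrow> H q = 0"
  shows "moment (Suc p) (deriv H) = - real (Suc p) * moment p H"
proof -
  have "((\<lambda>q. real (Suc p) * (q ^ p * H q) + q ^ Suc p * deriv H q) has_integral
      1 ^ Suc p * H 1 - 0 ^ Suc p * H 0) {0..1}"
  proof (rule fundamental_theorem_of_calculus)
    fix q :: real
    have "((\<lambda>q. q ^ Suc p * H q) has_real_derivative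
        real (Suc p) * (q ^ p * H q) + q ^ Suc p * deriv H q) (at q)"
      by (rule derivative_eq_intros smooth1_has_deriv[OF H] refl)+ (simp add: algebra_simps)
    then show "((\<lambda>q. q ^ Suc p * H q) has_vector_derivative
        real (Suc p) * (q ^ p * H q) + q ^ Suc p * deriv H q) (at q within {0..1})"
      by (simp add: has_real_derivative_iff_has_vector_derivative has_vector_derivative_at_within)
  qed simp
  then have "integral {0..1} (\<lambda>q. real (Suc p) * (q ^ p * H q) + q ^ Suc p * deriv H q) = 0"
    using z[of 1] by (simp add: integral_unique)
  moreover have "integral {0..1} (\<lambda>q. real (Suc p) * (q ^ p * H q) + q ^ Suc p * deriv H q)
     = real (Suc p) * moment p H + moment (Suc p) (deriv H)"
    unfolding moment_def
    by (subst integral_add)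
      (use moment_integrable[OF H] moment_integrable[OF smooth1_deriv[OF H]] in
        \<open>auto intro!: integrable_on_mult_right simp del: power_Suc\<close>)
  ultimately show ?thesis by (simp add: algebra_simps)
qed

lemma moment_radial_lap:
  assumes H: "smooth1 H" and z: "\<And>q. 1 \<le> q \<Longrightarrow> H q = 0"
  shows "moment p (radial_lap (2 * m) H) = 4 * (real m - 1 - real p) * moment p (deriv H)"
proof -
  have "moment p (radial_lap (2 * m) H) = integral {0..1}
      (\<lambda>q. 4 * (q ^ Suc p * deriv (deriv H) q) + 4 * real m * (q ^ p * deriv H q))"
    unfolding moment_def by (intro integral_cong) (simp add: radial_lap_def algebra_simps)
  also have "\<dots> = 4 * moment (Suc p) (deriv (deriv H)) + 4 * real m * moment p (deriv H)"
    unfolding moment_def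
    by (subst integral_add)
      (use moment_integrable[OF smooth1_deriv[OF smooth1_deriv[OF H]]]
          moment_integrable[OF smooth1_deriv[OF H]] in
        \<open>auto intro!: integrable_on_mult_right simp del: power_Suc\<close>)
  also have "moment (Suc p) (deriv (deriv H)) = - real (Suc p) * moment p (deriv H)"
    by (rule moment_deriv[OF smooth1_deriv[OF H]]) (rule smooth1_deriv_vanishes[OF H z])
  finally show ?thesis by (simp add: algebra_simps)
qed

lemma moment_deriv_bump_profile: "moment p (deriv bump_profile) \<noteq> 0"
proof
  assume "moment p (deriv bump_profile) = 0"
  then have "integral {0..1} (\<lambda>q. - (q ^ p * deriv bump_profile q)) = 0"
    by (simp add: moment_def)
  moreover have "continuous_on {0..1} (\<lambda>q. - (q ^ p * deriv bump_profile q))"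
    by (intro continuous_intros smooth1_continuous_on smooth1_deriv smooth1_bump_profile)
  moreover have "0 \<le> - (q ^ p * deriv bump_profile q)" if "q \<in> {0..1}" for q
    using that deriv_bump_profile_nonpos[of q] by (simp add: mult_nonneg_nonpos)
  ultimately have "\<forall>q\<in>{0..1}. - (q ^ p * deriv bump_profile q) = 0"
    by (subst (asm) integral_eq_0_iff) auto
  then show False using deriv_bump_profile_neg[of "1/2"] by (auto dest!: bspec[of _ _ "1/2"])
qed

text \<open>This is the mass of the approximate identity. Integration by parts reduces one application
  of the operator to a moment of one order less, with the factor \<open>-4 p (m - p)\<close>
  for the order \<open>p = m - K + j\<close>; it never vanishes as long as \<open>0 < p <
  m\<close>. What remains at the end is a moment of the derivative of the bump, which is
  negative on \<open>[0,1)\<close>.\<close>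

lemma moment_deriv_radial_lap_pow_bump:
  assumes "j < K" "K \<le> m"
  shows "moment (m - K + j) (deriv ((radial_lap (2 * m) ^^ j) bump_profile)) \<noteq> 0"
  using assms(1)
proof (induction j)
  case 0
  then show ?case using moment_deriv_bump_profile by simp
next
  case (Suc j)
  let ?G = "(radial_lap (2 * m) ^^ j) bump_profile"
  have s: "smooth1 ?G" and z: "\<And>q. 1 \<le> q \<Longrightarrow> ?G q = 0"
    using smooth1_radial_lap_pow[OF smooth1_bump_profile]
      radial_lap_pow_vanishes[OF smooth1_bump_profile bump_profile_zero] by auto
  have "moment (m - K + Suc j) (deriv ((radial_lap (2 * m) ^^ Suc j) bump_profile))
     = - real (Suc (m - K + j)) * moment (m - K + j) (radial_lap (2 * m) ?G)"
    using moment_deriv[OF smooth1_radial_lap[OF s, of "2 * m"] radial_lap_vanishes[OF s z], where p = "m - K + j"]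
    by simp
  also have "\<dots> = - real (Suc (m - K + j)) * (4 * (real m - 1 - real (m - K + j)) * moment (m - K + j) (deriv ?G))"
    by (simp add: moment_radial_lap[OF s z])
  also have "\<dots> \<noteq> 0"
    using Suc assms(2) by (simp add: of_nat_diff)
  finally show ?case .
qed

section \<open>The Hardy--Littlewood maximal function\<close>

definition hl_max :: "('a::euclidean_space \<Rightarrow> ennreal) \<Rightarrow> 'a \<Rightarrow> ennreal" where
  "hl_max w x = (SUP r\<in>{0<..}. (\<integral>\<^sup>+y\<in>ball x r. w y \<partial>lborel) / ennreal (r ^ DIM('a)))"

text \<open>Avoids division in the extended reals in all later arguments.\<close>

lemma hl_max_greater_iff:
  fixes w :: "'a::euclidean_space \<Rightarrow> ennreal"
  shows "t < hl_max w x \<longleftrightarrow> (\<exists>r>0. t * ennreal (r ^ DIM('a)) < (\<integral>\<^sup>+y\<in>ball x r. w y \<partial>lborel))"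
proof -
  have *: "t < A / ennreal (r ^ DIM('a)) \<longleftrightarrow> t * ennreal (r ^ DIM('a)) < A" if "0 < r" for r A
  proof -
    have "t < A / ennreal c \<longleftrightarrow> t * ennreal c < A" if "0 < c" for c
      using that by (cases t; cases A)
        (auto simp: divide_ennreal ennreal_mult[symmetric] ennreal_less_iff field_simps
          ennreal_top_mult ennreal_top_divide ennreal_mult_top)
    then show ?thesis using that by simp
  qed
  show ?thesis unfolding hl_max_def less_SUP_iff using * by auto
qed

lemma nn_integral_ball_mono:
  "A \<subseteq> B \<Longrightarrow> (\<integral>\<^sup>+y\<in>A. w y \<partial>M) \<le> (\<integral>\<^sup>+y\<in>B. w y \<partial>M)"
  by (intro nn_integral_mono) (auto split: split_indicator)

lemma ball_integral_inner_approx: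
  fixes w :: "'a::euclidean_space \<Rightarrow> ennreal"
  assumes [measurable]: "w \<in> borel_measurable borel" and "0 < r"
    and "t < (\<integral>\<^sup>+y\<in>ball x r. w y \<partial>lborel)"
  obtains r' where "0 < r'" "r' < r" "t < (\<integral>\<^sup>+y\<in>ball x r'. w y \<partial>lborel)"
proof -
  \<comment> \<open>Radii that increase to \<open>r\<close>; the summand 2 keeps them positive.\<close>
  define \<rho> where "\<rho> k = r - r / (real k + 2)" for k
  have rho: "0 < \<rho> k" "\<rho> k < r" for k
    using \<open>0 < r\<close> by (auto simp: \<rho>_def field_simps intro!: add_pos_nonneg)
  have [measurable]: "ball x s \<in> sets borel" for s :: real by simp
  have "(\<integral>\<^sup>+y\<in>ball x r. w y \<partial>lborel) = (\<integral>\<^sup>+y. (SUP k. w y * indicator (ball x (\<rho> k)) y) \<partial>lborel)"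
  proof (intro nn_integral_cong)
    fix y
    show "w y * indicator (ball x r) y = (SUP k. w y * indicator (ball x (\<rho> k)) y)"
    proof (cases "y \<in> ball x r")
      case True
      have "\<rho> \<longlonglongrightarrow> r" unfolding \<rho>_def by real_asymp
      then have "\<forall>\<^sub>F k in sequentially. dist x y < \<rho> k"
        using True by (auto intro: order_tendstoD(1))
      then obtain k where "dist x y < \<rho> k" by (auto simp: eventually_sequentially)
      then show ?thesis using True
        by (intro antisym SUP_least) (auto intro!: SUP_upper2[of k] split: split_indicator)
    next
      case False
      then have "y \<notin> ball x (\<rho> k)" for k using rho(2)[of k] by auto
      then show ?thesis using False by (simp add: indicator_def)
    qed
  qed
  also have "\<dots> = (SUP k. \<integral>\<^sup>+y\<in>ball x (\<rho> k). w y \<partial>lborel)"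
  proof (rule nn_integral_monotone_convergence_SUP)
    show "incseq (\<lambda>k y. w y * indicator (ball x (\<rho> k)) y)"
    proof (intro incseq_SucI le_funI)
      fix k y
      have "\<rho> k \<le> \<rho> (Suc k)" using \<open>0 < r\<close> by (auto simp: \<rho>_def field_simps)
      then show "w y * indicator (ball x (\<rho> k)) y \<le> w y * indicator (ball x (\<rho> (Suc k))) y"
        by (auto split: split_indicator)
    qed
  qed measurable
  finally obtain k where "t < (\<integral>\<^sup>+y\<in>ball x (\<rho> k). w y \<partial>lborel)"
    using assms(3) by (auto simp: less_SUP_iff)
  then show ?thesis using rho that by blast
qed

text \<open>A ball of slightly smaller radius still carries enough mass, and it is contained in all
  balls of the original radius around nearby points.\<close>

lemma open_hl_max_greater:
  fixes w :: "'a::euclidean_space \<Rightarrow> ennreal"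
  assumes w [measurable]: "w \<in> borel_measurable borel"
  shows "open {x. t < hl_max w x}"
proof (rule openI)
  fix x assume "x \<in> {x. t < hl_max w x}"
  then obtain r where r: "0 < r" "t * ennreal (r ^ DIM('a)) < (\<integral>\<^sup>+y\<in>ball x r. w y \<partial>lborel)"
    by (auto simp: hl_max_greater_iff)
  from ball_integral_inner_approx[OF w this] obtain r' where r': "0 < r'" "r' < r"
      "t * ennreal (r ^ DIM('a)) < (\<integral>\<^sup>+y\<in>ball x r'. w y \<partial>lborel)" .
  have "z \<in> {x. t < hl_max w x}" if "z \<in> ball x (r - r')" for z
  proof -
    have "ball x r' \<subseteq> ball z r"
    proof
      fix y assume "y \<in> ball x r'"
      then show "y \<in> ball z r" using that dist_triangle[of z y x] by (auto simp: dist_commute)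
    qed
    then have "t * ennreal (r ^ DIM('a)) < (\<integral>\<^sup>+y\<in>ball z r. w y \<partial>lborel)"
      using r'(3) nn_integral_ball_mono less_le_trans by blast
    then show ?thesis using r(1) by (auto simp: hl_max_greater_iff)
  qed
  then show "\<exists>e>0. ball x e \<subseteq> {x. t < hl_max w x}"
    using r' by (intro exI[of _ "r - r'"]) auto
qed

lemma borel_measurable_hl_max [measurable]:
  fixes w :: "'a::euclidean_space \<Rightarrow> ennreal"
  assumes "w \<in> borel_measurable borel"
  shows "hl_max w \<in> borel_measurable borel"
  by (rule borel_measurableI_greater) (use open_hl_max_greater[OF assms] in auto)

lemma emeasure_ball_power:
  fixes x :: "'a::euclidean_space"
  assumes "0 \<le> r"
  shows "emeasure lborel (ball x r) = ennreal (unit_ball_vol DIM('a)) * ennreal (r ^ DIM('a))"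
    and "emeasure lborel (cball x r) = ennreal (unit_ball_vol DIM('a)) * ennreal (r ^ DIM('a))"
  using assms by (auto simp: emeasure_ball emeasure_cball ennreal_mult)

lemma emeasure_UN_le_nn_integral:
  assumes "countable I" and "\<And>i. i \<in> I \<Longrightarrow> X i \<in> sets M"
  shows "emeasure M (\<Union>i\<in>I. X i) \<le> (\<integral>\<^sup>+i. emeasure M (X i) \<partial>count_space I)"
proof -
  have [measurable]: "(\<Union>i\<in>I. X i) \<in> sets M" using assms by (intro sets.countable_UN'') auto
  have "emeasure M (\<Union>i\<in>I. X i) = (\<integral>\<^sup>+x. indicator (\<Union>i\<in>I. X i) x \<partial>M)"
    by (rule nn_integral_indicator[symmetric]) measurable
  also have "\<dots> \<le> (\<integral>\<^sup>+x. (\<integral>\<^sup>+i. indicator (X i) x \<partial>count_space I) \<partial>M)"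
  proof (rule nn_integral_mono)
    fix x
    show "indicator (\<Union>i\<in>I. X i) x \<le> (\<integral>\<^sup>+i. (indicator (X i) x :: ennreal) \<partial>count_space I)"
    proof (cases "x \<in> (\<Union>i\<in>I. X i)")
      case True
      then obtain j where j: "j \<in> I" "x \<in> X j" by auto
      have "(1::ennreal) = (\<integral>\<^sup>+i. indicator {j} i \<partial>count_space I)"
        using j by (simp add: nn_integral_indicator)
      also have "\<dots> \<le> (\<integral>\<^sup>+i. indicator (X i) x \<partial>count_space I)"
        using j by (intro nn_integral_mono) (auto split: split_indicator)
      finally show ?thesis by (simp split: split_indicator)
    qed simp
  qed
  also have "\<dots> = (\<integral>\<^sup>+i. (\<integral>\<^sup>+x. indicator (X i) x \<partial>M) \<partial>count_space I)"
    by (rule nn_integral_count_space_nn_integral) (use assms in auto)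
  also have "\<dots> = (\<integral>\<^sup>+i. emeasure M (X i) \<partial>count_space I)"
    using assms by (intro nn_integral_cong) auto
  finally show ?thesis .
qed

text \<open>If the total mass is finite, the balls that witness a large maximal function have bounded
  radii. By Vitali's covering lemma, disjoint ones among them cover the set after enlargement
  by the factor five, and their masses add up to at most the total mass.\<close>

lemma hl_max_weak_type:
  fixes w :: "'a::euclidean_space \<Rightarrow> ennreal"
  assumes w [measurable]: "w \<in> borel_measurable borel" and t: "0 < t"
  shows "ennreal t * emeasure lborel {x. ennreal t < hl_max w x}
    \<le> ennreal (unit_ball_vol DIM('a) * 5 ^ DIM('a)) * (\<integral>\<^sup>+y. w y \<partial>lborel)"
proof (cases "(\<integral>\<^sup>+y. w y \<partial>lborel) = \<infinity>")
  case True
  moreover have "unit_ball_vol (real DIM('a)) \<noteq> 0"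
    by (metis less_irrefl unit_ball_vol_pos of_nat_0_le_iff)
  ultimately show ?thesis using unit_ball_vol_pos[of "real DIM('a)"]
    by (simp add: ennreal_mult_top del: unit_ball_vol_pos)
next
  case False
  let ?n = "DIM('a)"
  define I where "I = enn2real (\<integral>\<^sup>+y. w y \<partial>lborel)"
  have I: "(\<integral>\<^sup>+y. w y \<partial>lborel) = ennreal I" "0 \<le> I"
    using False by (auto simp: I_def less_top)
  define S where "S = {x. ennreal t < hl_max w x}"
  have "\<forall>x\<in>S. \<exists>r>0. ennreal t * ennreal (r ^ ?n) < (\<integral>\<^sup>+y\<in>ball x r. w y \<partial>lborel)"
    by (auto simp: S_def hl_max_greater_iff)
  then obtain \<rho> where rho: "\<And>x. x \<in> S \<Longrightarrow> 0 < \<rho> x"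
     "\<And>x. x \<in> S \<Longrightarrow> ennreal t * ennreal (\<rho> x ^ ?n) < (\<integral>\<^sup>+y\<in>ball x (\<rho> x). w y \<partial>lborel)"
    by metis
  have bnd: "\<rho> x \<le> max 1 (I / t)" if "x \<in> S" for x
  proof (rule ccontr)
    assume "\<not> ?thesis"
    then have *: "1 < \<rho> x" "I / t < \<rho> x" by auto
    have "ennreal (t * \<rho> x ^ ?n) = ennreal t * ennreal (\<rho> x ^ ?n)"
      using t by (intro ennreal_mult') simp
    also have "\<dots> < (\<integral>\<^sup>+y\<in>ball x (\<rho> x). w y \<partial>lborel)"
      by (rule rho(2)[OF that])
    also have "\<dots> \<le> (\<integral>\<^sup>+y. w y \<partial>lborel)"
      by (intro nn_integral_mono) (auto split: split_indicator)
    finally have "ennreal (t * \<rho> x ^ ?n) < ennreal I" unfolding I(1) .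
    then have "t * \<rho> x ^ ?n < I"
      using t rho(1)[OF that] by (subst (asm) ennreal_less_iff) auto
    moreover have "\<rho> x \<le> \<rho> x ^ ?n" using * by (intro self_le_power) auto
    then have "t * \<rho> x \<le> t * \<rho> x ^ ?n" using t by simp
    moreover have "I < t * \<rho> x" using *(2) t by (simp add: field_simps)
    ultimately show False by linarith
  qed
  obtain C where C: "countable C" "C \<subseteq> S"
     "pairwise (\<lambda>i j. disjnt (cball i (\<rho> i)) (cball j (\<rho> j))) C"
     "S \<subseteq> (\<Union>i\<in>C. cball i (5 * \<rho> i))"
  proof (rule Vitali_covering_lemma_cballs[where S=S and K=S and a="\<lambda>x. x" and r=\<rho> and B="max 1 (I/t)"])
    show "S \<subseteq> (\<Union>i\<in>S. cball i (\<rho> i))" 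
    proof
      fix x assume "x \<in> S"
      then have "x \<in> cball x (\<rho> x)" using rho(1)[of x] by simp
      then show "x \<in> (\<Union>i\<in>S. cball i (\<rho> i))" using \<open>x \<in> S\<close> by blast
    qed
  qed (use rho(1) bnd in auto)
  have disj: "disjoint_family_on (\<lambda>i. cball i (\<rho> i)) C"
    using C(3) by (auto simp: disjoint_family_on_def pairwise_def disjnt_def)
  have "emeasure lborel S \<le> emeasure lborel (\<Union>i\<in>C. cball i (5 * \<rho> i))"
    using C by (intro emeasure_mono sets.countable_UN'') auto
  also have "emeasure lborel (\<Union>i\<in>C. cball i (5 * \<rho> i))
     \<le> (\<integral>\<^sup>+i. emeasure lborel (cball i (5 * \<rho> i)) \<partial>count_space C)"
    by (rule emeasure_UN_le_nn_integral) (use C in auto)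
  also have "\<dots> \<le> (\<integral>\<^sup>+i. ennreal (unit_ball_vol ?n * 5 ^ ?n) * ennreal (\<rho> i ^ ?n) \<partial>count_space C)"
  proof (intro nn_integral_mono)
    fix i assume "i \<in> space (count_space C)"
    then have "0 < \<rho> i" using rho(1) C(2) by auto
    then show "emeasure lborel (cball i (5 * \<rho> i))
        \<le> ennreal (unit_ball_vol ?n * 5 ^ ?n) * ennreal (\<rho> i ^ ?n)"
      by (simp add: emeasure_ball_power(2) power_mult_distrib ennreal_mult'[symmetric] mult.assoc)
  qed
  finally have "ennreal t * emeasure lborel S \<le>
      ennreal t * (\<integral>\<^sup>+i. ennreal (unit_ball_vol ?n * 5 ^ ?n) * ennreal (\<rho> i ^ ?n) \<partial>count_space C)"
    by (rule mult_left_mono) simp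
  also have "\<dots> = ennreal (unit_ball_vol ?n * 5 ^ ?n) * (\<integral>\<^sup>+i. ennreal t * ennreal (\<rho> i ^ ?n) \<partial>count_space C)"
    by (subst (1 2) nn_integral_cmult) (simp_all add: mult.left_commute)
  also have "\<dots> \<le> ennreal (unit_ball_vol ?n * 5 ^ ?n) * (\<integral>\<^sup>+i. emeasure (density lborel w) (cball i (\<rho> i)) \<partial>count_space C)"
  proof (intro mult_left_mono nn_integral_mono)
    fix i assume "i \<in> space (count_space C)"
    then have "i \<in> S" using C(2) by auto
    then have "ennreal t * ennreal (\<rho> i ^ ?n) \<le> (\<integral>\<^sup>+y\<in>ball i (\<rho> i). w y \<partial>lborel)"
      using rho(2) by (simp add: less_imp_le)
    also have "\<dots> \<le> (\<integral>\<^sup>+y\<in>cball i (\<rho> i). w y \<partial>lborel)"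
      by (rule nn_integral_ball_mono) auto
    also have "\<dots> = emeasure (density lborel w) (cball i (\<rho> i))"
      by (simp add: emeasure_density)
    finally show "ennreal t * ennreal (\<rho> i ^ ?n) \<le> emeasure (density lborel w) (cball i (\<rho> i))" .
  qed auto
  also have "(\<integral>\<^sup>+i. emeasure (density lborel w) (cball i (\<rho> i)) \<partial>count_space C)
      = emeasure (density lborel w) (\<Union>i\<in>C. cball i (\<rho> i))"
    by (rule emeasure_UN_countable[symmetric]) (use C disj in auto)
  also have "\<dots> \<le> emeasure (density lborel w) UNIV"
    by (rule emeasure_mono) auto
  also have "\<dots> = (\<integral>\<^sup>+y. w y \<partial>lborel)"
    by (simp add: emeasure_density)
  finally show ?thesis by (simp add: S_def mult_left_mono)
qed

lemma ennreal_square_le_layer_integral: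
  fixes Y :: ennreal
  shows "Y\<^sup>2 \<le> (\<integral>\<^sup>+t. ennreal (2 * t) * indicator {t. 0 < t \<and> ennreal t < Y} t \<partial>lborel)"
proof -
  have fin: "(ennreal y)\<^sup>2 \<le> (\<integral>\<^sup>+t. ennreal (2 * t) * indicator {t. 0 < t \<and> ennreal t < Y} t \<partial>lborel)"
    if y: "0 \<le> y" "ennreal y \<le> Y" for y
  proof -
    have "(ennreal y)\<^sup>2 = ennreal (y\<^sup>2 - 0\<^sup>2)" using y by (simp add: ennreal_power)
    also have "\<dots> = (\<integral>\<^sup>+t. ennreal (2 * t) * indicator {0..y} t \<partial>lborel)"
      using y by (intro nn_integral_FTC_Icc[symmetric]) (auto intro!: derivative_eq_intros)
    also have "\<dots> \<le> (\<integral>\<^sup>+t. ennreal (2 * t) * indicator {t. 0 < t \<and> ennreal t < Y} t \<partial>lborel)"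
    proof (rule nn_integral_mono_AE)
      have "AE t in lborel. t \<noteq> 0 \<and> t \<noteq> y" by (intro AE_conjI AE_lborel_singleton)
      then show "AE t in lborel. ennreal (2 * t) * indicator {0..y} t
          \<le> ennreal (2 * t) * indicator {t. 0 < t \<and> ennreal t < Y} t"
      proof eventually_elim
        fix t assume t: "t \<noteq> 0 \<and> t \<noteq> y"
        have "ennreal t < Y" if "0 \<le> t" "t \<le> y"
          using y that t by (intro less_le_trans[OF _ y(2)]) (simp add: ennreal_less_iff)
        then show "ennreal (2 * t) * indicator {0..y} t
          \<le> ennreal (2 * t) * indicator {t. 0 < t \<and> ennreal t < Y} t"
          using t by (auto split: split_indicator)
      qed
    qed
    finally show ?thesis .
  qed
  show ?thesis
  proof (cases Y)
    case (real r)
    then show ?thesis using fin[of r] by simp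
  next
    case top
    have "ennreal (real k) \<le> (\<integral>\<^sup>+t. ennreal (2 * t) * indicator {t. 0 < t \<and> ennreal t < Y} t \<partial>lborel)" for k
    proof -
      have "real k \<le> (real k)\<^sup>2" by (cases k) (auto simp: power2_eq_square)
      then have "ennreal (real k) \<le> (ennreal (real k))\<^sup>2"
        by (subst ennreal_power) (auto intro: ennreal_leI)
      then show ?thesis using fin[of "real k"] top by (auto intro: order_trans)
    qed
    then have "(\<integral>\<^sup>+t. ennreal (2 * t) * indicator {t. 0 < t \<and> ennreal t < Y} t \<partial>lborel) = top"
      by (metis ennreal_Ex_less_of_nat ennreal_of_nat_eq_real_of_nat leD top.not_eq_extremum)
    then show ?thesis by simp
  qed
qed

lemma layer_length_le:
  fixes Y :: ennreal
  shows "(\<integral>\<^sup>+t. indicator {t. 0 < t \<and> ennreal t < Y} t \<partial>lborel) \<le> Y"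
proof (cases Y)
  case (real r)
  have "{t. 0 < t \<and> ennreal t < Y} = {0<..<r}" using real by (auto simp: ennreal_less_iff)
  then show ?thesis using real by simp
qed simp

text \<open>The part of \<open>w\<close> below \<open>t/(2\<omega>)\<close> contributes at most
  \<open>t/2\<close> to any average, where \<open>\<omega>\<close> is the volume of the unit
  ball; the averages are normalised by \<open>r\<^sup>n\<close> instead of the volume.\<close>

lemma hl_max_truncation:
  fixes w :: "'a::euclidean_space \<Rightarrow> ennreal"
  assumes [measurable]: "w \<in> borel_measurable borel" and t: "0 < t" and M: "ennreal t < hl_max w x"
  defines "\<omega> \<equiv> unit_ball_vol (real DIM('a))"
  shows "ennreal (t / 2) < hl_max (\<lambda>y. w y * indicator {y. ennreal t < ennreal (2 * \<omega>) * w y} y) x"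
proof -
  let ?f = "\<lambda>y. w y * indicator {y. ennreal t < ennreal (2 * \<omega>) * w y} y"
  have om: "0 < \<omega>" unfolding \<omega>_def by simp
  have [measurable]: "ball x s \<in> sets borel" for s :: real by simp
  obtain r where r: "0 < r" "ennreal t * ennreal (r ^ DIM('a)) < (\<integral>\<^sup>+y\<in>ball x r. w y \<partial>lborel)"
    using M by (auto simp: hl_max_greater_iff)
  have le: "w y \<le> ?f y + ennreal (t / (2 * \<omega>))" for y
  proof (cases "ennreal t < ennreal (2 * \<omega>) * w y")
    case False
    then have "ennreal (2 * \<omega>) * w y \<le> ennreal t" by simp
    then have "w y \<le> ennreal (t / (2 * \<omega>))" using om t
      by (cases "w y") (auto simp: ennreal_mult[symmetric] ennreal_mult_top top_unique field_simps
          intro!: ennreal_leI)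
    then show ?thesis using False by simp
  qed simp
  have "(\<integral>\<^sup>+y\<in>ball x r. w y \<partial>lborel)
      \<le> (\<integral>\<^sup>+y. ?f y * indicator (ball x r) y + ennreal (t / (2 * \<omega>)) * indicator (ball x r) y \<partial>lborel)"
    using le by (intro nn_integral_mono) (auto split: split_indicator)
  also have "\<dots> = (\<integral>\<^sup>+y\<in>ball x r. ?f y \<partial>lborel) + ennreal (t / (2 * \<omega>)) * emeasure lborel (ball x r)"
    by (subst nn_integral_add) (auto simp: nn_integral_cmult_indicator)
  also have "ennreal (t / (2 * \<omega>)) * emeasure lborel (ball x r) = ennreal (t / 2) * ennreal (r ^ DIM('a))"
    using r(1) t om by (simp add: emeasure_ball_power \<omega>_def[symmetric] ennreal_mult[symmetric])
  finally have less: "ennreal t * ennreal (r ^ DIM('a))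
      < (\<integral>\<^sup>+y\<in>ball x r. ?f y \<partial>lborel) + ennreal (t / 2) * ennreal (r ^ DIM('a))"
    using r(2) by (rule less_le_trans[rotated])
  have "ennreal (t / 2) * ennreal (r ^ DIM('a)) < (\<integral>\<^sup>+y\<in>ball x r. ?f y \<partial>lborel)"
  proof (rule ccontr)
    assume "\<not> ?thesis"
    then have "(\<integral>\<^sup>+y\<in>ball x r. ?f y \<partial>lborel) + ennreal (t / 2) * ennreal (r ^ DIM('a))
      \<le> ennreal (t / 2) * ennreal (r ^ DIM('a)) + ennreal (t / 2) * ennreal (r ^ DIM('a))"
      by (intro add_right_mono) simp
    also have "\<dots> = ennreal t * ennreal (r ^ DIM('a))"
      using t r(1) by (simp add: ennreal_mult[symmetric] ennreal_plus[symmetric] del: ennreal_plus)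
    finally show False using less by simp
  qed
  then show ?thesis using r(1) by (auto simp: hl_max_greater_iff)
qed

text \<open>Marcinkiewicz interpolation: apply the weak bound at each level \<open>t\<close> to the part
  of \<open>w\<close> above a multiple of \<open>t\<close>, then integrate over the levels.\<close>

lemma hl_max_L2_bound:
  fixes w :: "'a::euclidean_space \<Rightarrow> ennreal"
  assumes w [measurable]: "w \<in> borel_measurable borel"
  shows "(\<integral>\<^sup>+x. (hl_max w x)\<^sup>2 \<partial>lborel)
    \<le> ennreal (8 * (unit_ball_vol DIM('a))\<^sup>2 * 5 ^ DIM('a)) * (\<integral>\<^sup>+x. (w x)\<^sup>2 \<partial>lborel)"
proof -
  define \<omega> where "\<omega> = unit_ball_vol (real DIM('a))"
  have om: "0 < \<omega>" unfolding \<omega>_def by simp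
  define C where "C = \<omega> * 5 ^ DIM('a)"
  have C: "0 < C" using om by (simp add: C_def)
  define f where "f t y = w y * indicator {y. ennreal t < ennreal (2 * \<omega>) * w y} y" for t y
  have [measurable]: "f t \<in> borel_measurable borel" for t unfolding f_def by measurable
  have "(\<integral>\<^sup>+x. (hl_max w x)\<^sup>2 \<partial>lborel)
     \<le> (\<integral>\<^sup>+x. (\<integral>\<^sup>+t. ennreal (2 * t) * indicator {t. 0 < t \<and> ennreal t < hl_max w x} t \<partial>lborel) \<partial>lborel)"
    by (intro nn_integral_mono ennreal_square_le_layer_integral)
  also have "\<dots> = (\<integral>\<^sup>+x. (\<integral>\<^sup>+t. ennreal (2 * t) * indicator {z. 0 < fst z \<and> ennreal (fst z) < hl_max w (snd z)} (t, x) \<partial>lborel) \<partial>lborel)"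
    by (intro nn_integral_cong) (auto split: split_indicator)
  also have "\<dots> = (\<integral>\<^sup>+t. (\<integral>\<^sup>+x. ennreal (2 * t) * indicator {z. 0 < fst z \<and> ennreal (fst z) < hl_max w (snd z)} (t, x) \<partial>lborel) \<partial>lborel)"
    by (rule lborel_pair.Fubini') measurable
  also have "\<dots> \<le> (\<integral>\<^sup>+t. (\<integral>\<^sup>+x. ennreal (4 * C) * (w x * indicator {z. 0 < fst z \<and> ennreal (fst z) < ennreal (2 * \<omega>) * w (snd z)} (t, x)) \<partial>lborel) \<partial>lborel)"
  proof (rule nn_integral_mono)
    fix t :: real
    show "(\<integral>\<^sup>+x. ennreal (2 * t) * indicator {z. 0 < fst z \<and> ennreal (fst z) < hl_max w (snd z)} (t, x) \<partial>lborel)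
      \<le> (\<integral>\<^sup>+x. ennreal (4 * C) * (w x * indicator {z. 0 < fst z \<and> ennreal (fst z) < ennreal (2 * \<omega>) * w (snd z)} (t, x)) \<partial>lborel)"
    proof (cases "0 < t")
      case True
      have "(\<integral>\<^sup>+x. ennreal (2 * t) * indicator {z. 0 < fst z \<and> ennreal (fst z) < hl_max w (snd z)} (t, x) \<partial>lborel)
         \<le> (\<integral>\<^sup>+x. ennreal (2 * t) * indicator {x. ennreal (t / 2) < hl_max (f t) x} x \<partial>lborel)"
        using hl_max_truncation[OF w True]
        by (intro nn_integral_mono) (auto simp: f_def[abs_def] \<omega>_def split: split_indicator)
      also have "\<dots> = ennreal (2 * t) * emeasure lborel {x. ennreal (t / 2) < hl_max (f t) x}"
        by (rule nn_integral_cmult_indicator) simp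
      also have "\<dots> = ennreal 4 * (ennreal (t / 2) * emeasure lborel {x. ennreal (t / 2) < hl_max (f t) x})"
        using True by (simp add: mult.assoc[symmetric] ennreal_mult[symmetric] del: ennreal_numeral)
      also have "\<dots> \<le> ennreal 4 * (ennreal C * (\<integral>\<^sup>+x. f t x \<partial>lborel))"
        using hl_max_weak_type[of "f t" "t / 2"] True
        by (intro mult_left_mono) (auto simp: C_def \<omega>_def)
      also have "\<dots> = (\<integral>\<^sup>+x. ennreal (4 * C) * f t x \<partial>lborel)"
        using C by (simp add: nn_integral_cmult mult.assoc[symmetric] ennreal_mult del: ennreal_numeral)
      also have "\<dots> = (\<integral>\<^sup>+x. ennreal (4 * C) * (w x * indicator {z. 0 < fst z \<and> ennreal (fst z) < ennreal (2 * \<omega>) * w (snd z)} (t, x)) \<partial>lborel)"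
        using True by (intro nn_integral_cong) (auto simp: f_def split: split_indicator)
      finally show ?thesis .
    qed simp
  qed
  also have "\<dots> = (\<integral>\<^sup>+x. (\<integral>\<^sup>+t. ennreal (4 * C) * (w x * indicator {z. 0 < fst z \<and> ennreal (fst z) < ennreal (2 * \<omega>) * w (snd z)} (t, x)) \<partial>lborel) \<partial>lborel)"
    by (rule lborel_pair.Fubini'[symmetric]) measurable
  also have "\<dots> = (\<integral>\<^sup>+x. ennreal (4 * C) * (w x * (\<integral>\<^sup>+t. indicator {t. 0 < t \<and> ennreal t < ennreal (2 * \<omega>) * w x} t \<partial>lborel)) \<partial>lborel)"
    by (intro nn_integral_cong) (simp add: nn_integral_cmult indicator_def)
  also have "\<dots> \<le> (\<integral>\<^sup>+x. ennreal (4 * C) * (w x * (ennreal (2 * \<omega>) * w x)) \<partial>lborel)"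
    by (intro nn_integral_mono mult_left_mono layer_length_le) auto
  also have "\<dots> = (\<integral>\<^sup>+x. ennreal (8 * \<omega> * C) * (w x)\<^sup>2 \<partial>lborel)"
  proof (intro nn_integral_cong)
    fix x
    have "ennreal (8 * \<omega> * C) = ennreal (4 * C) * ennreal (2 * \<omega>)"
      using om C by (subst ennreal_mult[symmetric]) (auto simp: mult_ac)
    then show "ennreal (4 * C) * (w x * (ennreal (2 * \<omega>) * w x)) = ennreal (8 * \<omega> * C) * (w x)\<^sup>2"
      by (simp only: power2_eq_square mult_ac)
  qed
  also have "\<dots> = ennreal (8 * \<omega> * C) * (\<integral>\<^sup>+x. (w x)\<^sup>2 \<partial>lborel)"
    by (rule nn_integral_cmult) simp
  finally show ?thesis by (simp add: C_def \<omega>_def power2_eq_square mult_ac)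
qed

section \<open>Lebesgue points\<close>

text \<open>The measure with density \<open>v\<close>, restricted to a ball, does not charge the zero
  set of \<open>v\<close>. By outer regularity this zero set has open neighbourhoods of
  arbitrarily small mass, and near a zero the averages of \<open>v\<close> only see such a
  neighbourhood. The weak maximal inequality then bounds the measure of the set of bad points.\<close>

lemma averages_tendsto_zero:
  fixes v :: "'a::euclidean_space \<Rightarrow> ennreal"
  assumes v [measurable]: "v \<in> borel_measurable borel"
    and loc: "\<And>N::nat. (\<integral>\<^sup>+y\<in>ball 0 (real N). v y \<partial>lborel) < \<infinity>"
    and e: "0 < e"
  shows "AE x in lborel. v x = 0 \<longrightarrow>
    (\<forall>\<^sub>F r in at_right 0. (\<integral>\<^sup>+y\<in>ball x r. v y \<partial>lborel) \<le> ennreal (e * r ^ DIM('a)))"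
proof -
  have [measurable]: "ball x s \<in> sets borel" for x :: 'a and s :: real by simp
  define C where "C = unit_ball_vol (real DIM('a)) * 5 ^ DIM('a)"
  have C: "0 < C" by (simp add: C_def)
  have "AE x in lborel. x \<in> ball 0 (real N) \<longrightarrow> v x = 0 \<longrightarrow>
    (\<forall>\<^sub>F r in at_right 0. (\<integral>\<^sup>+y\<in>ball x r. v y \<partial>lborel) \<le> ennreal (e * r ^ DIM('a)))" for N
  proof -
    define \<nu> where "\<nu> = density lborel (\<lambda>y. v y * indicator (ball 0 (real N)) y)"
    define E where "E = {x \<in> ball 0 (real N). v x = 0}"
    have [measurable]: "E \<in> sets borel" unfolding E_def by measurable
    have sets: "sets \<nu> = sets borel" by (simp add: \<nu>_def)
    have fin: "emeasure \<nu> (space \<nu>) \<noteq> \<infinity>"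
      using loc[of N] by (simp add: \<nu>_def emeasure_density)
    have "emeasure \<nu> E = (\<integral>\<^sup>+y. (v y * indicator (ball 0 (real N)) y) * indicator E y \<partial>lborel)"
      unfolding \<nu>_def by (rule emeasure_density) auto
    also have "\<dots> = 0" by (auto simp: nn_integral_0_iff_AE E_def split: split_indicator)
    finally have "(INF U\<in>{U. E \<subseteq> U \<and> open U}. emeasure \<nu> U) = 0"
      using outer_regular[OF sets fin, of E] by simp
    then have "\<exists>U. E \<subseteq> U \<and> open U \<and> emeasure \<nu> U < ennreal (1 / (real k + 1))" for k
      using INF_less_iff[of "emeasure \<nu>" "{U. E \<subseteq> U \<and> open U}" "ennreal (1 / (real k + 1))"] by auto
    \<comment> \<open>Neighbourhoods of the zero set whose mass tends to zero.\<close>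
    then obtain U where U: "\<And>k. E \<subseteq> U k" "\<And>k. open (U k)" 
       "\<And>k. emeasure \<nu> (U k) < ennreal (1 / (real k + 1))" by metis
    have [measurable]: "U k \<in> sets borel" for k using U(2) by auto
    \<comment> \<open>Bad points lie in \<open>W k\<close> for every \<open>k\<close>.\<close>
    define w where "w k y = v y * indicator (U k \<inter> ball 0 (real N)) y" for k y
    have [measurable]: "w k \<in> borel_measurable borel" for k unfolding w_def by measurable
    define W where "W k = {x. ennreal e < hl_max (w k) x}" for k
    have [measurable]: "W k \<in> sets borel" for k unfolding W_def by simp
    have Wk: "emeasure lborel (W k) \<le> ennreal (C / e / (real k + 1))" for k
    proof -
      have "(\<integral>\<^sup>+y. w k y \<partial>lborel) = emeasure \<nu> (U k)"
        unfolding \<nu>_def by (subst emeasure_density) (auto simp: w_def intro!: nn_integral_cong split: split_indicator)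
      then have "ennreal e * emeasure lborel (W k) \<le> ennreal C * ennreal (1 / (real k + 1))"
        using hl_max_weak_type[of "w k" e] U(3)[of k] e
        by (auto simp: W_def C_def intro: order_trans[OF _ mult_left_mono] less_imp_le)
      moreover have "0 < e + e * real k" using e by (simp add: add_pos_nonneg)
      ultimately show ?thesis using e C
        by (cases "emeasure lborel (W k)")
          (auto simp: ennreal_mult[symmetric] ennreal_mult_top top_unique field_simps intro!: ennreal_leI)
    qed
    have "emeasure lborel (\<Inter>k. W k) \<le> 0"
    proof (rule tendsto_lowerbound)
      have "(\<lambda>k. C / e / (real k + 1)) \<longlonglongrightarrow> 0" by real_asymp
      then have "(\<lambda>k. ennreal (C / e / (real k + 1))) \<longlonglongrightarrow> ennreal 0"
        by (rule tendsto_ennrealI)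
      then show "(\<lambda>k. ennreal (C / e / (real k + 1))) \<longlonglongrightarrow> 0" by simp
      show "\<forall>\<^sub>F k in sequentially. emeasure lborel (\<Inter>k. W k) \<le> ennreal (C / e / (real k + 1))"
      proof (intro always_eventually allI)
        fix k
        have "emeasure lborel (\<Inter>k. W k) \<le> emeasure lborel (W k)"
          by (rule emeasure_mono) auto
        then show "emeasure lborel (\<Inter>k. W k) \<le> ennreal (C / e / (real k + 1))"
          using Wk order_trans by blast
      qed
    qed simp
    then have "(\<Inter>k. W k) \<in> null_sets lborel" by (intro null_setsI) auto
    then have "AE x in lborel. x \<notin> (\<Inter>k. W k)" by (rule AE_not_in)
    then show ?thesis
    proof (eventually_elim, intro impI)
      fix x assume "x \<notin> (\<Inter>k. W k)" and x: "x \<in> ball 0 (real N)" "v x = 0"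
      then obtain k where k: "x \<notin> W k" by auto
      have "x \<in> U k \<inter> ball 0 (real N)" using U(1)[of k] x by (auto simp: E_def)
      moreover have "open (U k \<inter> ball 0 (real N))" using U(2) by auto
      ultimately obtain d where d: "0 < d" "ball x d \<subseteq> U k \<inter> ball 0 (real N)"
        by (meson open_contains_ball)
      have "(\<integral>\<^sup>+y\<in>ball x r. v y \<partial>lborel) \<le> ennreal (e * r ^ DIM('a))" if r: "0 < r" "r < d" for r
      proof -
        have "(\<integral>\<^sup>+y\<in>ball x r. v y \<partial>lborel) = (\<integral>\<^sup>+y\<in>ball x r. w k y \<partial>lborel)"
        proof (intro nn_integral_cong)
          fix y
          have "ball x r \<subseteq> ball x d" using r by (intro subset_ball) simp
          then have "y \<in> ball x r \<Longrightarrow> y \<in> U k \<inter> ball 0 (real N)" using d(2) by blast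
          then show "v y * indicator (ball x r) y = w k y * indicator (ball x r) y"
            by (cases "y \<in> ball x r") (auto simp: w_def)
        qed
        also have "\<dots> \<le> ennreal e * ennreal (r ^ DIM('a))"
          using k r by (auto simp: W_def hl_max_greater_iff not_less dest!: spec[of _ r])
        finally show ?thesis using e r by (simp add: ennreal_mult)
      qed
      then show "\<forall>\<^sub>F r in at_right 0. (\<integral>\<^sup>+y\<in>ball x r. v y \<partial>lborel) \<le> ennreal (e * r ^ DIM('a))"
        using d(1) by (auto simp: eventually_at_right_field)
    qed
  qed
  then have "AE x in lborel. \<forall>N. x \<in> ball 0 (real N) \<longrightarrow> v x = 0 \<longrightarrow>
    (\<forall>\<^sub>F r in at_right 0. (\<integral>\<^sup>+y\<in>ball x r. v y \<partial>lborel) \<le> ennreal (e * r ^ DIM('a)))"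
    unfolding AE_all_countable by blast
  then show ?thesis
  proof (eventually_elim)
    fix x :: 'a
    assume *: "\<forall>N. x \<in> ball 0 (real N) \<longrightarrow> v x = 0 \<longrightarrow>
      (\<forall>\<^sub>F r in at_right 0. (\<integral>\<^sup>+y\<in>ball x r. v y \<partial>lborel) \<le> ennreal (e * r ^ DIM('a)))"
    obtain N :: nat where "norm x < real N" using reals_Archimedean2 by blast
    then show "v x = 0 \<longrightarrow> (\<forall>\<^sub>F r in at_right 0. (\<integral>\<^sup>+y\<in>ball x r. v y \<partial>lborel) \<le> ennreal (e * r ^ DIM('a)))"
      using *[rule_format, of N] by auto
  qed
qed

text \<open>Apply the previous lemma to the positive part of \<open>|u - q| - d\<close> for all rational
  \<open>q\<close> and \<open>d > 0\<close>. This function vanishes wherever \<open>q\<close>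
  approximates \<open>u(x)\<close> to within \<open>d\<close>.\<close>

lemma AE_lebesgue_point:
  fixes u :: "'a::euclidean_space \<Rightarrow> real"
  assumes u [measurable]: "u \<in> borel_measurable borel"
    and loc: "\<And>N::nat. (\<integral>\<^sup>+y\<in>ball 0 (real N). ennreal \<bar>u y\<bar> \<partial>lborel) < \<infinity>"
  shows "AE x in lborel. \<forall>e>0. \<forall>\<^sub>F r in at_right 0.
    (\<integral>\<^sup>+y\<in>ball x r. ennreal \<bar>u y - u x\<bar> \<partial>lborel) \<le> ennreal (e * r ^ DIM('a))"
proof -
  have [measurable]: "ball x s \<in> sets borel" for x :: 'a and s :: real by simp
  define \<omega> where "\<omega> = unit_ball_vol (real DIM('a))"
  have om: "0 < \<omega>" by (simp add: \<omega>_def)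
  define v where "v q d y = ennreal (\<bar>u y - of_rat q\<bar> - of_rat d)" for q d y
  have [measurable]: "v q d \<in> borel_measurable borel" for q d unfolding v_def by measurable
  have locv: "(\<integral>\<^sup>+y\<in>ball 0 (real N). v q d y \<partial>lborel) < \<infinity>" if "0 < d" for q d N
  proof -
    have "(\<integral>\<^sup>+y\<in>ball 0 (real N). v q d y \<partial>lborel)
       \<le> (\<integral>\<^sup>+y. ennreal \<bar>u y\<bar> * indicator (ball 0 (real N)) y + ennreal \<bar>of_rat q\<bar> * indicator (ball 0 (real N)) y \<partial>lborel)"
    proof (intro nn_integral_mono)
      fix y :: 'a
      have "v q d y \<le> ennreal (\<bar>u y\<bar> + \<bar>of_rat q\<bar>)"
        unfolding v_def using that by (intro ennreal_leI) (smt (verit) zero_less_of_rat_iff)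
      then show "v q d y * indicator (ball 0 (real N)) y \<le> ennreal \<bar>u y\<bar> * indicator (ball 0 (real N)) y + ennreal \<bar>of_rat q\<bar> * indicator (ball 0 (real N)) y"
        by (auto split: split_indicator)
    qed
    also have "\<dots> = (\<integral>\<^sup>+y\<in>ball 0 (real N). ennreal \<bar>u y\<bar> \<partial>lborel) + ennreal \<bar>of_rat q\<bar> * emeasure lborel (ball (0::'a) (real N))"
      by (subst nn_integral_add) (auto simp: nn_integral_cmult_indicator)
    also have "\<dots> < \<infinity>"
      using loc[of N] by (auto simp: emeasure_ball_power ennreal_mult_less_top)
    finally show ?thesis .
  qed
  have "AE x in lborel. 0 < d \<longrightarrow> v q d x = 0 \<longrightarrow>
     (\<forall>\<^sub>F r in at_right 0. (\<integral>\<^sup>+y\<in>ball x r. v q d y \<partial>lborel) \<le> ennreal (of_rat d * r ^ DIM('a)))" for q d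
    using averages_tendsto_zero[of "v q d" "of_rat d"] locv[of d q] by (cases "0 < d") auto
  then have "AE x in lborel. \<forall>q d. 0 < d \<longrightarrow> v q d x = 0 \<longrightarrow>
     (\<forall>\<^sub>F r in at_right 0. (\<integral>\<^sup>+y\<in>ball x r. v q d y \<partial>lborel) \<le> ennreal (of_rat d * r ^ DIM('a)))"
    unfolding AE_all_countable by blast
  then show ?thesis
  proof (eventually_elim, intro allI impI)
    fix x :: 'a and e :: real
    assume *: "\<forall>q d. 0 < d \<longrightarrow> v q d x = 0 \<longrightarrow>
     (\<forall>\<^sub>F r in at_right 0. (\<integral>\<^sup>+y\<in>ball x r. v q d y \<partial>lborel) \<le> ennreal (of_rat d * r ^ DIM('a)))"
      and e: "0 < e"
    have "0 < e / (1 + 2 * \<omega>)" using e om by auto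
    \<comment> \<open>The average of \<open>v q d + 2d\<close> is at most \<open>d + 2 \<omega> d\<close> for
      small radii.\<close>
    then obtain d :: rat where d: "0 < (of_rat d :: real)" "of_rat d < e / (1 + 2 * \<omega>)"
      using of_rat_dense by blast
    obtain q :: rat where q: "u x - of_rat d < of_rat q" "of_rat q < u x"
      using of_rat_dense[of "u x - of_rat d" "u x"] d(1) by auto
    have "v q d x = 0" using q by (simp add: v_def ennreal_eq_0_iff)
    then have "\<forall>\<^sub>F r in at_right 0. (\<integral>\<^sup>+y\<in>ball x r. v q d y \<partial>lborel) \<le> ennreal (of_rat d * r ^ DIM('a))"
      using * d(1) by auto
    moreover have "\<forall>\<^sub>F r in at_right (0::real). 0 < r" by (simp add: eventually_at_filter)
    ultimately show "\<forall>\<^sub>F r in at_right 0. (\<integral>\<^sup>+y\<in>ball x r. ennreal \<bar>u y - u x\<bar> \<partial>lborel) \<le> ennreal (e * r ^ DIM('a))"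
    proof eventually_elim
      fix r :: real
      assume r: "(\<integral>\<^sup>+y\<in>ball x r. v q d y \<partial>lborel) \<le> ennreal (of_rat d * r ^ DIM('a))" "0 < r"
      have "(\<integral>\<^sup>+y\<in>ball x r. ennreal \<bar>u y - u x\<bar> \<partial>lborel)
         \<le> (\<integral>\<^sup>+y. v q d y * indicator (ball x r) y + ennreal (2 * of_rat d) * indicator (ball x r) y \<partial>lborel)"
      proof (intro nn_integral_mono)
        fix y
        have "ennreal \<bar>u y - u x\<bar> \<le> ennreal (max 0 (\<bar>u y - of_rat q\<bar> - of_rat d) + 2 * of_rat d)"
          using q by (intro ennreal_leI) auto
        also have "\<dots> = ennreal (max 0 (\<bar>u y - of_rat q\<bar> - of_rat d)) + ennreal (2 * of_rat d)"
          using d(1) by (intro ennreal_plus) auto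
        also have "ennreal (max 0 (\<bar>u y - of_rat q\<bar> - of_rat d)) = v q d y"
          by (auto simp: v_def max_def ennreal_neg)
        finally show "ennreal \<bar>u y - u x\<bar> * indicator (ball x r) y
           \<le> v q d y * indicator (ball x r) y + ennreal (2 * of_rat d) * indicator (ball x r) y"
          by (auto split: split_indicator)
      qed
      also have "\<dots> = (\<integral>\<^sup>+y\<in>ball x r. v q d y \<partial>lborel) + ennreal (2 * of_rat d) * emeasure lborel (ball x r)"
        by (subst nn_integral_add) (auto simp: nn_integral_cmult_indicator)
      also have "\<dots> \<le> ennreal (of_rat d * r ^ DIM('a)) + ennreal (2 * of_rat d) * emeasure lborel (ball x r)"
        using r(1) by (rule add_right_mono)
      also have "\<dots> = ennreal (of_rat d * (1 + 2 * \<omega>) * r ^ DIM('a))"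
        using d(1) r(2) om
        by (simp add: emeasure_ball_power ennreal_mult[symmetric] ennreal_plus[symmetric]
            \<omega>_def[symmetric] algebra_simps del: ennreal_plus)
      also have "\<dots> \<le> ennreal (e * r ^ DIM('a))"
      proof (intro ennreal_leI mult_right_mono)
        show "of_rat d * (1 + 2 * \<omega>) \<le> e" using d(2) om by (simp add: field_simps)
      qed (use r in auto)
      finally show "(\<integral>\<^sup>+y\<in>ball x r. ennreal \<bar>u y - u x\<bar> \<partial>lborel) \<le> ennreal (e * r ^ DIM('a))" .
    qed
  qed
qed

section \<open>Test functions and the Laplacian\<close>

definition smooth_fun :: "(real^'n::finite \<Rightarrow> real) \<Rightarrow> bool" where
  "smooth_fun f \<longleftrightarrow> (\<forall>\<nu> x. iter_deriv \<nu> f differentiable (at x))"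

lemma iter_deriv_simps [simp]:
  "iter_deriv [] f = f" "iter_deriv (i # \<nu>) f = partial_deriv i (iter_deriv \<nu> f)"
  by (simp_all add: iter_deriv_def)

lemma iter_deriv_append: "iter_deriv (\<mu> @ \<nu>) f = iter_deriv \<mu> (iter_deriv \<nu> f)"
  by (simp add: iter_deriv_def)

text \<open>The counterpart in several variables of coinduction for smooth profiles.\<close>

lemma smooth_funI_closed:
  assumes "f \<in> S" and "\<And>g x. g \<in> S \<Longrightarrow> g differentiable (at x)"
    and "\<And>g i. g \<in> S \<Longrightarrow> partial_deriv i g \<in> S"
  shows "smooth_fun f"
proof -
  have "iter_deriv \<nu> f \<in> S" for \<nu>
    by (induction \<nu>) (use assms(1,3) in auto)
  then show ?thesis using assms(2) by (auto simp: smooth_fun_def)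
qed

lemma smooth_fun_differentiable: "smooth_fun f \<Longrightarrow> f differentiable (at x)"
  unfolding smooth_fun_def by (metis iter_deriv_simps(1))

lemma smooth_fun_iter_deriv: "smooth_fun f \<Longrightarrow> smooth_fun (iter_deriv \<nu> f)"
  unfolding smooth_fun_def by (metis iter_deriv_append)

lemma smooth_fun_partial_deriv: "smooth_fun f \<Longrightarrow> smooth_fun (partial_deriv i f)"
  using smooth_fun_iter_deriv[of f "[i]"] by simp

lemma smooth_fun_continuous_on: "smooth_fun f \<Longrightarrow> continuous_on S f"
  by (meson continuous_at_imp_continuous_on differentiable_imp_continuous_within smooth_fun_differentiable)

lemma partial_deriv_eq: "(f has_derivative f') (at x) \<Longrightarrow> partial_deriv i f x = f' (axis i 1)"
  unfolding partial_deriv_def by (metis frechet_derivative_at)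

lemma partial_deriv_add:
  assumes "f differentiable (at x)" "g differentiable (at x)"
  shows "partial_deriv i (\<lambda>y. f y + g y) x = partial_deriv i f x + partial_deriv i g x"
  using partial_deriv_eq[OF has_derivative_add[OF assms[unfolded frechet_derivative_works]]]
  by (simp add: partial_deriv_def)

lemma partial_deriv_mult:
  assumes "f differentiable (at x)" "g differentiable (at x)"
  shows "partial_deriv i (\<lambda>y. f y * g y) x = f x * partial_deriv i g x + partial_deriv i f x * g x"
  using partial_deriv_eq[OF has_derivative_mult[OF assms[unfolded frechet_derivative_works]]]
  by (simp add: partial_deriv_def)

lemma partial_deriv_const: "partial_deriv i (\<lambda>y. c) x = 0"
  by (rule partial_deriv_eq[OF has_derivative_const])

lemma smooth_fun_const: "smooth_fun (\<lambda>x. c)"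
proof (rule smooth_funI_closed[where S = "range (\<lambda>c x. c)"])
  show "(\<lambda>x. c) \<in> range (\<lambda>c x. c)" by auto
  fix g :: "real^'n \<Rightarrow> real" and i assume "g \<in> range (\<lambda>c x. c)"
  then show "partial_deriv i g \<in> range (\<lambda>c x. c)"
    by (auto simp: partial_deriv_const[abs_def] fun_eq_iff)
qed auto

lemma smooth_fun_add:
  assumes "smooth_fun f" "smooth_fun g"
  shows "smooth_fun (\<lambda>x. f x + g x)"
proof (rule smooth_funI_closed[where S = "{h. \<exists>f g. h = (\<lambda>x. f x + g x) \<and> smooth_fun f \<and> smooth_fun g}"])
  show "(\<lambda>x. f x + g x) \<in> {h. \<exists>f g. h = (\<lambda>x. f x + g x) \<and> smooth_fun f \<and> smooth_fun g}"
    using assms by blast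
next
  fix h :: "real^'n \<Rightarrow> real" and x
  assume "h \<in> {h. \<exists>f g. h = (\<lambda>x. f x + g x) \<and> smooth_fun f \<and> smooth_fun g}"
  then obtain f g where "h = (\<lambda>x. f x + g x)" "smooth_fun f" "smooth_fun g" by blast
  then show "h differentiable at x" by (simp add: differentiable_add smooth_fun_differentiable)
next
  fix h :: "real^'n \<Rightarrow> real" and i
  assume "h \<in> {h. \<exists>f g. h = (\<lambda>x. f x + g x) \<and> smooth_fun f \<and> smooth_fun g}"
  then obtain f g where *: "h = (\<lambda>x. f x + g x)" "smooth_fun f" "smooth_fun g" by blast
  have "partial_deriv i h = (\<lambda>x. partial_deriv i f x + partial_deriv i g x)"
    unfolding *(1) using * by (intro ext partial_deriv_add smooth_fun_differentiable)
  then show "partial_deriv i h \<in> {h. \<exists>f g. h = (\<lambda>x. f x + g x) \<and> smooth_fun f \<and> smooth_fun g}"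
    using smooth_fun_partial_deriv[OF *(2)] smooth_fun_partial_deriv[OF *(3)] by blast
qed

lemma smooth_fun_sum:
  "(\<And>i. i \<in> I \<Longrightarrow> smooth_fun (f i)) \<Longrightarrow> smooth_fun (\<lambda>x. \<Sum>i\<in>I. f i x)"
  by (induction I rule: infinite_finite_induct) (auto intro: smooth_fun_add smooth_fun_const)

text \<open>Supports are controlled by radii, which combine more easily than compact sets.\<close>

lemma test_function_iff:
  "test_function \<phi> \<longleftrightarrow> smooth_fun \<phi> \<and> (\<exists>R. \<forall>x. R < norm x \<longrightarrow> \<phi> x = 0)"
proof
  assume t: "test_function \<phi>"
  then obtain K where K: "compact K" "\<And>x. x \<notin> K \<Longrightarrow> \<phi> x = 0" by (auto simp: test_function_def)
  obtain R where "\<forall>x\<in>K. norm x \<le> R" using compact_imp_bounded[OF K(1)] by (auto simp: bounded_iff)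
  then have "\<forall>x. R < norm x \<longrightarrow> \<phi> x = 0" using K(2) by (meson not_le)
  moreover have "smooth_fun \<phi>" using t unfolding test_function_def smooth_fun_def by blast
  ultimately show "smooth_fun \<phi> \<and> (\<exists>R. \<forall>x. R < norm x \<longrightarrow> \<phi> x = 0)" by blast
next
  assume "smooth_fun \<phi> \<and> (\<exists>R. \<forall>x. R < norm x \<longrightarrow> \<phi> x = 0)"
  then obtain R where "smooth_fun \<phi>" "\<And>x. R < norm x \<Longrightarrow> \<phi> x = 0" by blast
  then show "test_function \<phi>" unfolding test_function_def smooth_fun_def
    by (auto intro!: exI[of _ "cball 0 R"])
qed

lemma test_function_smooth: "test_function \<phi> \<Longrightarrow> smooth_fun \<phi>"
  by (simp add: test_function_iff)

lemma test_function_partial_deriv: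
  assumes "test_function \<phi>"
  shows "test_function (partial_deriv i \<phi>)"
proof -
  obtain R where R: "\<And>x. R < norm x \<Longrightarrow> \<phi> x = 0" using assms by (auto simp: test_function_iff)
  have "partial_deriv i \<phi> x = 0" if x: "R < norm x" for x
  proof -
    have "((\<lambda>x. 0) has_derivative (\<lambda>x. 0)) (at x)" by simp
    then have "(\<phi> has_derivative (\<lambda>x. 0)) (at x)"
      by (rule has_derivative_transform_within_open[where s = "- cball 0 R"]) (use x R in auto)
    then show ?thesis by (rule partial_deriv_eq)
  qed
  then show ?thesis using assms smooth_fun_partial_deriv unfolding test_function_iff by blast
qed

lemma test_function_iter_deriv: "test_function \<phi> \<Longrightarrow> test_function (iter_deriv \<nu> \<phi>)"
  by (induction \<nu>) (auto intro: test_function_partial_deriv)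

lemma test_function_sum:
  fixes f :: "'i \<Rightarrow> real^'n::finite \<Rightarrow> real"
  assumes "finite I" "\<And>i. i \<in> I \<Longrightarrow> test_function (f i)"
  shows "test_function (\<lambda>x. \<Sum>i\<in>I. f i x)"
proof -
  have "\<forall>i\<in>I. \<exists>R. \<forall>x. R < norm x \<longrightarrow> f i x = 0"
    using assms(2) by (auto simp: test_function_iff)
  then obtain R where R: "\<And>i x. i \<in> I \<Longrightarrow> R i < norm x \<Longrightarrow> f i x = 0" by metis
  have "(\<Sum>i\<in>I. f i x) = 0" if "Max (insert 0 (R ` I)) < norm x" for x
    using that assms(1) R by (intro sum.neutral) auto
  then show ?thesis
    using smooth_fun_sum[of I f] assms(2) unfolding test_function_iff by blast
qed

definition lap :: "(real^'n::finite \<Rightarrow> real) \<Rightarrow> real^'n \<Rightarrow> real" where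
  "lap f x = (\<Sum>i\<in>UNIV. iter_deriv [i, i] f x)"

lemma test_function_lap: "test_function \<phi> \<Longrightarrow> test_function (lap \<phi>)"
  unfolding lap_def[abs_def] by (intro test_function_sum test_function_iter_deriv) auto

lemma test_function_lap_pow: "test_function \<phi> \<Longrightarrow> test_function ((lap ^^ k) \<phi>)"
  by (induction k) (auto intro: test_function_lap)

text \<open>A family that contains the radial functions around \<open>x\<close> and is closed under
  partial derivatives: each derivative of a profile brings out a coordinate factor.\<close>

inductive_set radial_algebra :: "real^'n::finite \<Rightarrow> (real^'n \<Rightarrow> real) set" for x where
  profile: "smooth1 H \<Longrightarrow> (\<lambda>y. H ((norm (y - x))\<^sup>2)) \<in> radial_algebra x"
| coord: "f \<in> radial_algebra x \<Longrightarrow> (\<lambda>y. (y $ i - x $ i) * f y) \<in> radial_algebra x"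
| add: "f \<in> radial_algebra x \<Longrightarrow> g \<in> radial_algebra x \<Longrightarrow> (\<lambda>y. f y + g y) \<in> radial_algebra x"

lemma has_derivative_radial:
  assumes "smooth1 H"
  shows "((\<lambda>y. H ((norm (y - x))\<^sup>2)) has_derivative
    (\<lambda>h. deriv H ((norm (y - x))\<^sup>2) * (2 * ((y - x) \<bullet> h)))) (at (y :: real^'n::finite))"
proof -
  have 1: "((\<lambda>y. (norm (y - x))\<^sup>2) has_derivative (\<lambda>h. 2 * ((y - x) \<bullet> h))) (at y)"
    unfolding power2_norm_eq_inner
    by (auto intro!: derivative_eq_intros simp: inner_commute)
  have 2: "(H has_derivative (\<lambda>t. deriv H ((norm (y - x))\<^sup>2) * t)) (at ((norm (y - x))\<^sup>2))"
    using smooth1_has_deriv[OF assms] by (simp add: has_field_derivative_def)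
  show ?thesis using has_derivative_compose[OF 1 2] .
qed

lemma partial_deriv_radial:
  assumes "smooth1 H"
  shows "partial_deriv i (\<lambda>y. H ((norm (y - x))\<^sup>2)) = 
    (\<lambda>y. (y $ i - x $ i) * (2 * deriv H ((norm (y - x))\<^sup>2)))"
  by (rule ext) (simp add: partial_deriv_eq[OF has_derivative_radial[OF assms]] inner_axis)

lemma has_derivative_coord: "((\<lambda>y. y $ i - x $ i) has_derivative (\<lambda>h. h $ i)) (at (y :: real^'n::finite))"
  by (auto intro!: derivative_eq_intros bounded_linear_imp_has_derivative bounded_linear_vec_nth)

lemma differentiable_coord: "(\<lambda>y. y $ i - x $ i) differentiable (at (y :: real^'n::finite))"
  using has_derivative_coord differentiable_def by blast

lemma partial_deriv_coord:
  "partial_deriv j (\<lambda>y. y $ i - x $ i) (y :: real^'n::finite) = (if i = j then 1 else 0)"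
  by (simp add: partial_deriv_eq[OF has_derivative_coord] axis_def)

lemma radial_algebra_differentiable:
  "f \<in> radial_algebra x \<Longrightarrow> f differentiable (at y)"
proof (induction rule: radial_algebra.induct)
  case (profile H)
  then show ?case using has_derivative_radial differentiable_def by blast
next
  case (coord f i)
  then show ?case by (intro differentiable_mult differentiable_coord)
qed (rule differentiable_add)

lemma radial_algebra_partial_deriv:
  "f \<in> radial_algebra x \<Longrightarrow> partial_deriv j f \<in> radial_algebra x"
proof (induction rule: radial_algebra.induct)
  case (profile H)
  have "(\<lambda>y. 2 * deriv H ((norm (y - x))\<^sup>2)) \<in> radial_algebra x"
    using radial_algebra.profile[OF smooth1_cmult[OF smooth1_deriv[OF profile], of 2]] .
  then show ?case
    unfolding partial_deriv_radial[OF profile] by (rule radial_algebra.coord)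
next
  case (coord f i)
  have eq: "partial_deriv j (\<lambda>y. (y $ i - x $ i) * f y)
     = (\<lambda>y. (y $ i - x $ i) * partial_deriv j f y + (if i = j then f y else 0))"
    using radial_algebra_differentiable[OF coord(1)]
    by (intro ext) (simp add: partial_deriv_mult differentiable_coord partial_deriv_coord)
  show ?case
  proof (cases "i = j")
    case True
    then show ?thesis unfolding eq using coord by (auto intro: radial_algebra.intros)
  next
    case False
    then show ?thesis unfolding eq using coord by (auto intro: radial_algebra.intros)
  qed
next
  case (add f g)
  have eq: "partial_deriv j (\<lambda>y. f y + g y) = (\<lambda>y. partial_deriv j f y + partial_deriv j g y)"
    using add(1,2) by (intro ext partial_deriv_add radial_algebra_differentiable)
  show ?case unfolding eq using add by (auto intro: radial_algebra.add)
qed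

lemma smooth_fun_radial:
  "smooth1 H \<Longrightarrow> smooth_fun (\<lambda>y. H ((norm (y - x))\<^sup>2))"
  by (rule smooth_funI_closed[where S = "radial_algebra x"])
    (auto intro: radial_algebra.profile radial_algebra_differentiable radial_algebra_partial_deriv)

lemma test_function_radial:
  fixes x :: "real^'n::finite"
  assumes "smooth1 H" and z: "\<And>q. c \<le> q \<Longrightarrow> H q = 0"
  shows "test_function (\<lambda>y. H ((norm (y - x))\<^sup>2))"
proof -
  have "H ((norm (y - x))\<^sup>2) = 0" if "norm x + max 1 c < norm y" for y
  proof (rule z)
    have *: "max 1 c \<le> norm (y - x)" using that norm_triangle_ineq2[of y x] by linarith
    then have "norm (y - x) \<le> (norm (y - x))\<^sup>2" by (intro self_le_power) auto
    then show "c \<le> (norm (y - x))\<^sup>2" using * by linarith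
  qed
  then show ?thesis using smooth_fun_radial[OF assms(1)] unfolding test_function_iff by blast
qed

lemma lap_radial:
  assumes "smooth1 H"
  shows "lap (\<lambda>y. H ((norm (y - x))\<^sup>2)) = 
    (\<lambda>y::real^'n::finite. radial_lap CARD('n) H ((norm (y - x))\<^sup>2))"
proof
  fix y :: "real^'n"
  have s2: "smooth1 (\<lambda>q. 2 * deriv H q)" by (intro smooth1_cmult smooth1_deriv assms)
  have d: "deriv (\<lambda>q. 2 * deriv H q) q = 2 * deriv (deriv H) q" for q
    by (intro DERIV_imp_deriv DERIV_cmult smooth1_has_deriv smooth1_deriv assms)
  have diff: "(\<lambda>y. 2 * deriv H ((norm (y - x))\<^sup>2)) differentiable (at y)"
    by (rule radial_algebra_differentiable[OF radial_algebra.profile[OF s2]])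
  have "iter_deriv [i, i] (\<lambda>y. H ((norm (y - x))\<^sup>2)) y
     = 4 * deriv (deriv H) ((norm (y - x))\<^sup>2) * ((y $ i - x $ i) * (y $ i - x $ i)) + 2 * deriv H ((norm (y - x))\<^sup>2)" for i
    by (simp add: partial_deriv_radial[OF assms] partial_deriv_mult[OF differentiable_coord diff]
        partial_deriv_coord partial_deriv_radial[OF s2] d)
  then have "lap (\<lambda>y. H ((norm (y - x))\<^sup>2)) y
     = 4 * deriv (deriv H) ((norm (y - x))\<^sup>2) * (\<Sum>i\<in>UNIV. (y $ i - x $ i) * (y $ i - x $ i))
       + real CARD('n) * (2 * deriv H ((norm (y - x))\<^sup>2))"
    by (simp add: lap_def sum.distrib sum_distrib_left)
  also have "(\<Sum>i\<in>UNIV. (y $ i - x $ i) * (y $ i - x $ i)) = (norm (y - x))\<^sup>2"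
    by (simp add: power2_norm_eq_inner inner_vec_def)
  finally show "lap (\<lambda>y. H ((norm (y - x))\<^sup>2)) y = radial_lap CARD('n) H ((norm (y - x))\<^sup>2)"
    by (simp add: radial_lap_def)
qed

lemma lap_pow_radial:
  assumes "smooth1 H"
  shows "(lap ^^ k) (\<lambda>y. H ((norm (y - x))\<^sup>2)) = 
    (\<lambda>y::real^'n::finite. (radial_lap CARD('n) ^^ k) H ((norm (y - x))\<^sup>2))"
  by (induction k) (use lap_radial[OF smooth1_radial_lap_pow[OF assms]] in auto)

lemma continuous_bounded_support_integrable:
  fixes f :: "'a::euclidean_space \<Rightarrow> real"
  assumes "continuous_on UNIV f" and z: "\<And>x. R < norm x \<Longrightarrow> f x = 0"
  shows "integrable lborel f"
proof -
  have "integrable lborel (\<lambda>x. indicator (cball 0 R) x *\<^sub>R f x)"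
    by (intro borel_integrable_compact continuous_on_subset[OF assms(1)]) auto
  moreover have "(\<lambda>x. indicator (cball 0 R) x *\<^sub>R f x) = f"
    using z by (auto simp: fun_eq_iff indicator_def not_le)
  ultimately show ?thesis by simp
qed

lemma continuous_bounded_support_bounded:
  fixes f :: "'a::euclidean_space \<Rightarrow> real"
  assumes "continuous_on UNIV f" and z: "\<And>x. R < norm x \<Longrightarrow> f x = 0"
  obtains B where "0 < B" "\<And>x. \<bar>f x\<bar> \<le> B"
proof -
  have "compact (f ` cball 0 R)" by (intro compact_continuous_image continuous_on_subset[OF assms(1)]) auto
  then obtain B where B: "0 < B" "\<forall>y\<in>f ` cball 0 R. norm y \<le> B"
    using compact_imp_bounded bounded_pos by metis
  have "\<bar>f x\<bar> \<le> B" for x using B z[of x] by (cases "norm x \<le> R") auto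
  then show ?thesis using that B(1) by blast
qed

lemma lborel_integral_translation:
  fixes f :: "'a::euclidean_space \<Rightarrow> real"
  assumes [measurable]: "f \<in> borel_measurable borel"
  shows "(\<integral>x. f (c + x) \<partial>lborel) = (\<integral>x. f x \<partial>lborel)"
  using integral_distr[of "\<lambda>x. c + x" lborel lborel f] lborel_distr_plus[of c]
  by (simp add: distr_cong[of lborel lborel lborel borel])

text \<open>By translation invariance all difference quotients have integral zero, and they converge
  dominatedly.\<close>

lemma integral_partial_deriv_zero:
  fixes f :: "real^'n::finite \<Rightarrow> real"
  assumes diff: "\<And>x. f differentiable (at x)" and cont: "continuous_on UNIV (partial_deriv i f)"
    and z: "\<And>x. R < norm x \<Longrightarrow> f x = 0" "\<And>x. R < norm x \<Longrightarrow> partial_deriv i f x = 0"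
  shows "(\<integral>x. partial_deriv i f x \<partial>lborel) = 0"
proof -
  let ?e = "axis i 1 :: real^'n"
  have cf: "continuous_on UNIV f"
    by (simp add: continuous_at_imp_continuous_on diff differentiable_imp_continuous_within)
  have [measurable]: "f \<in> borel_measurable borel" "partial_deriv i f \<in> borel_measurable borel"
    using cf cont by (auto intro: borel_measurable_continuous_onI)
  obtain B where B: "0 < B" "\<And>x. \<bar>partial_deriv i f x\<bar> \<le> B"
    using continuous_bounded_support_bounded[OF cont z(2)] by blast
  have line: "((\<lambda>t. f (t *\<^sub>R ?e + x)) has_real_derivative partial_deriv i f (t *\<^sub>R ?e + x)) (at t)" for t x
  proof -
    have "(f has_derivative frechet_derivative f (at (t *\<^sub>R ?e + x))) (at (t *\<^sub>R ?e + x))"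
      using diff by (simp add: frechet_derivative_works)
    moreover have "((\<lambda>t. t *\<^sub>R ?e + x) has_derivative (\<lambda>h. h *\<^sub>R ?e)) (at t)"
      by (auto intro!: derivative_eq_intros)
    ultimately have 1: "((\<lambda>t. f (t *\<^sub>R ?e + x)) has_derivative
        (\<lambda>h. frechet_derivative f (at (t *\<^sub>R ?e + x)) (h *\<^sub>R ?e))) (at t)"
      using has_derivative_compose by blast
    have "linear (frechet_derivative f (at (t *\<^sub>R ?e + x)))"
      using diff by (rule linear_frechet_derivative)
    then have "frechet_derivative f (at (t *\<^sub>R ?e + x)) (h *\<^sub>R ?e) = partial_deriv i f (t *\<^sub>R ?e + x) * h" for h
      by (simp add: linear_cmul partial_deriv_def)
    then show ?thesis using 1 by (simp add: has_field_derivative_def)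
  qed
  define d where "d k x = (f ((1 / real (Suc k)) *\<^sub>R ?e + x) - f x) * real (Suc k)" for k x
  have "(\<lambda>k. \<integral>x. d k x \<partial>lborel) \<longlonglongrightarrow> (\<integral>x. partial_deriv i f x \<partial>lborel)"
  proof (rule integral_dominated_convergence[where w = "\<lambda>x. B * indicator (cball 0 (R + 1)) x"])
    show "integrable lborel (\<lambda>x :: real^'n. B * indicator (cball 0 (R + 1)) x)"
      by (intro integrable_mult_right integrable_real_indicator)
        (use emeasure_bounded_finite[OF bounded_cball[of "0 :: real^'n" "R + 1"]] in auto)
    show "AE x in lborel. (\<lambda>k. d k x) \<longlonglongrightarrow> partial_deriv i f x"
    proof (rule AE_I2)
      fix x :: "real^'n"
      have "((\<lambda>h. (f (h *\<^sub>R ?e + x) - f x) / h) \<longlongrightarrow> partial_deriv i f x) (at 0)"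
        using line[of x 0] by (simp add: has_field_derivative_iff)
      moreover have "filterlim (\<lambda>k. 1 / real (Suc k)) (at 0) sequentially"
      proof (rule filterlim_atI)
        show "(\<lambda>k. 1 / real (Suc k)) \<longlonglongrightarrow> 0" by real_asymp
      qed (simp add: always_eventually)
      ultimately have "(\<lambda>k. (f ((1 / real (Suc k)) *\<^sub>R ?e + x) - f x) / (1 / real (Suc k))) \<longlonglongrightarrow> partial_deriv i f x"
        by (rule filterlim_compose)
      then show "(\<lambda>k. d k x) \<longlonglongrightarrow> partial_deriv i f x" by (simp add: d_def)
    qed
    fix k
    show "AE x in lborel. norm (d k x) \<le> B * indicator (cball 0 (R + 1)) x"
    proof (rule AE_I2)
      fix x :: "real^'n"
      let ?h = "1 / real (Suc k)"
      have h: "0 < ?h" "?h \<le> 1" by auto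
      show "norm (d k x) \<le> B * indicator (cball 0 (R + 1)) x"
      proof (cases "norm x \<le> R + 1")
        case True
        obtain t where "f (?h *\<^sub>R ?e + x) - f (0 *\<^sub>R ?e + x) = (?h - 0) * partial_deriv i f (t *\<^sub>R ?e + x)"
          using MVT2[OF h(1) line[of x]] by blast
        then have "d k x = partial_deriv i f (t *\<^sub>R ?e + x)" by (simp add: d_def)
        then show ?thesis using True B by simp
      next
        case False
        have "norm x - norm (?h *\<^sub>R ?e) \<le> norm (?h *\<^sub>R ?e + x)"
          by (metis add.commute norm_diff_ineq)
        moreover have "norm (?h *\<^sub>R ?e) \<le> 1" by simp
        ultimately have "R < norm (?h *\<^sub>R ?e + x)" using False by linarith
        then show ?thesis using False z(1) by (simp add: d_def)
      qed
    qed
  qed (auto simp: d_def)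
  moreover have "(\<integral>x. d k x \<partial>lborel) = 0" for k
  proof -
    have i: "integrable lborel f" by (rule continuous_bounded_support_integrable[OF cf z(1)])
    have "integrable lborel (\<lambda>x. f ((1 / real (Suc k)) *\<^sub>R ?e + x))"
    proof (rule continuous_bounded_support_integrable)
      show "continuous_on UNIV (\<lambda>x. f ((1 / real (Suc k)) *\<^sub>R ?e + x))"
        by (intro continuous_on_compose2[OF cf] continuous_intros) auto
      fix x :: "real^'n" assume "R + 1 < norm x"
      moreover have "norm x - norm ((1 / real (Suc k)) *\<^sub>R ?e) \<le> norm ((1 / real (Suc k)) *\<^sub>R ?e + x)"
        by (metis add.commute norm_diff_ineq)
      moreover have "norm ((1 / real (Suc k)) *\<^sub>R ?e) \<le> 1" by simp
      ultimately show "f ((1 / real (Suc k)) *\<^sub>R ?e + x) = 0" by (intro z(1)) linarith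
    qed
    then show ?thesis unfolding d_def
      by (simp only: integral_mult_left_zero Bochner_Integration.integral_diff[OF _ i]
          lborel_integral_translation[OF \<open>f \<in> borel_measurable borel\<close>]) simp
  qed
  ultimately show ?thesis by (simp add: LIMSEQ_const_iff)
qed

lemma test_function_integration_by_parts:
  assumes \<phi>: "test_function \<phi>" and \<psi>: "test_function \<psi>"
  shows "(\<integral>x. \<phi> x * partial_deriv i \<psi> x \<partial>lborel) = - (\<integral>x. partial_deriv i \<phi> x * \<psi> x \<partial>lborel)"
proof -
  have sm: "smooth_fun \<phi>" "smooth_fun \<psi>" "smooth_fun (partial_deriv i \<phi>)" "smooth_fun (partial_deriv i \<psi>)"
    using \<phi> \<psi> by (auto intro: test_function_smooth smooth_fun_partial_deriv)
  obtain R where R: "\<And>x. R < norm x \<Longrightarrow> \<phi> x = 0" using \<phi> by (auto simp: test_function_iff)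
  obtain R' where R': "\<And>x. R' < norm x \<Longrightarrow> \<psi> x = 0" using \<psi> by (auto simp: test_function_iff)
  have eq: "partial_deriv i (\<lambda>x. \<phi> x * \<psi> x) = (\<lambda>x. \<phi> x * partial_deriv i \<psi> x + partial_deriv i \<phi> x * \<psi> x)"
    using sm by (intro ext partial_deriv_mult smooth_fun_differentiable)
  have cont: "continuous_on UNIV (\<lambda>x. \<phi> x * partial_deriv i \<psi> x)"
      "continuous_on UNIV (\<lambda>x. partial_deriv i \<phi> x * \<psi> x)"
    by (intro continuous_on_mult smooth_fun_continuous_on[OF sm(1)] smooth_fun_continuous_on[OF sm(2)]
      smooth_fun_continuous_on[OF sm(3)] smooth_fun_continuous_on[OF sm(4)])+
  have i1: "integrable lborel (\<lambda>x. \<phi> x * partial_deriv i \<psi> x)"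
    by (rule continuous_bounded_support_integrable[OF cont(1), of R]) (simp add: R)
  have i2: "integrable lborel (\<lambda>x. partial_deriv i \<phi> x * \<psi> x)"
    by (rule continuous_bounded_support_integrable[OF cont(2), of R']) (simp add: R')
  have "(\<integral>x. partial_deriv i (\<lambda>x. \<phi> x * \<psi> x) x \<partial>lborel) = 0"
  proof (rule integral_partial_deriv_zero[where R = "max R R'"])
    show "continuous_on UNIV (partial_deriv i (\<lambda>x. \<phi> x * \<psi> x))"
      unfolding eq by (intro continuous_intros cont)
    show "(\<lambda>x. \<phi> x * \<psi> x) differentiable at x" for x
      using sm by (intro differentiable_mult smooth_fun_differentiable)
  qed (auto simp: eq R R')
  then show ?thesis using i1 i2 by (simp add: eq)
qed

section \<open>Integrals of radial functions\<close>

text \<open>The distribution function of the squared distance is the volume \<open>\<omega>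
  a\<^sup>m\<close> of a ball of radius \<open>\<surd>a\<close>. This replaces polar
  coordinates.\<close>

lemma distr_squared_distance:
  fixes x :: "'a::euclidean_space"
  assumes n: "DIM('a) = 2 * m" and m: "1 \<le> m"
  defines "\<omega> \<equiv> unit_ball_vol (real DIM('a))"
  shows "distr lborel borel (\<lambda>y. (norm (y - x))\<^sup>2)
     = density lborel (\<lambda>q. ennreal (\<omega> * m * q ^ (m - 1)) * indicator {0..} q)"
    (is "?M = ?N")
proof (rule measure_eqI_generator_eq[where E = "range atMost" and \<Omega> = UNIV and A = "\<lambda>i. {..real i}"])
  have om: "0 < \<omega>" unfolding \<omega>_def by simp
  show "Int_stable (range atMost :: real set set)"
    by (auto simp: Int_stable_def)
  have "sets borel = sigma_sets UNIV (range (atMost :: real \<Rightarrow> real set))"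
    by (subst borel_eq_atMost) simp
  then show "sets ?M = sigma_sets UNIV (range atMost)" "sets ?N = sigma_sets UNIV (range atMost)"
    by auto
  have M: "emeasure ?M {..a} = (if a < 0 then 0 else ennreal (\<omega> * a ^ m))" for a
  proof -
    have "emeasure ?M {..a} = emeasure lborel ((\<lambda>y. (norm (y - x))\<^sup>2) -` {..a} \<inter> space lborel)"
      by (rule emeasure_distr) auto
    also have "(\<lambda>y. (norm (y - x))\<^sup>2) -` {..a} \<inter> space lborel = (if a < 0 then {} else cball x (sqrt a))"
    proof (cases "a < 0")
      case False
      have "(norm (y - x))\<^sup>2 \<le> a \<longleftrightarrow> dist x y \<le> sqrt a" for y
        using False by (metis dist_norm dist_commute norm_ge_zero not_less real_le_rsqrt
            real_sqrt_le_iff real_sqrt_unique sqrt_le_D)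
      then show ?thesis using False by auto
    qed (auto simp: not_le dest: order_trans[OF zero_le_power2])
    finally show ?thesis
      by (simp add: emeasure_ball_power(2) n power_mult real_sqrt_pow2 \<omega>_def ennreal_mult[symmetric])
  qed
  have N: "emeasure ?N {..a} = (if a < 0 then 0 else ennreal (\<omega> * a ^ m))" for a
  proof -
    have "emeasure ?N {..a} = (\<integral>\<^sup>+q. ennreal (\<omega> * m * q ^ (m - 1)) * indicator {0..a} q \<partial>lborel)"
      by (subst emeasure_density) (auto intro!: nn_integral_cong split: split_indicator)
    also have "\<dots> = (if a < 0 then 0 else ennreal (\<omega> * a ^ m))"
    proof (cases "a < 0")
      case False
      have "(\<integral>\<^sup>+q. ennreal (\<omega> * m * q ^ (m - 1)) * indicator {0..a} q \<partial>lborel) = ennreal (\<omega> * a ^ m - \<omega> * 0 ^ m)"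
      proof (rule nn_integral_FTC_Icc[where F = "\<lambda>q. \<omega> * q ^ m"])
        fix q :: real assume "q \<in> {0..a}"
        show "((\<lambda>q. \<omega> * q ^ m) has_real_derivative \<omega> * m * q ^ (m - 1)) (at q)"
          by (auto intro!: derivative_eq_intros)
      qed (use False om in auto)
      then show ?thesis using False m by (auto simp: power_0_left)
    qed auto
    finally show ?thesis .
  qed
  show "emeasure ?M X = emeasure ?N X" if "X \<in> range atMost" for X
    using that M N by auto
  show "(\<Union>i. {..real i}) = UNIV" using real_arch_simple by auto
  show "emeasure ?M {..real i} \<noteq> \<infinity>" for i by (simp add: M)
qed auto

lemma nn_integral_radial:
  fixes x :: "'a::euclidean_space"
  assumes n: "DIM('a) = 2 * m" and m: "1 \<le> m" and h [measurable]: "h \<in> borel_measurable borel"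
  shows "(\<integral>\<^sup>+y. h ((norm (y - x))\<^sup>2) \<partial>lborel) =
    (\<integral>\<^sup>+q. ennreal (unit_ball_vol (real DIM('a)) * m * q ^ (m - 1)) * indicator {0..} q * h q \<partial>lborel)"
proof -
  have "(\<integral>\<^sup>+y. h ((norm (y - x))\<^sup>2) \<partial>lborel) = (\<integral>\<^sup>+q. h q \<partial>distr lborel borel (\<lambda>y. (norm (y - x))\<^sup>2))"
    by (rule nn_integral_distr[symmetric]) auto
  also have "\<dots> = (\<integral>\<^sup>+q. ennreal (unit_ball_vol (real DIM('a)) * m * q ^ (m - 1)) * indicator {0..} q * h q \<partial>lborel)"
    unfolding distr_squared_distance[OF n m] by (rule nn_integral_density) auto
  finally show ?thesis .
qed

lemma integral_radial_profile:
  fixes x :: "'a::euclidean_space"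
  assumes n: "DIM('a) = 2 * m" and m: "1 \<le> m" and H: "smooth1 H"
    and z: "\<And>q. 1 \<le> q \<Longrightarrow> H q = 0" and b: "0 < b"
  shows "b ^ m * (\<integral>y. H (b * (norm (y - x))\<^sup>2) \<partial>lborel) = unit_ball_vol (real DIM('a)) * m * moment (m - 1) H"
proof -
  define c where "c = unit_ball_vol (real DIM('a)) * m"
  have c: "0 \<le> c" unfolding c_def by simp
  have cH: "continuous_on UNIV H" by (rule smooth1_continuous_on[OF H])
  then have [measurable]: "H \<in> borel_measurable borel" by (rule borel_measurable_continuous_onI)
  have "(\<integral>y. H (b * (norm (y - x))\<^sup>2) \<partial>lborel) = (\<integral>q. H (b * q) \<partial>distr lborel borel (\<lambda>y. (norm (y - x))\<^sup>2))"
    by (rule integral_distr[symmetric]) auto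
  also have "distr lborel borel (\<lambda>y. (norm (y - x))\<^sup>2) = density lborel (\<lambda>q. ennreal (c * q ^ (m - 1) * indicator {0..} q))"
    unfolding distr_squared_distance[OF n m] c_def
    by (intro arg_cong2[where f = density] refl ext) (auto split: split_indicator)
  also have "(\<integral>q. H (b * q) \<partial>density lborel (\<lambda>q. ennreal (c * q ^ (m - 1) * indicator {0..} q)))
     = (\<integral>q. (c * q ^ (m - 1) * indicator {0..} q) *\<^sub>R H (b * q) \<partial>lborel)"
    by (rule integral_density) (use c in \<open>auto split: split_indicator\<close>)
  also have "\<dots> = \<bar>1 / b\<bar> *\<^sub>R (\<integral>q. (c * (0 + (1 / b) * q) ^ (m - 1) * indicator {0..} (0 + (1 / b) * q)) *\<^sub>R H (b * (0 + (1 / b) * q)) \<partial>lborel)"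
    by (rule lborel_integral_real_affine) (use b in auto)
  also have "\<dots> = (1 / b) * (\<integral>q. (c / b ^ (m - 1)) * (indicator {0..1} q *\<^sub>R (q ^ (m - 1) * H q)) \<partial>lborel)"
  proof -
    have "(c * (0 + (1 / b) * q) ^ (m - 1) * indicator {0..} (0 + (1 / b) * q)) *\<^sub>R H (b * (0 + (1 / b) * q))
      = (c / b ^ (m - 1)) * (indicator {0..1} q *\<^sub>R (q ^ (m - 1) * H q))" for q
      using b z[of q] by (auto simp: power_divide zero_le_divide_iff split: split_indicator)
    then show ?thesis using b by simp
  qed
  also have "(\<integral>q. (c / b ^ (m - 1)) * (indicator {0..1} q *\<^sub>R (q ^ (m - 1) * H q)) \<partial>lborel)
     = (c / b ^ (m - 1)) * (\<integral>q. indicator {0..1} q *\<^sub>R (q ^ (m - 1) * H q) \<partial>lborel)"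
    by simp
  also have "(\<integral>q. indicator {0..1} q *\<^sub>R (q ^ (m - 1) * H q) \<partial>lborel) = moment (m - 1) H"
  proof -
    have "set_integrable lborel {0..1} (\<lambda>q. q ^ (m - 1) * H q)"
      by (intro borel_integrable_atLeastAtMost' continuous_intros continuous_on_subset[OF cH]) auto
    from set_borel_integral_eq_integral(2)[OF this] show ?thesis
      by (simp add: moment_def set_lebesgue_integral_def)
  qed
  finally have "(\<integral>y. H (b * (norm (y - x))\<^sup>2) \<partial>lborel) = (1 / b) * ((c / b ^ (m - 1)) * moment (m - 1) H)" .
  moreover have "b ^ m = b * b ^ (m - 1)" using m by (cases m) auto
  ultimately show ?thesis using b by (simp add: c_def)
qed

lemma radial_profile_support:
  assumes z: "\<And>q. 1 \<le> q \<Longrightarrow> H q = 0" and b: "0 < b" and "H (b * (norm (y - x))\<^sup>2) \<noteq> (0::real)"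
  shows "y \<in> ball x (1 / sqrt b)"
proof -
  have "b * (norm (y - x))\<^sup>2 < 1"
  proof (rule ccontr)
    assume "\<not> ?thesis"
    then have "H (b * (norm (y - x))\<^sup>2) = 0" by (intro z) simp
    then show False using assms(3) by simp
  qed
  then have "(sqrt b * norm (y - x))\<^sup>2 < 1\<^sup>2" using b by (simp add: power_mult_distrib)
  then have "sqrt b * norm (y - x) < 1" by (rule power_less_imp_less_base) simp
  then show ?thesis using b by (simp add: dist_norm norm_minus_commute field_simps)
qed

lemma integrable_mult_radial_profile:
  fixes u :: "'a::euclidean_space \<Rightarrow> real"
  assumes u [measurable]: "u \<in> borel_measurable borel"
    and loc: "\<And>N::nat. (\<integral>\<^sup>+y\<in>ball 0 (real N). ennreal \<bar>u y\<bar> \<partial>lborel) < \<infinity>"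
    and H: "smooth1 H" and z: "\<And>q. 1 \<le> q \<Longrightarrow> H q = 0" and b: "0 < b"
  shows "integrable lborel (\<lambda>y. u y * H (b * (norm (y - x))\<^sup>2))"
proof (rule integrableI_bounded)
  have [measurable]: "H \<in> borel_measurable borel"
    using smooth1_continuous_on[OF H, of UNIV] by (rule borel_measurable_continuous_onI)
  show "(\<lambda>y. u y * H (b * (norm (y - x))\<^sup>2)) \<in> borel_measurable lborel" by measurable
  obtain C where C: "0 < C" "\<And>q. 0 \<le> q \<Longrightarrow> \<bar>H q\<bar> \<le> C" using smooth1_bounded[OF H z] by blast
  obtain N :: nat where N: "norm x + 1 / sqrt b < real N" using reals_Archimedean2 by blast
  have [measurable]: "ball (0::'a) (real N) \<in> sets borel" by simp
  have "(\<integral>\<^sup>+y. norm (u y * H (b * (norm (y - x))\<^sup>2)) \<partial>lborel)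
     \<le> (\<integral>\<^sup>+y. ennreal C * (ennreal \<bar>u y\<bar> * indicator (ball 0 (real N)) y) \<partial>lborel)"
  proof (intro nn_integral_mono)
    fix y
    show "ennreal (norm (u y * H (b * (norm (y - x))\<^sup>2))) \<le> ennreal C * (ennreal \<bar>u y\<bar> * indicator (ball 0 (real N)) y)"
    proof (cases "H (b * (norm (y - x))\<^sup>2) = 0")
      case False
      from radial_profile_support[where H = H, OF z b False] have "norm (y - x) < 1 / sqrt b"
        by (simp add: dist_norm norm_minus_commute)
      then have "norm y < real N" using N norm_triangle_sub[of y x] by linarith
      moreover have "\<bar>u y * H (b * (norm (y - x))\<^sup>2)\<bar> \<le> C * \<bar>u y\<bar>"
        using C(2)[of "b * (norm (y - x))\<^sup>2"] b by (subst mult.commute) (simp add: abs_mult mult_right_mono)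
      ultimately show ?thesis using C(1)
        by (simp add: ennreal_mult[symmetric] ennreal_leI)
    qed simp
  qed
  also have "\<dots> = ennreal C * (\<integral>\<^sup>+y\<in>ball 0 (real N). ennreal \<bar>u y\<bar> \<partial>lborel)"
    by (rule nn_integral_cmult) measurable
  also have "\<dots> < \<infinity>" using loc[of N] by (simp add: ennreal_mult_less_top)
  finally show "(\<integral>\<^sup>+y. norm (u y * H (b * (norm (y - x))\<^sup>2)) \<partial>lborel) < \<infinity>" .
qed

text \<open>The kernels with profile \<open>b\<^sup>m H(bq)\<close> are bounded by a multiple of
  \<open>b\<^sup>m\<close>, live on balls of radius \<open>1/\<surd>b\<close> and all have the
  same total mass.\<close>

lemma approximate_identity_at_lebesgue_point:
  fixes u :: "'a::euclidean_space \<Rightarrow> real"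
  assumes n: "DIM('a) = 2 * m" and m: "1 \<le> m"
    and u [measurable]: "u \<in> borel_measurable borel"
    and loc: "\<And>N::nat. (\<integral>\<^sup>+y\<in>ball 0 (real N). ennreal \<bar>u y\<bar> \<partial>lborel) < \<infinity>"
    and x: "\<forall>e>0. \<forall>\<^sub>F r in at_right 0.
      (\<integral>\<^sup>+y\<in>ball x r. ennreal \<bar>u y - u x\<bar> \<partial>lborel) \<le> ennreal (e * r ^ DIM('a))"
    and H: "smooth1 H" and z: "\<And>q. 1 \<le> q \<Longrightarrow> H q = 0"
  shows "((\<lambda>b. b ^ m * (\<integral>y. u y * H (b * (norm (y - x))\<^sup>2) \<partial>lborel)) \<longlongrightarrow>
     u x * (unit_ball_vol (real DIM('a)) * m * moment (m - 1) H)) at_top"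
proof -
  let ?\<kappa> = "unit_ball_vol (real DIM('a)) * m * moment (m - 1) H"
  obtain C where C: "0 < C" "\<And>q. 0 \<le> q \<Longrightarrow> \<bar>H q\<bar> \<le> C" using smooth1_bounded[OF H z] by blast
  have [measurable]: "H \<in> borel_measurable borel"
    using smooth1_continuous_on[OF H, of UNIV] by (rule borel_measurable_continuous_onI)
  have [measurable]: "ball x r \<in> sets borel" for r :: real by simp
  have main: "\<forall>\<^sub>F b in at_top. \<bar>b ^ m * (\<integral>y. u y * H (b * (norm (y - x))\<^sup>2) \<partial>lborel) - u x * ?\<kappa>\<bar> \<le> C * e"
    if e: "0 < e" for e
  proof -
    have "filterlim (\<lambda>b::real. 1 / sqrt b) (at_right 0) at_top" by real_asymp
    with x e have "\<forall>\<^sub>F b in at_top. (\<integral>\<^sup>+y\<in>ball x (1 / sqrt b). ennreal \<bar>u y - u x\<bar> \<partial>lborel)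
        \<le> ennreal (e * (1 / sqrt b) ^ DIM('a))"
      by (auto simp: filterlim_iff)
    moreover have "\<forall>\<^sub>F b::real in at_top. 0 < b" by (rule eventually_gt_at_top)
    ultimately show ?thesis
    proof eventually_elim
      fix b :: real
      assume b: "0 < b" and le: "(\<integral>\<^sup>+y\<in>ball x (1 / sqrt b). ennreal \<bar>u y - u x\<bar> \<partial>lborel)
        \<le> ennreal (e * (1 / sqrt b) ^ DIM('a))"
      let ?h = "\<lambda>y. H (b * (norm (y - x))\<^sup>2)"
      have i1: "integrable lborel (\<lambda>y. u y * ?h y)"
        by (rule integrable_mult_radial_profile[OF u loc H z b])
      have "(\<integral>\<^sup>+y\<in>ball 0 (real N). ennreal \<bar>u x\<bar> \<partial>lborel) < \<infinity>" for N
        by (subst nn_integral_cmult_indicator) (auto simp: emeasure_ball_power ennreal_mult_less_top)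
      then have i2: "integrable lborel (\<lambda>y. u x * ?h y)"
        by (intro integrable_mult_radial_profile[OF _ _ H z b]) auto
      have "ennreal \<bar>\<integral>y. (u y - u x) * ?h y \<partial>lborel\<bar> \<le> (\<integral>\<^sup>+y. norm ((u y - u x) * ?h y) \<partial>lborel)"
        using i1 i2 integral_norm_bound_ennreal[of lborel "\<lambda>y. (u y - u x) * ?h y"]
        by (simp add: left_diff_distrib)
      also have "\<dots> \<le> (\<integral>\<^sup>+y. ennreal C * (ennreal \<bar>u y - u x\<bar> * indicator (ball x (1 / sqrt b)) y) \<partial>lborel)"
      proof (intro nn_integral_mono)
        fix y
        show "ennreal (norm ((u y - u x) * ?h y)) \<le> ennreal C * (ennreal \<bar>u y - u x\<bar> * indicator (ball x (1 / sqrt b)) y)"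
        proof (cases "?h y = 0")
          case False
          have "\<bar>u y - u x\<bar> * \<bar>?h y\<bar> \<le> \<bar>u y - u x\<bar> * C"
            using C(2)[of "b * (norm (y - x))\<^sup>2"] b by (intro mult_left_mono) auto
          then show ?thesis using radial_profile_support[where H = H, OF z b False] C(1)
            by (simp add: abs_mult ennreal_mult[symmetric] ennreal_leI mult.commute)
        qed simp
      qed
      also have "\<dots> = ennreal C * (\<integral>\<^sup>+y\<in>ball x (1 / sqrt b). ennreal \<bar>u y - u x\<bar> \<partial>lborel)"
        by (rule nn_integral_cmult) measurable
      also have "\<dots> \<le> ennreal C * ennreal (e * (1 / sqrt b) ^ DIM('a))"
        using le by (rule mult_left_mono) simp
      also have "\<dots> = ennreal (C * e / b ^ m)"
        using C b e by (simp add: ennreal_mult[symmetric] n power_mult power_divide)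
      finally have "\<bar>\<integral>y. (u y - u x) * ?h y \<partial>lborel\<bar> \<le> C * e / b ^ m"
        using C b e by (subst (asm) ennreal_le_iff) auto
      then have A: "\<bar>b ^ m * (\<integral>y. (u y - u x) * ?h y \<partial>lborel)\<bar> \<le> C * e"
        using b by (simp add: abs_mult field_simps)
      have B: "(\<integral>y. (u y - u x) * ?h y \<partial>lborel) = (\<integral>y. u y * ?h y \<partial>lborel) - u x * (\<integral>y. ?h y \<partial>lborel)"
        using i1 i2 by (simp add: left_diff_distrib)
      have "b ^ m * (\<integral>y. ?h y \<partial>lborel) = ?\<kappa>"
        by (rule integral_radial_profile[OF n m H z b])
      then have eq: "b ^ m * ((\<integral>y. u y * ?h y \<partial>lborel) - u x * (\<integral>y. ?h y \<partial>lborel))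
          = b ^ m * (\<integral>y. u y * ?h y \<partial>lborel) - u x * ?\<kappa>"
        by (simp add: right_diff_distrib mult.left_commute)
      show "\<bar>b ^ m * (\<integral>y. u y * ?h y \<partial>lborel) - u x * ?\<kappa>\<bar> \<le> C * e"
        using A unfolding B eq .
    qed
  qed
  show ?thesis
  proof (rule tendstoI)
    fix e :: real assume e: "0 < e"
    then have "0 < e / (2 * C)" using C by simp
    from main[OF this] show "\<forall>\<^sub>F b in at_top. dist (b ^ m * (\<integral>y. u y * H (b * (norm (y - x))\<^sup>2) \<partial>lborel)) (u x * ?\<kappa>) < e"
    proof eventually_elim
      case (elim b)
      then have "\<bar>b ^ m * (\<integral>y. u y * H (b * (norm (y - x))\<^sup>2) \<partial>lborel) - u x * ?\<kappa>\<bar> \<le> e / 2" using C by simp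
      then show ?case unfolding dist_real_def using e by linarith
    qed
  qed
qed

section \<open>Weak derivatives\<close>

lemma borel_measurable_lebesgueI: "f \<in> borel_measurable borel \<Longrightarrow> f \<in> borel_measurable lebesgue"
  by (simp add: measurable_completion)

lemma locally_integrable_measurable:
  fixes u :: "real^'n::finite \<Rightarrow> real"
  assumes "locally_integrable u"
  shows "u \<in> borel_measurable lebesgue"
proof (rule borel_measurable_LIMSEQ_real)
  fix i :: nat
  show "(\<lambda>x. indicator (cball 0 (real i)) x *\<^sub>R u x) \<in> borel_measurable lebesgue"
    using assms unfolding locally_integrable_def set_integrable_def
    by (intro borel_measurable_integrable) auto
next
  fix x :: "real^'n"
  obtain N :: nat where N: "norm x < real N" using reals_Archimedean2 by blast
  show "(\<lambda>i. indicator (cball 0 (real i)) x *\<^sub>R u x) \<longlonglongrightarrow> u x"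
  proof (rule tendsto_eventually)
    show "\<forall>\<^sub>F i in sequentially. indicator (cball 0 (real i)) x *\<^sub>R u x = u x"
      using eventually_ge_at_top[of N] by eventually_elim (use N in auto)
  qed
qed

text \<open>Maximal functions and radial integrals are set up for Borel functions, whereas Sobolev
  functions are only Lebesgue measurable.\<close>

lemma borel_representative:
  fixes u :: "'a::euclidean_space \<Rightarrow> real"
  assumes "u \<in> borel_measurable lebesgue"
  obtains u' where "u' \<in> borel_measurable borel" "AE x in lebesgue. u x = u' x"
proof -
  obtain u' where "u' \<in> borel_measurable lborel" "AE x in lborel. u x = u' x"
    using completion_ex_borel_measurable_real[OF assms] by blast
  then show ?thesis using that[of u'] by (simp add: AE_completion)
qed

lemma locally_integrable_ball_finite:
  assumes "locally_integrable u"
  shows "(\<integral>\<^sup>+y\<in>ball 0 R. ennreal \<bar>u y\<bar> \<partial>lebesgue) < \<infinity>"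
proof -
  have "integrable lebesgue (\<lambda>x. indicator (cball 0 R) x *\<^sub>R u x)"
    using assms unfolding locally_integrable_def set_integrable_def by auto
  then have "(\<integral>\<^sup>+x. norm (indicator (cball 0 R) x *\<^sub>R u x) \<partial>lebesgue) < \<infinity>"
    by (simp add: integrable_iff_bounded)
  moreover have "(\<integral>\<^sup>+y\<in>ball 0 R. ennreal \<bar>u y\<bar> \<partial>lebesgue)
      \<le> (\<integral>\<^sup>+x. norm (indicator (cball 0 R) x *\<^sub>R u x) \<partial>lebesgue)"
    by (intro nn_integral_mono) (auto split: split_indicator)
  ultimately show ?thesis by (rule le_less_trans[rotated])
qed

lemma locally_integrable_AE_cong:
  fixes u :: "real^'n::finite \<Rightarrow> real"
  assumes "locally_integrable u" "AE x in lebesgue. u x = v x" "v \<in> borel_measurable lebesgue"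
  shows "locally_integrable v"
  unfolding locally_integrable_def
proof (intro allI impI)
  fix K :: "(real^'n) set" assume K: "compact K"
  then have K': "K \<in> sets lebesgue" by (simp add: compact_imp_closed borel_closed sets_completionI_sets)
  have "set_integrable lebesgue K u" using assms(1) K by (auto simp: locally_integrable_def)
  then show "set_integrable lebesgue K v"
    unfolding set_integrable_def
    by (rule integrable_cong_AE_imp)
      (use assms(2,3) K' in \<open>auto intro!: borel_measurable_scaleR borel_measurable_indicator elim: eventually_mono\<close>)
qed

lemma test_function_bounded_support:
  assumes "test_function \<phi>"
  obtains B R where "0 < B" "\<And>x. \<bar>\<phi> x\<bar> \<le> B" "\<And>x. R < norm x \<Longrightarrow> \<phi> x = 0"
proof -
  obtain R where R: "\<And>x. R < norm x \<Longrightarrow> \<phi> x = 0" using assms by (auto simp: test_function_iff)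
  have "continuous_on UNIV \<phi>" by (rule smooth_fun_continuous_on[OF test_function_smooth[OF assms]])
  from continuous_bounded_support_bounded[OF this R] show ?thesis using that R by metis
qed

lemma test_function_borel: "test_function \<phi> \<Longrightarrow> \<phi> \<in> borel_measurable borel"
  by (intro borel_measurable_continuous_onI smooth_fun_continuous_on test_function_smooth)

lemma test_function_measurable: "test_function \<phi> \<Longrightarrow> \<phi> \<in> borel_measurable lebesgue"
  by (intro borel_measurable_lebesgueI test_function_borel)

lemma integrable_mult_test:
  assumes u: "locally_integrable u" and \<phi>: "test_function \<phi>"
  shows "integrable lebesgue (\<lambda>x. u x * \<phi> x)"
proof -
  obtain B R where B: "0 < B" "\<And>x. \<bar>\<phi> x\<bar> \<le> B" "\<And>x. R < norm x \<Longrightarrow> \<phi> x = 0"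
    using test_function_bounded_support[OF \<phi>] by blast
  have "integrable lebesgue (\<lambda>x. indicator (cball 0 R) x *\<^sub>R u x)"
    using u unfolding locally_integrable_def set_integrable_def by auto
  then have "integrable lebesgue (\<lambda>x. B * (indicator (cball 0 R) x *\<^sub>R u x))" by simp
  then show ?thesis
  proof (rule Bochner_Integration.integrable_bound)
    show "(\<lambda>x. u x * \<phi> x) \<in> borel_measurable lebesgue"
      by (intro borel_measurable_times locally_integrable_measurable u test_function_measurable \<phi>)
    show "AE x in lebesgue. norm (u x * \<phi> x) \<le> norm (B * (indicator (cball 0 R) x *\<^sub>R u x))"
    proof (rule AE_I2)
      fix x
      show "norm (u x * \<phi> x) \<le> norm (B * (indicator (cball 0 R) x *\<^sub>R u x))"
      proof (cases "norm x \<le> R")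
        case True
        then show ?thesis using B(1) B(2)[of x] by (simp add: abs_mult mult.commute mult_right_mono)
      next
        case False
        then show ?thesis using B(3)[of x] by simp
      qed
    qed
  qed
qed

lemma locally_integrable_add:
  "locally_integrable u \<Longrightarrow> locally_integrable v \<Longrightarrow> locally_integrable (\<lambda>x. u x + v x)"
  unfolding locally_integrable_def by (blast intro: set_integral_add(1))

lemma locally_integrable_diff:
  "locally_integrable u \<Longrightarrow> locally_integrable v \<Longrightarrow> locally_integrable (\<lambda>x. u x - v x)"
  unfolding locally_integrable_def by (blast intro: set_integral_diff(1))

lemma locally_integrable_zero: "locally_integrable (\<lambda>x. 0)"
  by (simp add: locally_integrable_def set_integrable_def)

lemma locally_integrable_sum:
  "(\<And>i. i \<in> I \<Longrightarrow> locally_integrable (f i)) \<Longrightarrow> locally_integrable (\<lambda>x. \<Sum>i\<in>I. f i x)"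
  by (induction I rule: infinite_finite_induct) (auto intro: locally_integrable_add locally_integrable_zero)

lemma weak_derivI: "has_weak_deriv \<nu> u v \<Longrightarrow> has_weak_deriv \<nu> u (weak_deriv \<nu> u)"
  unfolding weak_deriv_def by (rule someI[of "has_weak_deriv \<nu> u"])

lemma has_weak_deriv_test:
  assumes "has_weak_deriv \<nu> u v" "test_function \<phi>"
  shows "(LINT x|lebesgue. u x * iter_deriv \<nu> \<phi> x) = (- 1) ^ length \<nu> * (LINT x|lebesgue. v x * \<phi> x)"
  using assms by (auto simp: has_weak_deriv_def)

lemma has_weak_deriv_locally_integrable:
  assumes "has_weak_deriv \<nu> u v"
  shows "locally_integrable u" "locally_integrable v"
  using assms by (auto simp: has_weak_deriv_def)

lemma has_weak_deriv_sum:
  fixes u :: "'i \<Rightarrow> real^'n::finite \<Rightarrow> real"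
  assumes "\<And>i. i \<in> I \<Longrightarrow> has_weak_deriv \<nu> (u i) (v i)"
  shows "has_weak_deriv \<nu> (\<lambda>x. \<Sum>i\<in>I. u i x) (\<lambda>x. \<Sum>i\<in>I. v i x)"
  unfolding has_weak_deriv_def
proof (intro conjI allI impI)
  have li: "\<And>i. i \<in> I \<Longrightarrow> locally_integrable (u i)" "\<And>i. i \<in> I \<Longrightarrow> locally_integrable (v i)"
    using has_weak_deriv_locally_integrable[OF assms] by auto
  show "locally_integrable (\<lambda>x. \<Sum>i\<in>I. u i x)" "locally_integrable (\<lambda>x. \<Sum>i\<in>I. v i x)"
    by (intro locally_integrable_sum li; assumption)+
  fix \<phi> :: "real^'n \<Rightarrow> real" assume \<phi>: "test_function \<phi>"
  have "(LINT x|lebesgue. (\<Sum>i\<in>I. u i x) * iter_deriv \<nu> \<phi> x)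
     = (\<Sum>i\<in>I. LINT x|lebesgue. u i x * iter_deriv \<nu> \<phi> x)"
    unfolding sum_distrib_right
    by (intro Bochner_Integration.integral_sum integrable_mult_test test_function_iter_deriv \<phi> li)
  also have "\<dots> = (\<Sum>i\<in>I. (- 1) ^ length \<nu> * (LINT x|lebesgue. v i x * \<phi> x))"
    by (intro sum.cong refl has_weak_deriv_test assms \<phi>)
  also have "\<dots> = (- 1) ^ length \<nu> * (LINT x|lebesgue. (\<Sum>i\<in>I. v i x) * \<phi> x)"
    unfolding sum_distrib_right sum_distrib_left[symmetric]
    by (subst Bochner_Integration.integral_sum) (auto intro!: integrable_mult_test \<phi> li)
  finally show "(LINT x|lebesgue. (\<Sum>i\<in>I. u i x) * iter_deriv \<nu> \<phi> x)
     = (- 1) ^ length \<nu> * (LINT x|lebesgue. (\<Sum>i\<in>I. v i x) * \<phi> x)" .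
qed

text \<open>The derivatives \<open>\<mu>\<close> act last on a test function, so they can be moved over
  to \<open>u\<close> while \<open>iter_deriv \<nu> \<phi>\<close> serves as the new test
  function.\<close>

lemma has_weak_deriv_trans:
  fixes u :: "real^'n::finite \<Rightarrow> real"
  assumes "has_weak_deriv (\<mu> @ \<nu>) u v" "has_weak_deriv \<mu> u w"
  shows "has_weak_deriv \<nu> w v"
  unfolding has_weak_deriv_def
proof (intro conjI allI impI)
  show "locally_integrable w" "locally_integrable v"
    using has_weak_deriv_locally_integrable(2)[OF assms(1)] has_weak_deriv_locally_integrable(2)[OF assms(2)] by auto
  fix \<phi> :: "real^'n \<Rightarrow> real" assume \<phi>: "test_function \<phi>"
  have "(- 1) ^ length \<mu> * (LINT x|lebesgue. w x * iter_deriv \<nu> \<phi> x)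
     = (LINT x|lebesgue. u x * iter_deriv \<mu> (iter_deriv \<nu> \<phi>) x)"
    by (rule has_weak_deriv_test[OF assms(2) test_function_iter_deriv[OF \<phi>], symmetric])
  also have "\<dots> = (- 1) ^ length \<mu> * ((- 1) ^ length \<nu> * (LINT x|lebesgue. v x * \<phi> x))"
    using has_weak_deriv_test[OF assms(1) \<phi>] by (simp add: iter_deriv_append power_add)
  finally show "(LINT x|lebesgue. w x * iter_deriv \<nu> \<phi> x)
     = (- 1) ^ length \<nu> * (LINT x|lebesgue. v x * \<phi> x)"
    by simp
qed

text \<open>Dilated bumps around a Lebesgue point form an approximate identity, so that vanishing
  against all of them forces the value zero.\<close>

lemma fundamental_lemma:
  fixes z :: "real^'n::finite \<Rightarrow> real"
  assumes n: "CARD('n) = 2 * m" and m: "1 \<le> m" and z: "locally_integrable z"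
    and 0: "\<And>\<phi>. test_function \<phi> \<Longrightarrow> (LINT x|lebesgue. z x * \<phi> x) = 0"
  shows "AE x in lebesgue. z x = 0"
proof -
  have d: "DIM(real^'n) = 2 * m" using n by simp
  obtain w where w [measurable]: "w \<in> borel_measurable borel" and zw: "AE x in lebesgue. z x = w x"
    using borel_representative[OF locally_integrable_measurable[OF z]] by blast
  have lw: "locally_integrable w"
    using locally_integrable_AE_cong[OF z zw] borel_measurable_lebesgueI[OF w] by blast
  have loc: "(\<integral>\<^sup>+y\<in>ball 0 (real N). ennreal \<bar>w y\<bar> \<partial>lborel) < \<infinity>" for N :: nat
    using locally_integrable_ball_finite[OF lw] by (simp add: nn_integral_completion)
  let ?\<kappa> = "unit_ball_vol (real DIM(real^'n)) * m * moment (m - 1) bump_profile"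
  have "moment (m - 1) bump_profile \<noteq> 0"
    using moment_deriv[OF smooth1_bump_profile bump_profile_zero, of "m - 1"]
      moment_deriv_bump_profile[of "Suc (m - 1)"] by auto
  moreover have "unit_ball_vol (real CARD('n)) \<noteq> 0"
    by (metis less_irrefl unit_ball_vol_pos of_nat_0_le_iff)
  ultimately have \<kappa>: "?\<kappa> \<noteq> 0" using m by simp
  have int0: "(\<integral>y. w y * bump_profile (b * (norm (y - x))\<^sup>2) \<partial>lborel) = 0" if b: "0 < b" for b x
  proof -
    let ?\<phi> = "\<lambda>y. bump_profile (b * (norm (y - x))\<^sup>2)"
    have "smooth1 (\<lambda>q. bump_profile (b * q))"
      using smooth1_affine[OF smooth1_bump_profile, of 1 0 b] by simp
    then have \<phi>: "test_function ?\<phi>"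
      by (rule test_function_radial[where c = "1 / b" and H = "\<lambda>q. bump_profile (b * q)"])
        (use b in \<open>simp add: bump_profile_zero field_simps\<close>)
    have "(\<integral>y. w y * ?\<phi> y \<partial>lborel) = (LINT y|lebesgue. w y * ?\<phi> y)"
      using test_function_borel[OF \<phi>] by (intro integral_completion[symmetric]) measurable
    also have "\<dots> = (LINT y|lebesgue. z y * ?\<phi> y)"
      using zw by (intro integral_cong_AE borel_measurable_times test_function_measurable \<phi>
          locally_integrable_measurable z lw) (auto elim: eventually_mono)
    also have "\<dots> = 0" by (rule 0[OF \<phi>])
    finally show ?thesis .
  qed
  have "AE x in lborel. w x = 0"
    using AE_lebesgue_point[OF w loc]
  proof eventually_elim
    fix x :: "real^'n"
    assume x: "\<forall>e>0. \<forall>\<^sub>F r in at_right 0.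
      (\<integral>\<^sup>+y\<in>ball x r. ennreal \<bar>w y - w x\<bar> \<partial>lborel) \<le> ennreal (e * r ^ DIM(real^'n))"
    have "((\<lambda>b. b ^ m * (\<integral>y. w y * bump_profile (b * (norm (y - x))\<^sup>2) \<partial>lborel)) \<longlongrightarrow> w x * ?\<kappa>) at_top"
      by (rule approximate_identity_at_lebesgue_point[OF d m w loc x smooth1_bump_profile bump_profile_zero])
    moreover have "((\<lambda>b. b ^ m * (\<integral>y. w y * bump_profile (b * (norm (y - x))\<^sup>2) \<partial>lborel)) \<longlongrightarrow> 0) at_top"
      by (rule Lim_transform_eventually[OF tendsto_const])
        (use eventually_gt_at_top[of "0::real"] in eventually_elim, simp add: int0)
    ultimately have "w x * ?\<kappa> = 0" by (rule tendsto_unique[rotated]) simp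
    then show "w x = 0" using \<kappa> by simp
  qed
  then have "AE x in lebesgue. w x = 0" by (rule AE_completion)
  with zw show ?thesis by eventually_elim simp
qed

lemma fundamental_lemma_eq:
  fixes v w :: "real^'n::finite \<Rightarrow> real"
  assumes n: "CARD('n) = 2 * m" and m: "1 \<le> m" and vw: "locally_integrable v" "locally_integrable w"
    and eq: "\<And>\<phi>. test_function \<phi> \<Longrightarrow> (LINT x|lebesgue. v x * \<phi> x) = (LINT x|lebesgue. w x * \<phi> x)"
  shows "AE x in lebesgue. v x = w x"
proof -
  have "AE x in lebesgue. v x - w x = 0"
  proof (rule fundamental_lemma[OF n m locally_integrable_diff[OF vw]])
    fix \<phi> :: "real^'n \<Rightarrow> real" assume \<phi>: "test_function \<phi>"
    then show "(LINT x|lebesgue. (v x - w x) * \<phi> x) = 0"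
      using integrable_mult_test[OF vw(1) \<phi>] integrable_mult_test[OF vw(2) \<phi>] eq[OF \<phi>]
      by (simp add: left_diff_distrib)
  qed
  then show ?thesis by (rule eventually_mono) simp
qed

lemma square_integrable_AE_cong:
  assumes "square_integrable v" "AE x in lebesgue. v x = w x" "w \<in> borel_measurable lebesgue"
  shows "square_integrable w"
proof -
  have "integrable lebesgue (\<lambda>x. (v x)\<^sup>2)" using assms(1) by (simp add: square_integrable_def)
  then have "integrable lebesgue (\<lambda>x. (w x)\<^sup>2)"
    by (rule integrable_cong_AE_imp) (use assms in \<open>auto elim: eventually_mono\<close>)
  then show ?thesis using assms(3) by (simp add: square_integrable_def)
qed

lemma square_integrable_add:
  assumes "square_integrable f" "square_integrable g"
  shows "square_integrable (\<lambda>x. f x + g x)"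
proof -
  have m: "f \<in> borel_measurable lebesgue" "g \<in> borel_measurable lebesgue"
    using assms by (auto simp: square_integrable_def)
  have "integrable lebesgue (\<lambda>x. 2 * (f x)\<^sup>2 + 2 * (g x)\<^sup>2)"
    using assms by (auto simp: square_integrable_def)
  then have "integrable lebesgue (\<lambda>x. (f x + g x)\<^sup>2)"
  proof (rule Bochner_Integration.integrable_bound)
    have "(a + b)\<^sup>2 \<le> 2 * a\<^sup>2 + 2 * b\<^sup>2" for a b :: real
      using sum_squares_bound[of a b] by (simp add: power2_sum)
    then show "AE x in lebesgue. norm ((f x + g x)\<^sup>2) \<le> norm (2 * (f x)\<^sup>2 + 2 * (g x)\<^sup>2)" by simp
  qed (use m in measurable)
  then show ?thesis using m by (simp add: square_integrable_def)
qed

lemma square_integrable_sum: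
  "(\<And>i. i \<in> I \<Longrightarrow> square_integrable (f i)) \<Longrightarrow> square_integrable (\<lambda>x. \<Sum>i\<in>I. f i x)"
  by (induction I rule: infinite_finite_induct)
    (auto intro: square_integrable_add simp: square_integrable_def[of "\<lambda>x. 0"])

text \<open>Each weak Laplacian is assembled from arbitrarily chosen weak derivatives. Its own weak
  derivatives of order \<open>\<nu>\<close> are sums of those of order \<open>[i, i] @
  \<nu>\<close> of the preceding function, whatever the choice.\<close>

lemma sobolev_weak_laplacian_pow_derivs:
  assumes u: "u \<in> sobolev m"
  shows "2 * j + length \<nu> \<le> m \<Longrightarrow>
    \<exists>v. has_weak_deriv \<nu> ((weak_laplacian ^^ j) u) v \<and> square_integrable v"
proof (induction j arbitrary: \<nu>)
  case 0
  then show ?case using u by (auto simp: sobolev_def)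
next
  case (Suc j)
  let ?w = "(weak_laplacian ^^ j) u"
  have "\<exists>v. has_weak_deriv ([i, i] @ \<nu>) ?w v \<and> square_integrable v" for i
    using Suc.prems by (intro Suc.IH) simp
  then obtain v where v: "\<And>i. has_weak_deriv ([i, i] @ \<nu>) ?w (v i)" "\<And>i. square_integrable (v i)"
    by metis
  have z: "has_weak_deriv [i, i] ?w (weak_deriv [i, i] ?w)" for i
    using Suc.IH[of "[i, i]"] Suc.prems weak_derivI by fastforce
  have "has_weak_deriv \<nu> (weak_deriv [i, i] ?w) (v i)" for i
    by (rule has_weak_deriv_trans[OF v(1) z])
  then have "has_weak_deriv \<nu> (\<lambda>x. \<Sum>i\<in>UNIV. weak_deriv [i, i] ?w x) (\<lambda>x. \<Sum>i\<in>UNIV. v i x)"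
    by (intro has_weak_deriv_sum)
  moreover have "(weak_laplacian ^^ Suc j) u = (\<lambda>x. \<Sum>i\<in>UNIV. weak_deriv [i, i] ?w x)"
    by (simp add: weak_laplacian_def[abs_def])
  ultimately show ?case using square_integrable_sum[of UNIV v] v(2) by auto
qed

text \<open>A weak derivative of order zero is the function itself almost everywhere. This transfers
  square integrability to the representatives that are selected in the definition of weak
  derivatives.\<close>

lemma has_weak_deriv_Nil_square_integrable:
  fixes u :: "real^'n::finite \<Rightarrow> real"
  assumes n: "CARD('n) = 2 * m" and m: "1 \<le> m" and "has_weak_deriv [] u v" "square_integrable v"
  shows "square_integrable u"
proof -
  have li: "locally_integrable u" "locally_integrable v"
    using has_weak_deriv_locally_integrable[OF assms(3)] .
  have "AE x in lebesgue. v x = u x"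
    by (rule fundamental_lemma_eq[OF n m li(2,1)]) (use has_weak_deriv_test[OF assms(3)] in simp)
  then show ?thesis
    using square_integrable_AE_cong[OF assms(4) _ locally_integrable_measurable[OF li(1)]] by blast
qed

lemma weak_deriv_square_integrable:
  fixes u :: "real^'n::finite \<Rightarrow> real"
  assumes n: "CARD('n) = 2 * m" and m: "1 \<le> m" and "has_weak_deriv \<nu> u v" "square_integrable v"
  shows "square_integrable (weak_deriv \<nu> u)"
proof -
  have "has_weak_deriv [] (weak_deriv \<nu> u) v"
    using has_weak_deriv_trans[of \<nu> "[]"] assms(3) weak_derivI[OF assms(3)] by simp
  then show ?thesis using has_weak_deriv_Nil_square_integrable[OF n m _ assms(4)] by blast
qed

lemma weak_laplacian_pow_test:
  fixes u :: "real^'n::finite \<Rightarrow> real"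
  assumes u: "u \<in> sobolev m"
  shows "2 * j \<le> m \<Longrightarrow> test_function \<phi> \<Longrightarrow>
    (LINT x|lebesgue. (weak_laplacian ^^ j) u x * \<phi> x) = (LINT x|lebesgue. u x * (lap ^^ j) \<phi> x)"
proof (induction j arbitrary: \<phi>)
  case (Suc j)
  let ?w = "(weak_laplacian ^^ j) u"
  have z: "has_weak_deriv [i, i] ?w (weak_deriv [i, i] ?w)" for i
    using sobolev_weak_laplacian_pow_derivs[OF u, of j "[i, i]"] Suc.prems weak_derivI by fastforce
  have li: "locally_integrable ?w" "locally_integrable (weak_deriv [i, i] ?w)" for i
    using has_weak_deriv_locally_integrable[OF z] by auto
  have "(LINT x|lebesgue. (weak_laplacian ^^ Suc j) u x * \<phi> x)
     = (\<Sum>i\<in>UNIV. LINT x|lebesgue. weak_deriv [i, i] ?w x * \<phi> x)"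
    by (simp add: weak_laplacian_def sum_distrib_right integrable_mult_test[OF li(2) Suc.prems(2)])
  also have "\<dots> = (\<Sum>i\<in>UNIV. LINT x|lebesgue. ?w x * iter_deriv [i, i] \<phi> x)"
    using has_weak_deriv_test[OF z Suc.prems(2)] by (simp del: iter_deriv_simps)
  also have "\<dots> = (LINT x|lebesgue. ?w x * lap \<phi> x)"
    unfolding lap_def sum_distrib_left
    by (intro Bochner_Integration.integral_sum[symmetric] integrable_mult_test li(1)
        test_function_iter_deriv Suc.prems)
  also have "\<dots> = (LINT x|lebesgue. u x * (lap ^^ j) (lap \<phi>) x)"
    by (rule Suc.IH) (use Suc.prems test_function_lap in auto)
  finally show ?case by (simp add: funpow_swap1)
qed simp

section \<open>Pairing Sobolev functions with radial test functions\<close>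

lemma norm_gradient_radial:
  assumes "smooth1 H"
  shows "norm (\<chi> i. partial_deriv i (\<lambda>y. H ((norm (y - x))\<^sup>2)) y)
     = 2 * norm (y - x) * \<bar>deriv H ((norm (y - x))\<^sup>2)\<bar>"
proof -
  have "(\<chi> i. partial_deriv i (\<lambda>y. H ((norm (y - x))\<^sup>2)) y) = (2 * deriv H ((norm (y - x))\<^sup>2)) *\<^sub>R (y - x)"
    by (simp add: vec_eq_iff partial_deriv_radial[OF assms])
  then show ?thesis by (simp add: abs_mult)
qed

text \<open>The size of a test function, or of its gradient, that is paired with
  \<open>|\<nabla>\<^sup>m u|\<close> according to the parity of \<open>m\<close>.\<close>

definition dual_size :: "nat \<Rightarrow> (real^'n::finite \<Rightarrow> real) \<Rightarrow> real^'n \<Rightarrow> real" where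
  "dual_size m \<phi> y = (if even m then \<bar>\<phi> y\<bar> else norm (\<chi> i. partial_deriv i \<phi> y))"

lemma square_integrable_norm_vec:
  fixes z :: "'n::finite \<Rightarrow> real^'m::finite \<Rightarrow> real"
  assumes "\<And>i. square_integrable (z i)"
  shows "square_integrable (\<lambda>x. norm (\<chi> i. z i x))"
proof -
  have eq: "(norm (\<chi> i. z i x))\<^sup>2 = (\<Sum>i\<in>UNIV. (z i x)\<^sup>2)" for x
    unfolding power2_norm_eq_inner inner_vec_def by (simp add: power2_eq_square)
  have [measurable]: "z i \<in> borel_measurable lebesgue" for i
    using assms by (simp add: square_integrable_def)
  have "norm (\<chi> i. z i x) = sqrt (\<Sum>i\<in>UNIV. (z i x)\<^sup>2)" for x
    by (metis eq norm_ge_zero real_sqrt_unique)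
  moreover have "(\<lambda>x. sqrt (\<Sum>i\<in>UNIV. (z i x)\<^sup>2)) \<in> borel_measurable lebesgue" by measurable
  ultimately have "(\<lambda>x. norm (\<chi> i. z i x)) \<in> borel_measurable lebesgue" by simp
  moreover have "integrable lebesgue (\<lambda>x. (norm (\<chi> i. z i x))\<^sup>2)"
    unfolding eq using assms unfolding square_integrable_def
    by (intro Bochner_Integration.integrable_sum) auto
  ultimately show ?thesis by (simp add: square_integrable_def)
qed

text \<open>The Laplacians are moved from the test function to \<open>u\<close> one after the other. For
  odd \<open>m\<close> the last one is split, with one first derivative on either side, and
  the Cauchy-Schwarz inequality for vectors applies pointwise.\<close>

lemma sobolev_abs_nabla_pow_dual:
  fixes u :: "real^'n::finite \<Rightarrow> real"
  assumes n: "CARD('n) = 2 * m" and m: "1 \<le> m" and u: "u \<in> sobolev m"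
  shows "square_integrable (abs_nabla_pow m u)"
    and "test_function \<phi> \<Longrightarrow> ennreal \<bar>LINT y|lebesgue. u y * (lap ^^ ((m + 1) div 2)) \<phi> y\<bar>
      \<le> (\<integral>\<^sup>+y. ennreal (abs_nabla_pow m u y * dual_size m \<phi> y) \<partial>lebesgue)"
proof -
  define k where "k = m div 2"
  let ?w = "(weak_laplacian ^^ k) u"
  have "square_integrable (abs_nabla_pow m u) \<and> (test_function \<phi> \<longrightarrow>
     ennreal \<bar>LINT y|lebesgue. u y * (lap ^^ ((m + 1) div 2)) \<phi> y\<bar>
      \<le> (\<integral>\<^sup>+y. ennreal (abs_nabla_pow m u y * dual_size m \<phi> y) \<partial>lebesgue))"
  proof (cases "even m")
    case True
    then have K: "(m + 1) div 2 = k" "2 * k = m" by (auto simp: k_def)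
    have ab: "abs_nabla_pow m u = (\<lambda>x. \<bar>?w x\<bar>)" using True by (auto simp: abs_nabla_pow_def k_def)
    obtain v where v: "has_weak_deriv [] ?w v" "square_integrable v"
      using sobolev_weak_laplacian_pow_derivs[OF u, of k "[]"] K by auto
    have sq: "square_integrable ?w" by (rule has_weak_deriv_Nil_square_integrable[OF n m v])
    have li: "locally_integrable ?w" by (rule has_weak_deriv_locally_integrable(1)[OF v(1)])
    have "square_integrable (abs_nabla_pow m u)"
      using sq by (auto simp: ab square_integrable_def intro: borel_measurable_abs)
    moreover have "ennreal \<bar>LINT y|lebesgue. u y * (lap ^^ ((m + 1) div 2)) \<phi> y\<bar>
      \<le> (\<integral>\<^sup>+y. ennreal (abs_nabla_pow m u y * dual_size m \<phi> y) \<partial>lebesgue)" if \<phi>: "test_function \<phi>"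
    proof -
      have "(LINT y|lebesgue. u y * (lap ^^ ((m + 1) div 2)) \<phi> y) = (LINT y|lebesgue. ?w y * \<phi> y)"
        using weak_laplacian_pow_test[OF u _ \<phi>, of k] K by simp
      also have "ennreal \<bar>\<dots>\<bar> \<le> (\<integral>\<^sup>+y. norm (?w y * \<phi> y) \<partial>lebesgue)"
        using integral_norm_bound_ennreal[OF integrable_mult_test[OF li \<phi>]] by simp
      also have "\<dots> = (\<integral>\<^sup>+y. ennreal (abs_nabla_pow m u y * dual_size m \<phi> y) \<partial>lebesgue)"
        using True by (simp add: ab dual_size_def abs_mult)
      finally show ?thesis .
    qed
    ultimately show ?thesis by blast
  next
    case False
    then have K: "(m + 1) div 2 = Suc k" "2 * k + 1 = m" "(m - 1) div 2 = k" by (auto simp: k_def elim!: oddE)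
    have ab: "abs_nabla_pow m u = (\<lambda>x. norm (\<chi> i. weak_deriv [i] ?w x))"
      using False K(3) by (auto simp: abs_nabla_pow_def weak_grad_def[abs_def])
    have "\<exists>v. has_weak_deriv [i] ?w v \<and> square_integrable v" for i
      using K by (intro sobolev_weak_laplacian_pow_derivs[OF u]) simp
    then obtain v where v: "\<And>i. has_weak_deriv [i] ?w (v i)" "\<And>i. square_integrable (v i)" by metis
    let ?z = "\<lambda>i. weak_deriv [i] ?w"
    have z: "has_weak_deriv [i] ?w (?z i)" for i by (rule weak_derivI[OF v(1)])
    have li: "locally_integrable ?w" "locally_integrable (?z i)" for i
      using has_weak_deriv_locally_integrable[OF z] by auto
    have "square_integrable (abs_nabla_pow m u)"
      unfolding ab by (intro square_integrable_norm_vec weak_deriv_square_integrable[OF n m v])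
    moreover have "ennreal \<bar>LINT y|lebesgue. u y * (lap ^^ ((m + 1) div 2)) \<phi> y\<bar>
      \<le> (\<integral>\<^sup>+y. ennreal (abs_nabla_pow m u y * dual_size m \<phi> y) \<partial>lebesgue)" if \<phi>: "test_function \<phi>"
    proof -
      have t: "test_function (partial_deriv i \<phi>)" for i by (rule test_function_partial_deriv[OF \<phi>])
      have i: "integrable lebesgue (\<lambda>y. ?z i y * partial_deriv i \<phi> y)" for i
        by (rule integrable_mult_test[OF li(2) t])
      have "(LINT y|lebesgue. u y * (lap ^^ ((m + 1) div 2)) \<phi> y) = (LINT y|lebesgue. u y * (lap ^^ k) (lap \<phi>) y)"
        by (simp only: K(1) funpow_Suc_right o_apply)
      also have "\<dots> = (LINT y|lebesgue. ?w y * lap \<phi> y)"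
        using weak_laplacian_pow_test[OF u _ test_function_lap[OF \<phi>], of k] K by simp
      also have "\<dots> = (\<Sum>i\<in>UNIV. LINT y|lebesgue. ?w y * iter_deriv [i, i] \<phi> y)"
        unfolding lap_def sum_distrib_left
        by (intro Bochner_Integration.integral_sum integrable_mult_test li(1) test_function_iter_deriv \<phi>)
      also have "\<dots> = (\<Sum>i\<in>UNIV. - (LINT y|lebesgue. ?z i y * partial_deriv i \<phi> y))"
        using has_weak_deriv_test[OF z t] by simp
      also have "\<dots> = - (LINT y|lebesgue. (\<Sum>i\<in>UNIV. ?z i y * partial_deriv i \<phi> y))"
        by (subst Bochner_Integration.integral_sum) (auto simp: i sum_negf)
      finally have "ennreal \<bar>LINT y|lebesgue. u y * (lap ^^ ((m + 1) div 2)) \<phi> y\<bar>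
         = ennreal (norm (LINT y|lebesgue. (\<Sum>i\<in>UNIV. ?z i y * partial_deriv i \<phi> y)))" by simp
      also have "\<dots> \<le> (\<integral>\<^sup>+y. norm (\<Sum>i\<in>UNIV. ?z i y * partial_deriv i \<phi> y) \<partial>lebesgue)"
        by (intro integral_norm_bound_ennreal Bochner_Integration.integrable_sum i)
      also have "\<dots> \<le> (\<integral>\<^sup>+y. ennreal (abs_nabla_pow m u y * dual_size m \<phi> y) \<partial>lebesgue)"
      proof (intro nn_integral_mono ennreal_leI)
        fix y
        have "(\<Sum>i\<in>UNIV. ?z i y * partial_deriv i \<phi> y) = (\<chi> i. ?z i y) \<bullet> (\<chi> i. partial_deriv i \<phi> y)"
          by (simp add: inner_vec_def)
        then show "norm (\<Sum>i\<in>UNIV. ?z i y * partial_deriv i \<phi> y) \<le> abs_nabla_pow m u y * dual_size m \<phi> y"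
          using False by (simp add: ab dual_size_def Cauchy_Schwarz_ineq2)
      qed
      finally show ?thesis .
    qed
    ultimately show ?thesis by blast
  qed
  then show "square_integrable (abs_nabla_pow m u)"
    and "test_function \<phi> \<Longrightarrow> ennreal \<bar>LINT y|lebesgue. u y * (lap ^^ ((m + 1) div 2)) \<phi> y\<bar>
      \<le> (\<integral>\<^sup>+y. ennreal (abs_nabla_pow m u y * dual_size m \<phi> y) \<partial>lebesgue)" by auto
qed

text \<open>The value of \<open>dual_size\<close> for the radial test function with profile
  \<open>H\<close>, in terms of \<open>q = |y - x|\<^sup>2\<close>.\<close>

definition dual_profile :: "nat \<Rightarrow> (real \<Rightarrow> real) \<Rightarrow> real \<Rightarrow> real" where
  "dual_profile m H q = (if even m then \<bar>H q\<bar> else 2 * sqrt q * \<bar>deriv H q\<bar>)"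

text \<open>All that the potential estimates use about \<open>u\<close> and \<open>f = |\<nabla>\<^sup>m
  u|\<close>. Weak derivatives no longer occur, and both functions are Borel.\<close>

definition radial_pairing :: "nat \<Rightarrow> ('a::euclidean_space \<Rightarrow> real) \<Rightarrow> ('a \<Rightarrow> real) \<Rightarrow> bool" where
  "radial_pairing m u f \<longleftrightarrow>
     u \<in> borel_measurable borel \<and> f \<in> borel_measurable borel \<and> (\<forall>x. 0 \<le> f x) \<and>
     (\<forall>N::nat. (\<integral>\<^sup>+y\<in>ball 0 (real N). ennreal \<bar>u y\<bar> \<partial>lborel) < \<infinity>) \<and>
     (\<forall>x H c. smooth1 H \<and> (\<forall>q\<ge>c. H q = 0) \<longrightarrow>
       ennreal \<bar>\<integral>y. u y * (radial_lap (2 * m) ^^ ((m + 1) div 2)) H ((norm (y - x))\<^sup>2) \<partial>lborel\<bar>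
         \<le> (\<integral>\<^sup>+y. ennreal (f y * dual_profile m H ((norm (y - x))\<^sup>2)) \<partial>lborel))"

lemma radial_pairingD:
  assumes "radial_pairing m u f"
  shows "u \<in> borel_measurable borel" "f \<in> borel_measurable borel" "0 \<le> f x"
    "(\<integral>\<^sup>+y\<in>ball 0 (real N). ennreal \<bar>u y\<bar> \<partial>lborel) < \<infinity>"
  using assms by (auto simp: radial_pairing_def)

lemma sobolev_borel_pair:
  fixes u :: "real^'n::finite \<Rightarrow> real"
  assumes n: "CARD('n) = 2 * m" and m: "1 \<le> m" and u: "u \<in> sobolev m"
  obtains u' f' where "AE x in lebesgue. u x = u' x" "AE x in lebesgue. abs_nabla_pow m u x = f' x"
    "radial_pairing m u' f'"
proof -
  have sq: "square_integrable u" using u by (simp add: sobolev_def)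
  have "\<exists>v. has_weak_deriv [] u v" using u by (force simp: sobolev_def dest: spec[of _ "[]"])
  then have li: "locally_integrable u" using has_weak_deriv_locally_integrable by blast
  obtain u' where u': "u' \<in> borel_measurable borel" "AE x in lebesgue. u x = u' x"
    using borel_representative[OF locally_integrable_measurable[OF li]] by blast
  have "abs_nabla_pow m u \<in> borel_measurable lebesgue"
    using sobolev_abs_nabla_pow_dual(1)[OF n m u] by (simp add: square_integrable_def)
  then obtain g where g: "g \<in> borel_measurable borel" "AE x in lebesgue. abs_nabla_pow m u x = g x"
    using borel_representative by blast
  define f' where "f' x = \<bar>g x\<bar>" for x
  have nn: "0 \<le> abs_nabla_pow m u x" for x by (simp add: abs_nabla_pow_def)
  have f': "f' \<in> borel_measurable borel" "AE x in lebesgue. abs_nabla_pow m u x = f' x" "\<And>x. 0 \<le> f' x"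
  proof -
    show "f' \<in> borel_measurable borel" using g(1) unfolding f'_def by measurable
    show "AE x in lebesgue. abs_nabla_pow m u x = f' x"
      using g(2) by eventually_elim (metis f'_def nn abs_of_nonneg)
  qed (simp add: f'_def)
  have li': "locally_integrable u'"
    using locally_integrable_AE_cong[OF li u'(2)] borel_measurable_lebesgueI[OF u'(1)] by blast
  have "radial_pairing m u' f'"
    unfolding radial_pairing_def
  proof (intro conjI allI impI)
    show "u' \<in> borel_measurable borel" "f' \<in> borel_measurable borel" "\<And>x. 0 \<le> f' x"
      by (fact u'(1) f')+
    show "(\<integral>\<^sup>+y\<in>ball 0 (real N). ennreal \<bar>u' y\<bar> \<partial>lborel) < \<infinity>" for N :: nat
      using locally_integrable_ball_finite[OF li', of "real N"] by (simp add: nn_integral_completion)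
  next
    fix x :: "real^'n" and H :: "real \<Rightarrow> real" and c assume "smooth1 H \<and> (\<forall>q\<ge>c. H q = 0)"
    then have H: "smooth1 H" and z: "\<And>q. c \<le> q \<Longrightarrow> H q = 0" by auto
    let ?\<phi> = "\<lambda>y. H ((norm (y - x))\<^sup>2)"
    let ?K = "(m + 1) div 2"
    have \<phi>: "test_function ?\<phi>" by (rule test_function_radial[OF H z])
    have lapeq: "(lap ^^ ?K) ?\<phi> = (\<lambda>y. (radial_lap (2 * m) ^^ ?K) H ((norm (y - x))\<^sup>2))"
      using lap_pow_radial[OF H, where 'n = 'n] n by simp
    have tl: "test_function ((lap ^^ ?K) ?\<phi>)" by (rule test_function_lap_pow[OF \<phi>])
    have ds: "dual_size m ?\<phi> y = dual_profile m H ((norm (y - x))\<^sup>2)" for y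
      by (simp add: dual_size_def dual_profile_def norm_gradient_radial[OF H])
    have "(\<integral>y. u' y * (lap ^^ ?K) ?\<phi> y \<partial>lborel) = (LINT y|lebesgue. u' y * (lap ^^ ?K) ?\<phi> y)"
      using test_function_borel[OF tl] u'(1)
      by (intro integral_completion[symmetric]) (simp add: borel_measurable_times)
    also have "\<dots> = (LINT y|lebesgue. u y * (lap ^^ ?K) ?\<phi> y)"
      using u'(2) by (intro integral_cong_AE borel_measurable_times test_function_measurable tl
          locally_integrable_measurable li li') (auto elim: eventually_mono)
    also have "ennreal \<bar>\<dots>\<bar> \<le> (\<integral>\<^sup>+y. ennreal (abs_nabla_pow m u y * dual_size m ?\<phi> y) \<partial>lebesgue)"
      by (rule sobolev_abs_nabla_pow_dual(2)[OF n m u \<phi>])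
    also have "\<dots> = (\<integral>\<^sup>+y. ennreal (f' y * dual_size m ?\<phi> y) \<partial>lebesgue)"
      using f'(2) by (intro nn_integral_cong_AE) (auto elim: eventually_mono)
    also have "\<dots> = (\<integral>\<^sup>+y. ennreal (f' y * dual_size m ?\<phi> y) \<partial>lborel)"
      by (rule nn_integral_completion)
    finally show "ennreal \<bar>\<integral>y. u' y * (radial_lap (2 * m) ^^ ?K) H ((norm (y - x))\<^sup>2) \<partial>lborel\<bar>
       \<le> (\<integral>\<^sup>+y. ennreal (f' y * dual_profile m H ((norm (y - x))\<^sup>2)) \<partial>lborel)"
      unfolding lapeq ds .
  qed
  then show ?thesis using that u'(2) f'(2) by blast
qed

section \<open>Truncated fundamental solutions of polyharmonic operators\<close>

lemma scale_avg_cong: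
  "(\<And>\<sigma>. \<sigma> \<in> {a..b} \<Longrightarrow> w \<sigma> = w' \<sigma>) \<Longrightarrow> scale_avg w a b H = scale_avg w' a b H"
  unfolding scale_avg_def by (intro ext integral_cong) simp

text \<open>The function \<open>F\<close> is a compactly supported mollification of a fundamental
  solution: \<open>\<Delta>\<^sup>K F\<close> is an approximate identity, up to a constant
  factor, minus a smooth function that depends on \<open>a\<close> only, and the relevant size
  of \<open>F\<close> is at most \<open>C t\<^bsup>-m\<^esup>\<close> at distance
  \<open>t\<close>, uniformly in the mollification parameter \<open>b\<close>. For even
  \<open>m\<close> the size of \<open>F\<close> itself counts, and \<open>F\<close> behaves
  like \<open>t\<^bsup>-m\<^esup>\<close>; for odd \<open>m\<close> it is the size of the
  gradient, and \<open>F\<close> behaves like \<open>t\<^bsup>1-m\<^esup>\<close> (like a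
  logarithm if \<open>m = 1\<close>).\<close>

lemma truncated_fundamental_solution:
  fixes m :: nat
  assumes m: "1 \<le> m"
  defines "K \<equiv> (m + 1) div 2"
  obtains C G where "0 < C" "smooth1 G" "\<And>q. 1 \<le> q \<Longrightarrow> G q = 0" "moment (m - 1) G \<noteq> 0"
    "\<And>a b. 0 < a \<Longrightarrow> a \<le> b \<Longrightarrow> \<exists>F. smooth1 F \<and> (\<forall>q. 1 \<le> a * q \<longrightarrow> F q = 0) \<and>
       (\<forall>q. (radial_lap (2 * m) ^^ K) F q = b ^ m * G (b * q) - a ^ m * G (a * q)) \<and>
       (\<forall>t>0. dual_profile m F (t\<^sup>2) \<le> (if a * t\<^sup>2 < 1 then C / t ^ m else 0))"
proof -
  define s where "s = m - K"
  have K: "1 \<le> K" "K \<le> m" "s + K = m" using m by (auto simp: K_def s_def)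
  define G0 where "G0 = (radial_lap (2 * m) ^^ (K - 1)) bump_profile"
  have G0: "smooth1 G0" "\<And>q. 1 \<le> q \<Longrightarrow> G0 q = 0"
    unfolding G0_def using smooth1_radial_lap_pow[OF smooth1_bump_profile]
      radial_lap_pow_vanishes[OF smooth1_bump_profile bump_profile_zero] by auto
  define G where "G q = 4 * deriv G0 q" for q
  have G: "smooth1 G" "\<And>q. 1 \<le> q \<Longrightarrow> G q = 0"
    unfolding G_def[abs_def]
    using smooth1_cmult[OF smooth1_deriv[OF G0(1)], of 4] smooth1_deriv_vanishes[OF G0] by auto
  have "moment (m - 1) (deriv G0) \<noteq> 0"
    using moment_deriv_radial_lap_pow_bump[of "K - 1" K m] K by (simp add: G0_def)
  moreover have "moment (m - 1) G = 4 * moment (m - 1) (deriv G0)"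
    by (simp add: moment_def G_def mult.left_commute[of _ 4])
  ultimately have mG: "moment (m - 1) G \<noteq> 0" by simp
  obtain C0 where C0: "0 < C0" "\<And>q. 0 \<le> q \<Longrightarrow> \<bar>bump_profile q\<bar> \<le> C0"
    using smooth1_bounded[OF smooth1_bump_profile bump_profile_zero] by blast
  have d: "smooth1 (deriv bump_profile)" "\<And>q. 1 \<le> q \<Longrightarrow> deriv bump_profile q = 0"
    using smooth1_deriv[OF smooth1_bump_profile] smooth1_deriv_vanishes[OF smooth1_bump_profile bump_profile_zero] by auto
  obtain C1 where C1: "0 < C1" "\<And>q. 0 \<le> q \<Longrightarrow> \<bar>deriv bump_profile q\<bar> \<le> C1"
    using smooth1_bounded[OF d] by blast
  have ex: "\<exists>F. smooth1 F \<and> (\<forall>q. 1 \<le> a * q \<longrightarrow> F q = 0) \<and>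
       (\<forall>q. (radial_lap (2 * m) ^^ K) F q = b ^ m * G (b * q) - a ^ m * G (a * q)) \<and>
       (\<forall>t>0. dual_profile m F (t\<^sup>2) \<le> (if a * t\<^sup>2 < 1 then (C0 + 2 * C1) / t ^ m else 0))"
    if ab: "0 < a" "a \<le> b" for a b
  proof -
    \<comment> \<open>The weight \<open>\<sigma>\<^bsup>s-1\<^esup>\<close>, written as a quotient since \<open>s
      = 0\<close> occurs for \<open>m = 1\<close>.\<close>
    define w where "w \<sigma> = \<sigma> ^ s / \<sigma>" for \<sigma> :: real
    have w: "continuous_on {a..b} w" unfolding w_def using ab by (intro continuous_intros) auto
    define F where "F = scale_avg w a b bump_profile"
    have F: "smooth1 F" unfolding F_def by (rule smooth1_scale_avg[OF w smooth1_bump_profile])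
    have van: "F q = 0" if "1 \<le> a * q" for q
      unfolding F_def by (rule scale_avg_vanishes[OF bump_profile_zero ab(1) that])
    have lapF: "(radial_lap (2 * m) ^^ K) F q = b ^ m * G (b * q) - a ^ m * G (a * q)" for q
    proof -
      have "(radial_lap (2 * m) ^^ K) F
          = scale_avg (\<lambda>\<sigma>. \<sigma> ^ K * w \<sigma>) a b ((radial_lap (2 * m) ^^ K) bump_profile)"
        unfolding F_def by (rule radial_lap_pow_scale_avg[OF w smooth1_bump_profile])
      also have "(radial_lap (2 * m) ^^ K) bump_profile = radial_lap (2 * m) G0"
        using K(1) by (cases K) (auto simp: G0_def)
      also have "scale_avg (\<lambda>\<sigma>. \<sigma> ^ K * w \<sigma>) a b (radial_lap (2 * m) G0)
          = scale_avg (\<lambda>\<sigma>. \<sigma> ^ (m - 1)) a b (radial_lap (2 * m) G0)"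
      proof (rule scale_avg_cong)
        fix \<sigma> assume "\<sigma> \<in> {a..b}"
        then have \<sigma>: "\<sigma> \<noteq> 0" using ab by auto
        have "\<sigma> ^ K * \<sigma> ^ s = \<sigma> ^ m" using K(3) by (metis add.commute power_add)
        also have "\<dots> = \<sigma> * \<sigma> ^ (m - 1)" using m by (cases m) auto
        finally show "\<sigma> ^ K * w \<sigma> = \<sigma> ^ (m - 1)" using \<sigma> by (simp add: w_def field_simps)
      qed
      finally show ?thesis
        using scale_avg_radial_lap_telescopes[OF G0(1) m ab(2), of q] by (simp add: G_def)
    qed
    have bound: "dual_profile m F (t\<^sup>2) \<le> (if a * t\<^sup>2 < 1 then (C0 + 2 * C1) / t ^ m else 0)" if t: "0 < t" for t
    proof (cases "a * t\<^sup>2 < 1")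
      case True
      show ?thesis
      proof (cases "even m")
        case even: True
        then have s: "s = K" "2 * K = m" "K = Suc (K - 1)" using K by (auto simp: K_def)
        have "F = scale_avg (\<lambda>\<sigma>. \<sigma> ^ (K - 1)) a b bump_profile"
          unfolding F_def
        proof (rule scale_avg_cong)
          fix \<sigma> assume "\<sigma> \<in> {a..b}"
          then have \<sigma>: "\<sigma> \<noteq> 0" using ab by auto
          have "\<sigma> ^ K = \<sigma> * \<sigma> ^ (K - 1)" by (subst s(3)) simp
          then show "w \<sigma> = \<sigma> ^ (K - 1)" using \<sigma> by (simp add: w_def s(1))
        qed
        then have "\<bar>F (t\<^sup>2)\<bar> \<le> C0 * (1 / t\<^sup>2) ^ Suc (K - 1)"
          using scale_avg_power_bound[OF smooth1_bump_profile bump_profile_zero C0(2) ab(1), of "t\<^sup>2"] t by simp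
        also have "\<dots> = C0 / t ^ m"
          unfolding s(3)[symmetric] by (simp add: power_divide power_mult[symmetric] s(2))
        also have "\<dots> \<le> (C0 + 2 * C1) / t ^ m" using C1 t by (intro divide_right_mono) auto
        finally show ?thesis using True even by (simp add: dual_profile_def)
      next
        case odd: False
        then have s: "m = 2 * s + 1" using K by (auto simp: K_def elim!: oddE)
        have "deriv F = scale_avg (\<lambda>\<sigma>. \<sigma> * w \<sigma>) a b (deriv bump_profile)"
          unfolding F_def by (rule deriv_scale_avg[OF w smooth1_bump_profile])
        also have "\<dots> = scale_avg (\<lambda>\<sigma>. \<sigma> ^ s) a b (deriv bump_profile)"
          by (rule scale_avg_cong) (use ab in \<open>auto simp: w_def\<close>)
        finally have "\<bar>deriv F (t\<^sup>2)\<bar> \<le> C1 * (1 / t\<^sup>2) ^ Suc s"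
          using scale_avg_power_bound[OF d C1(2) ab(1), of "t\<^sup>2"] t by simp
        then have "2 * t * \<bar>deriv F (t\<^sup>2)\<bar> \<le> 2 * t * (C1 * (1 / t\<^sup>2) ^ Suc s)"
          using t by (intro mult_left_mono) auto
        also have "(1 / t\<^sup>2) ^ Suc s = 1 / (t * t ^ m)"
          by (simp add: s power_divide power2_eq_square power_mult_distrib power_add[symmetric] mult_2)
        also have "2 * t * (C1 * (1 / (t * t ^ m))) = 2 * C1 / t ^ m" using t by simp
        also have "\<dots> \<le> (C0 + 2 * C1) / t ^ m" using C0 t by (intro divide_right_mono) auto
        finally show ?thesis using True odd t by (simp add: dual_profile_def)
      qed
    next
      case False
      then have "1 \<le> a * t\<^sup>2" by simp
      moreover have "deriv F (t\<^sup>2) = 0"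
        by (rule smooth1_deriv_vanishes[OF F, where c = "1 / a"])
          (use van ab False in \<open>auto simp: field_simps\<close>)
      ultimately show ?thesis using van False by (simp add: dual_profile_def)
    qed
    show ?thesis using F van lapF bound by blast
  qed
  have "0 < C0 + 2 * C1" using C0 C1 by simp
  then show ?thesis using that[of "C0 + 2 * C1" G] G mG ex by blast
qed

section \<open>Pointwise bounds by potentials and maximal functions\<close>

text \<open>Test with the truncated fundamental solution for \<open>a = r\<^bsup>-2\<^esup>\<close> and
  let \<open>b\<close> tend to infinity at a Lebesgue point: the approximate identity recovers
  a non-zero multiple of \<open>u(x)\<close>, and all other terms are bounded independently of
  \<open>b\<close>.\<close>

lemma pointwise_potential_bound:
  assumes n: "DIM('a::euclidean_space) = 2 * m" and m: "1 \<le> m"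
  shows "\<exists>C>0. \<forall>(u :: 'a \<Rightarrow> real) f. radial_pairing m u f \<longrightarrow> (AE x in lborel. \<forall>r>0. ennreal \<bar>u x\<bar> \<le> ennreal C *
      (ennreal (1 / r ^ (2 * m)) * (\<integral>\<^sup>+y\<in>ball x r. ennreal \<bar>u y\<bar> \<partial>lborel)
        + (\<integral>\<^sup>+y\<in>ball x r. ennreal (f y / norm (y - x) ^ m) \<partial>lborel)))"
proof -
  obtain C1 G where C1: "0 < C1" and G: "smooth1 G" "\<And>q. 1 \<le> q \<Longrightarrow> G q = 0" "moment (m - 1) G \<noteq> 0"
    and ex: "\<And>a b. 0 < a \<Longrightarrow> a \<le> b \<Longrightarrow> \<exists>F. smooth1 F \<and> (\<forall>q. 1 \<le> a * q \<longrightarrow> F q = 0) \<and>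
       (\<forall>q. (radial_lap (2 * m) ^^ ((m + 1) div 2)) F q = b ^ m * G (b * q) - a ^ m * G (a * q)) \<and>
       (\<forall>t>0. dual_profile m F (t\<^sup>2) \<le> (if a * t\<^sup>2 < 1 then C1 / t ^ m else 0))"
    using truncated_fundamental_solution[OF m] by blast
  define \<kappa> where "\<kappa> = unit_ball_vol (real DIM('a)) * m * moment (m - 1) G"
  have "unit_ball_vol (real DIM('a)) \<noteq> 0"
    by (metis less_irrefl unit_ball_vol_pos of_nat_0_le_iff)
  then have \<kappa>: "0 < \<bar>\<kappa>\<bar>" using G(3) m by (simp add: \<kappa>_def)
  obtain CG where CG: "0 < CG" "\<And>q. 0 \<le> q \<Longrightarrow> \<bar>G q\<bar> \<le> CG"
    using smooth1_bounded[OF G(1,2)] by blast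
  define C where "C = (CG + C1) / \<bar>\<kappa>\<bar>"
  have C: "0 < C" using CG C1 \<kappa> by (simp add: C_def)
  have "AE x in lborel. \<forall>r>0. ennreal \<bar>u x\<bar> \<le> ennreal C *
      (ennreal (1 / r ^ (2 * m)) * (\<integral>\<^sup>+y\<in>ball x r. ennreal \<bar>u y\<bar> \<partial>lborel)
        + (\<integral>\<^sup>+y\<in>ball x r. ennreal (f y / norm (y - x) ^ m) \<partial>lborel))"
    if pair: "radial_pairing m u f" for u f :: "'a \<Rightarrow> real"
  proof -
    note u [measurable] = radial_pairingD(1)[OF pair] and f [measurable] = radial_pairingD(2)[OF pair]
    note f0 = radial_pairingD(3)[OF pair] and loc = radial_pairingD(4)[OF pair]
    show ?thesis
    using AE_lebesgue_point[OF u loc]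
  proof (eventually_elim, intro allI impI)
    fix x :: 'a and r :: real
    assume x: "\<forall>e>0. \<forall>\<^sub>F r in at_right 0.
      (\<integral>\<^sup>+y\<in>ball x r. ennreal \<bar>u y - u x\<bar> \<partial>lborel) \<le> ennreal (e * r ^ DIM('a))" and r: "0 < r"
    have [measurable]: "ball x r \<in> sets borel" for r :: real by simp
    have [measurable]: "G \<in> borel_measurable borel"
      using smooth1_continuous_on[OF G(1), of UNIV] by (rule borel_measurable_continuous_onI)
    let ?A = "\<integral>\<^sup>+y\<in>ball x r. ennreal \<bar>u y\<bar> \<partial>lborel"
    let ?V = "\<integral>\<^sup>+y\<in>ball x r. ennreal (f y / norm (y - x) ^ m) \<partial>lborel"
    define a where "a = 1 / r\<^sup>2"
    have a: "0 < a" "1 / sqrt a = r" "a ^ m = 1 / r ^ (2 * m)"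
      using r by (auto simp: a_def real_sqrt_divide power_divide power_mult)
    define X where "X b = b ^ m * (\<integral>y. u y * G (b * (norm (y - x))\<^sup>2) \<partial>lborel)" for b
    have int: "integrable lborel (\<lambda>y. u y * G (b * (norm (y - x))\<^sup>2))" if "0 < b" for b
      by (rule integrable_mult_radial_profile[OF u loc G(1,2) that])
    have Xa: "ennreal \<bar>X a\<bar> \<le> ennreal CG * (ennreal (1 / r ^ (2 * m)) * ?A)"
    proof -
      have "ennreal \<bar>\<integral>y. u y * G (a * (norm (y - x))\<^sup>2) \<partial>lborel\<bar>
          \<le> (\<integral>\<^sup>+y. norm (u y * G (a * (norm (y - x))\<^sup>2)) \<partial>lborel)"
        using integral_norm_bound_ennreal[OF int[OF a(1)]] by simp
      also have "\<dots> \<le> (\<integral>\<^sup>+y. ennreal CG * (ennreal \<bar>u y\<bar> * indicator (ball x r) y) \<partial>lborel)"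
      proof (intro nn_integral_mono)
        fix y
        show "ennreal (norm (u y * G (a * (norm (y - x))\<^sup>2))) \<le> ennreal CG * (ennreal \<bar>u y\<bar> * indicator (ball x r) y)"
        proof (cases "G (a * (norm (y - x))\<^sup>2) = 0")
          case False
          have "\<bar>u y\<bar> * \<bar>G (a * (norm (y - x))\<^sup>2)\<bar> \<le> \<bar>u y\<bar> * CG"
            using CG(2)[of "a * (norm (y - x))\<^sup>2"] a by (intro mult_left_mono) auto
          moreover have "y \<in> ball x r"
            using radial_profile_support[where H = G, OF G(2) a(1) False] a(2) by simp
          ultimately show ?thesis using CG(1)
            by (simp add: abs_mult ennreal_mult[symmetric] ennreal_leI mult.commute)
        qed simp
      qed
      also have "\<dots> = ennreal CG * ?A" by (rule nn_integral_cmult) measurable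
      finally have "ennreal (a ^ m) * ennreal \<bar>\<integral>y. u y * G (a * (norm (y - x))\<^sup>2) \<partial>lborel\<bar>
          \<le> ennreal (a ^ m) * (ennreal CG * ?A)" by (rule mult_left_mono) simp
      moreover have "ennreal \<bar>X a\<bar> = ennreal (a ^ m) * ennreal \<bar>\<integral>y. u y * G (a * (norm (y - x))\<^sup>2) \<partial>lborel\<bar>"
        using a(1) by (simp add: X_def abs_mult ennreal_mult)
      ultimately show ?thesis unfolding a(3) by (simp add: mult.left_commute)
    qed
    have XX: "ennreal \<bar>X b\<bar> \<le> ennreal CG * (ennreal (1 / r ^ (2 * m)) * ?A) + ennreal C1 * ?V"
      if b: "a \<le> b" for b
    proof -
      have b0: "0 < b" using a b by linarith
      obtain F where F: "smooth1 F" "\<And>q. 1 \<le> a * q \<Longrightarrow> F q = 0"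
        "\<And>q. (radial_lap (2 * m) ^^ ((m + 1) div 2)) F q = b ^ m * G (b * q) - a ^ m * G (a * q)"
        "\<And>t. 0 < t \<Longrightarrow> dual_profile m F (t\<^sup>2) \<le> (if a * t\<^sup>2 < 1 then C1 / t ^ m else 0)"
        using ex[OF a(1) b] by blast
      have "\<forall>q\<ge>1 / a. F q = 0" using F(2) a(1) by (auto simp: field_simps)
      then have "ennreal \<bar>\<integral>y. u y * (radial_lap (2 * m) ^^ ((m + 1) div 2)) F ((norm (y - x))\<^sup>2) \<partial>lborel\<bar>
         \<le> (\<integral>\<^sup>+y. ennreal (f y * dual_profile m F ((norm (y - x))\<^sup>2)) \<partial>lborel)"
        using pair F(1) unfolding radial_pairing_def by blast
      also have "(\<integral>y. u y * (radial_lap (2 * m) ^^ ((m + 1) div 2)) F ((norm (y - x))\<^sup>2) \<partial>lborel)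
         = (\<integral>y. b ^ m * (u y * G (b * (norm (y - x))\<^sup>2)) - a ^ m * (u y * G (a * (norm (y - x))\<^sup>2)) \<partial>lborel)"
        by (intro Bochner_Integration.integral_cong refl) (simp only: F(3), simp add: algebra_simps)
      also have "\<dots> = X b - X a"
        unfolding X_def
        by (subst Bochner_Integration.integral_diff) (auto intro!: int a b0)
      also have "(\<integral>\<^sup>+y. ennreal (f y * dual_profile m F ((norm (y - x))\<^sup>2)) \<partial>lborel)
         \<le> (\<integral>\<^sup>+y. ennreal C1 * (ennreal (f y / norm (y - x) ^ m) * indicator (ball x r) y) \<partial>lborel)"
      proof (rule nn_integral_mono_AE)
        have "AE y in lborel. y \<noteq> x" by (rule AE_lborel_singleton)
        then show "AE y in lborel. ennreal (f y * dual_profile m F ((norm (y - x))\<^sup>2))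
           \<le> ennreal C1 * (ennreal (f y / norm (y - x) ^ m) * indicator (ball x r) y)"
        proof eventually_elim
          fix y assume "y \<noteq> x"
          then have t: "0 < norm (y - x)" by simp
          show "ennreal (f y * dual_profile m F ((norm (y - x))\<^sup>2))
           \<le> ennreal C1 * (ennreal (f y / norm (y - x) ^ m) * indicator (ball x r) y)"
          proof (cases "a * (norm (y - x))\<^sup>2 < 1")
            case True
            then have "(norm (y - x))\<^sup>2 < r\<^sup>2" using r by (simp add: a_def field_simps)
            then have "norm (y - x) < r" using r by (simp add: power_less_imp_less_base)
            then have "y \<in> ball x r" by (simp add: dist_norm norm_minus_commute)
            moreover have "f y * dual_profile m F ((norm (y - x))\<^sup>2) \<le> f y * (C1 / norm (y - x) ^ m)"
              using F(4)[OF t] True f0 by (intro mult_left_mono) auto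
            ultimately show ?thesis using C1 f0
              by (simp add: ennreal_mult[symmetric] ennreal_leI mult.commute)
          next
            case False
            then have "f y * dual_profile m F ((norm (y - x))\<^sup>2) \<le> 0"
              using F(4)[OF t] f0[of y] by (simp add: mult_nonneg_nonpos)
            then show ?thesis by (simp add: ennreal_neg)
          qed
        qed
      qed
      also have "\<dots> = ennreal C1 * ?V" by (rule nn_integral_cmult) measurable
      finally have d: "ennreal \<bar>X b - X a\<bar> \<le> ennreal C1 * ?V" .
      have "ennreal \<bar>X b\<bar> \<le> ennreal (\<bar>X a\<bar> + \<bar>X b - X a\<bar>)" by (intro ennreal_leI) linarith
      also have "\<dots> = ennreal \<bar>X a\<bar> + ennreal \<bar>X b - X a\<bar>" by simp
      also have "\<dots> \<le> ennreal CG * (ennreal (1 / r ^ (2 * m)) * ?A) + ennreal C1 * ?V"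
        by (rule add_mono[OF Xa d])
      finally show ?thesis .
    qed
    have "(X \<longlongrightarrow> u x * \<kappa>) at_top"
      unfolding X_def \<kappa>_def by (rule approximate_identity_at_lebesgue_point[OF n m u loc x G(1,2)])
    then have "((\<lambda>b. ennreal \<bar>X b\<bar>) \<longlongrightarrow> ennreal \<bar>u x * \<kappa>\<bar>) at_top"
      by (intro tendsto_ennrealI tendsto_rabs)
    then have "ennreal \<bar>u x * \<kappa>\<bar> \<le> ennreal CG * (ennreal (1 / r ^ (2 * m)) * ?A) + ennreal C1 * ?V"
      by (rule tendsto_upperbound) (auto intro: eventually_mono[OF eventually_ge_at_top[of a] XX])
    also have "\<dots> \<le> ennreal (CG + C1) * (ennreal (1 / r ^ (2 * m)) * ?A + ?V)"
      unfolding distrib_left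
      using CG C1 by (intro add_mono mult_right_mono ennreal_leI) auto
    finally have "ennreal (1 / \<bar>\<kappa>\<bar>) * ennreal \<bar>u x * \<kappa>\<bar>
       \<le> ennreal (1 / \<bar>\<kappa>\<bar>) * (ennreal (CG + C1) * (ennreal (1 / r ^ (2 * m)) * ?A + ?V))"
      by (rule mult_left_mono) simp
    moreover have "ennreal (1 / \<bar>\<kappa>\<bar>) * ennreal \<bar>u x * \<kappa>\<bar> = ennreal \<bar>u x\<bar>"
      using \<kappa> by (simp add: ennreal_mult[symmetric] abs_mult)
    moreover have "ennreal (1 / \<bar>\<kappa>\<bar>) * ennreal (CG + C1) = ennreal C"
      using CG C1 by (subst ennreal_mult[symmetric]) (auto simp: C_def)
    ultimately show "ennreal \<bar>u x\<bar> \<le> ennreal C * (ennreal (1 / r ^ (2 * m)) * ?A + ?V)"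
      by (simp add: mult.assoc[symmetric])
  qed
  qed
  then show ?thesis using C by blast
qed

lemma ennreal_le_of_square_le:
  fixes A :: ennreal
  assumes "A\<^sup>2 \<le> ennreal (s\<^sup>2)" "0 \<le> s"
  shows "A \<le> ennreal s"
proof (cases A)
  case (real r)
  then have "ennreal (r\<^sup>2) \<le> ennreal (s\<^sup>2)" using assms(1) by (simp add: ennreal_power)
  then have "r\<^sup>2 \<le> s\<^sup>2" by (subst (asm) ennreal_le_iff) auto
  then have "r \<le> s" using assms(2) by (rule power2_le_imp_le)
  then show ?thesis using real by (simp add: ennreal_leI)
next
  case top
  then show ?thesis using assms(1) by (simp add: top_unique ennreal_top_eq_mult_iff power2_eq_square)
qed

lemma ball_L1_le_L2:
  fixes u :: "'a::euclidean_space \<Rightarrow> real"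
  assumes n: "DIM('a) = 2 * m" and [measurable]: "u \<in> borel_measurable borel"
    and u1: "(\<integral>\<^sup>+y. ennreal ((u y)\<^sup>2) \<partial>lborel) \<le> 1" and r: "0 < r"
  shows "(\<integral>\<^sup>+y\<in>ball x r. ennreal \<bar>u y\<bar> \<partial>lborel) \<le> ennreal (sqrt (unit_ball_vol (real DIM('a))) * r ^ m)"
proof (rule ennreal_le_of_square_le)
  have [measurable]: "ball x r \<in> sets borel" by simp
  have "(\<integral>\<^sup>+y. ennreal \<bar>u y\<bar> * indicator (ball x r) y \<partial>lborel)\<^sup>2
     \<le> (\<integral>\<^sup>+y. (ennreal \<bar>u y\<bar>)\<^sup>2 \<partial>lborel) * (\<integral>\<^sup>+y. (indicator (ball x r) y)\<^sup>2 \<partial>lborel)"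
    by (rule Cauchy_Schwarz_nn_integral) auto
  also have "(\<integral>\<^sup>+y. (ennreal \<bar>u y\<bar>)\<^sup>2 \<partial>lborel) = (\<integral>\<^sup>+y. ennreal ((u y)\<^sup>2) \<partial>lborel)"
    by (simp add: ennreal_power)
  also have "(\<integral>\<^sup>+y. (indicator (ball x r) y :: ennreal)\<^sup>2 \<partial>lborel) = (\<integral>\<^sup>+y. indicator (ball x r) y \<partial>lborel)"
    by (intro nn_integral_cong) (auto split: split_indicator)
  also have "\<dots> = emeasure lborel (ball x r)" by simp
  also have "(\<integral>\<^sup>+y. ennreal ((u y)\<^sup>2) \<partial>lborel) * emeasure lborel (ball x r) \<le> 1 * emeasure lborel (ball x r)"
    by (rule mult_right_mono[OF u1]) simp
  also have "\<dots> = ennreal ((sqrt (unit_ball_vol (real DIM('a))) * r ^ m)\<^sup>2)"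
    using r by (simp add: emeasure_ball_power ennreal_mult[symmetric] power_mult_distrib n
        power_mult[symmetric] mult.commute)
  finally show "(\<integral>\<^sup>+y\<in>ball x r. ennreal \<bar>u y\<bar> \<partial>lborel)\<^sup>2
     \<le> ennreal ((sqrt (unit_ball_vol (real DIM('a))) * r ^ m)\<^sup>2)" .
qed (use r in auto)

lemma hl_max_ball_bound:
  fixes w :: "'a::euclidean_space \<Rightarrow> ennreal"
  assumes "0 < r"
  shows "(\<integral>\<^sup>+y\<in>ball x r. w y \<partial>lborel) \<le> hl_max w x * ennreal (r ^ DIM('a))"
  using hl_max_greater_iff[of "hl_max w x" w x] assms
  by (auto simp: not_less dest!: spec[of _ r])

text \<open>Decompose the ball into dyadic shells. The shell at distance about
  \<open>2\<^bsup>-j\<^esup>r\<close> contributes at most a multiple of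
  \<open>(2\<^bsup>-j\<^esup>r)\<^bsup>-m\<^esup>
  (2\<^bsup>-j\<^esup>r)\<^bsup>2m\<^esup>\<close> times the maximal function, which is a
  convergent geometric series.\<close>

lemma riesz_potential_hl_bound:
  fixes f :: "'a::euclidean_space \<Rightarrow> real"
  assumes n: "DIM('a) = 2 * m" and m: "1 \<le> m" and [measurable]: "f \<in> borel_measurable borel"
    and f0: "\<And>x. 0 \<le> f x" and r: "0 < r"
  shows "(\<integral>\<^sup>+y\<in>ball x r. ennreal (f y / norm (y - x) ^ m) \<partial>lborel)
    \<le> ennreal (2 ^ (m + 1) * r ^ m) * hl_max (\<lambda>y. ennreal (f y)) x"
proof -
  have [measurable]: "ball x s \<in> sets borel" for s :: real by simp
  let ?M = "hl_max (\<lambda>y. ennreal (f y)) x"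
  define c where "c j = (2 ^ Suc j / r) ^ m" for j :: nat
  have c: "0 \<le> c j" for j using r by (simp add: c_def)
  have "(\<integral>\<^sup>+y\<in>ball x r. ennreal (f y / norm (y - x) ^ m) \<partial>lborel)
     \<le> (\<integral>\<^sup>+y. (\<Sum>j. ennreal (c j) * (ennreal (f y) * indicator (ball x (r / 2 ^ j)) y)) \<partial>lborel)"
  proof (intro nn_integral_mono)
    fix y
    show "ennreal (f y / norm (y - x) ^ m) * indicator (ball x r) y
       \<le> (\<Sum>j. ennreal (c j) * (ennreal (f y) * indicator (ball x (r / 2 ^ j)) y))"
    proof (cases "y \<in> ball x r \<and> y \<noteq> x")
      case True
      define t where "t = norm (y - x)"
      have t: "0 < t" "t < r" using True by (auto simp: t_def dist_norm norm_minus_commute)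
      have ex: "\<exists>j. r / 2 ^ Suc j \<le> t"
      proof -
        obtain j where "r / t < 2 ^ j" using real_arch_pow[of 2 "r / t"] by auto
        then have "r \<le> t * 2 ^ Suc j" using t by (simp add: field_simps)
        then show ?thesis by (intro exI[of _ j]) (simp add: field_simps)
      qed
      \<comment> \<open>The index of the dyadic shell that contains \<open>y\<close>.\<close>
      define j where "j = (LEAST j. r / 2 ^ Suc j \<le> t)"
      have j: "r / 2 ^ Suc j \<le> t" "\<And>i. i < j \<Longrightarrow> \<not> r / 2 ^ Suc i \<le> t"
        unfolding j_def by (rule LeastI_ex[OF ex]) (rule not_less_Least)
      have jt: "t < r / 2 ^ j"
      proof (cases j)
        case 0
        then show ?thesis using t by simp
      next
        case (Suc i)
        then show ?thesis using j(2)[of i] by simp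
      qed
      have "f y / t ^ m = f y * (1 / t) ^ m" by (simp add: power_divide)
      also have "\<dots> \<le> f y * c j"
        unfolding c_def using j(1) t r f0 by (intro mult_left_mono power_mono) (auto simp: field_simps)
      finally have "ennreal (f y / norm (y - x) ^ m) * indicator (ball x r) y
         \<le> ennreal (c j) * (ennreal (f y) * indicator (ball x (r / 2 ^ j)) y)"
        using True jt f0 c[of j]
        by (simp add: t_def dist_norm norm_minus_commute ennreal_mult[symmetric] ennreal_leI mult.commute)
      also have "\<dots> = (\<Sum>j\<in>{j}. ennreal (c j) * (ennreal (f y) * indicator (ball x (r / 2 ^ j)) y))" by simp
      also have "\<dots> \<le> (\<Sum>j. ennreal (c j) * (ennreal (f y) * indicator (ball x (r / 2 ^ j)) y))"
        by (intro sum_le_suminf) auto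
      finally show ?thesis .
    next
      case False
      then show ?thesis using m by (auto simp: power_0_left)
    qed
  qed
  also have "\<dots> = (\<Sum>j. ennreal (c j) * (\<integral>\<^sup>+y\<in>ball x (r / 2 ^ j). ennreal (f y) \<partial>lborel))"
    by (simp add: nn_integral_suminf nn_integral_cmult)
  also have "\<dots> \<le> (\<Sum>j. ennreal (2 ^ m * r ^ m * (1 / 2) ^ j) * ?M)"
  proof (intro suminf_le)
    fix j :: nat
    have "ennreal (c j) * (\<integral>\<^sup>+y\<in>ball x (r / 2 ^ j). ennreal (f y) \<partial>lborel)
       \<le> ennreal (c j) * (?M * ennreal ((r / 2 ^ j) ^ DIM('a)))"
      using r by (intro mult_left_mono hl_max_ball_bound) auto
    also have "\<dots> = ennreal (c j * (r / 2 ^ j) ^ DIM('a)) * ?M"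
      using c r by (simp add: ennreal_mult mult_ac)
    also have "\<dots> \<le> ennreal (2 ^ m * r ^ m * (1 / 2) ^ j) * ?M"
    proof (intro mult_right_mono ennreal_leI)
      have "c j * (r / 2 ^ j) ^ DIM('a) = ((2 ^ Suc j / r) * (r / 2 ^ j) * (r / 2 ^ j)) ^ m"
        unfolding c_def n by (simp only: power_mult_distrib power_mult power2_eq_square mult.assoc)
      also have "(2 ^ Suc j / r) * (r / 2 ^ j) * (r / 2 ^ j) = 2 * r * (1 / 2) ^ j"
        using r by (simp add: power_divide)
      also have "(2 * r * (1 / 2) ^ j) ^ m = 2 ^ m * r ^ m * ((1 / 2) ^ j) ^ m"
        by (simp add: power_mult_distrib)
      also have "\<dots> \<le> 2 ^ m * r ^ m * (1 / 2) ^ j"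
      proof (intro mult_left_mono)
        show "((1 / 2 :: real) ^ j) ^ m \<le> (1 / 2) ^ j"
          using power_decreasing[of 1 m "(1 / 2 :: real) ^ j"] m by (simp add: power_le_one)
      qed (use r in auto)
      finally show "c j * (r / 2 ^ j) ^ DIM('a) \<le> 2 ^ m * r ^ m * (1 / 2) ^ j" .
    qed simp
    finally show "ennreal (c j) * (\<integral>\<^sup>+y\<in>ball x (r / 2 ^ j). ennreal (f y) \<partial>lborel)
       \<le> ennreal (2 ^ m * r ^ m * (1 / 2) ^ j) * ?M" .
  qed auto
  also have "\<dots> = (\<Sum>j. ennreal (2 ^ m * r ^ m * (1 / 2) ^ j)) * ?M" by simp
  also have "(\<Sum>j. ennreal (2 ^ m * r ^ m * (1 / 2) ^ j)) = ennreal (2 ^ m * r ^ m * 2)"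
  proof (rule suminf_ennreal_eq)
    have "(\<lambda>j. (1 / 2 :: real) ^ j) sums 2" using geometric_sums[of "1 / 2 :: real"] by simp
    then show "(\<lambda>j. 2 ^ m * r ^ m * (1 / 2) ^ j) sums (2 ^ m * r ^ m * 2)" by (rule sums_mult)
  qed (use r in auto)
  finally show ?thesis by (simp add: mult_ac)
qed

text \<open>The kernel \<open>|y - x|\<^bsup>-m\<^esup>\<close> just fails to be square integrable in
  dimension \<open>2m\<close>, with a logarithmic divergence. The square root of a logarithm
  that Cauchy-Schwarz leaves is the reason why \<open>u\<^sup>2\<close> is exponentially
  integrable.\<close>

lemma annulus_potential_bound:
  fixes f :: "'a::euclidean_space \<Rightarrow> real"
  assumes n: "DIM('a) = 2 * m" and m: "1 \<le> m" and [measurable]: "f \<in> borel_measurable borel"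
    and f0: "\<And>x. 0 \<le> f x" and f1: "(\<integral>\<^sup>+y. ennreal ((f y)\<^sup>2) \<partial>lborel) \<le> 1"
    and d: "0 < d" "d \<le> 1"
  shows "(\<integral>\<^sup>+y\<in>ball x 1 - ball x d. ennreal (f y / norm (y - x) ^ m) \<partial>lborel)
    \<le> ennreal (sqrt (2 * unit_ball_vol (real DIM('a)) * m * ln (1 / d)))"
proof (rule ennreal_le_of_square_le)
  define \<omega> where "\<omega> = unit_ball_vol (real DIM('a))"
  have om: "0 \<le> \<omega>" by (simp add: \<omega>_def)
  have ln0: "0 \<le> ln (1 / d)" using d by simp
  have [measurable]: "ball x s \<in> sets borel" for s :: real by simp
  \<comment> \<open>The squared kernel on the annulus, as a profile.\<close>
  define h where "h q = ennreal (1 / q ^ m) * indicator {d\<^sup>2..1} q" for q :: real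
  have [measurable]: "h \<in> borel_measurable borel" unfolding h_def by measurable
  have "(\<integral>\<^sup>+y. ennreal (f y) * (ennreal (1 / norm (y - x) ^ m) * indicator (ball x 1 - ball x d) y) \<partial>lborel)\<^sup>2
     \<le> (\<integral>\<^sup>+y. (ennreal (f y))\<^sup>2 \<partial>lborel) * (\<integral>\<^sup>+y. (ennreal (1 / norm (y - x) ^ m) * indicator (ball x 1 - ball x d) y)\<^sup>2 \<partial>lborel)"
    by (rule Cauchy_Schwarz_nn_integral) auto
  also have "(\<integral>\<^sup>+y. (ennreal (f y))\<^sup>2 \<partial>lborel) = (\<integral>\<^sup>+y. ennreal ((f y)\<^sup>2) \<partial>lborel)"
    using f0 by (simp add: ennreal_power)
  also have "(\<integral>\<^sup>+y. ennreal ((f y)\<^sup>2) \<partial>lborel) * (\<integral>\<^sup>+y. (ennreal (1 / norm (y - x) ^ m) * indicator (ball x 1 - ball x d) y)\<^sup>2 \<partial>lborel)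
     \<le> 1 * (\<integral>\<^sup>+y. h ((norm (y - x))\<^sup>2) \<partial>lborel)"
  proof (intro mult_mono f1 nn_integral_mono)
    fix y
    show "(ennreal (1 / norm (y - x) ^ m) * indicator (ball x 1 - ball x d) y)\<^sup>2 \<le> h ((norm (y - x))\<^sup>2)"
    proof (cases "y \<in> ball x 1 - ball x d")
      case True
      then have *: "d \<le> norm (y - x)" "norm (y - x) < 1" by (auto simp: dist_norm norm_minus_commute)
      then have "d\<^sup>2 \<le> (norm (y - x))\<^sup>2" "(norm (y - x))\<^sup>2 \<le> 1"
        using d by (auto intro: power_mono power_le_one)
      then show ?thesis using True
        by (simp add: h_def ennreal_power power_divide power_mult[symmetric] mult.commute)
    qed simp
  qed auto
  also have "1 * (\<integral>\<^sup>+y. h ((norm (y - x))\<^sup>2) \<partial>lborel)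
     = (\<integral>\<^sup>+q. ennreal (\<omega> * m * q ^ (m - 1)) * indicator {0..} q * h q \<partial>lborel)"
    unfolding \<omega>_def by (simp add: nn_integral_radial[OF n m])
  also have "\<dots> = (\<integral>\<^sup>+q. ennreal (\<omega> * m / q) * indicator {d\<^sup>2..1} q \<partial>lborel)"
  proof (intro nn_integral_cong)
    fix q :: real
    show "ennreal (\<omega> * m * q ^ (m - 1)) * indicator {0..} q * h q = ennreal (\<omega> * m / q) * indicator {d\<^sup>2..1} q"
    proof (cases "q \<in> {d\<^sup>2..1}")
      case True
      then have q: "0 < q" using d by (auto intro: less_le_trans[of 0 "d\<^sup>2"])
      have "q ^ m = q * q ^ (m - 1)" using m by (cases m) auto
      then show ?thesis using True q om by (simp add: h_def ennreal_mult[symmetric])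
    qed (simp add: h_def)
  qed
  also have "\<dots> = ennreal (\<omega> * m * ln 1 - \<omega> * m * ln (d\<^sup>2))"
  proof (rule nn_integral_FTC_Icc[where F = "\<lambda>q. \<omega> * m * ln q"])
    fix q :: real assume "q \<in> {d\<^sup>2..1}"
    then have q: "0 < q" using d by (auto intro: less_le_trans[of 0 "d\<^sup>2"])
    then show "((\<lambda>q. \<omega> * m * ln q) has_real_derivative \<omega> * m / q) (at q)"
      by (auto intro!: derivative_eq_intros)
    show "0 \<le> \<omega> * m / q" using q om by simp
  qed (use d in \<open>auto intro: power_le_one\<close>)
  also have "\<omega> * m * ln 1 - \<omega> * m * ln (d\<^sup>2) = (sqrt (2 * \<omega> * m * ln (1 / d)))\<^sup>2"
  proof -
    have "0 \<le> 2 * \<omega> * m * ln (1 / d)" using om ln0 by simp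
    then have "(sqrt (2 * \<omega> * m * ln (1 / d)))\<^sup>2 = 2 * \<omega> * m * ln (1 / d)" by (rule real_sqrt_pow2)
    then show ?thesis using d by (simp add: ln_div ln_realpow)
  qed
  finally show "(\<integral>\<^sup>+y\<in>ball x 1 - ball x d. ennreal (f y / norm (y - x) ^ m) \<partial>lborel)\<^sup>2
     \<le> ennreal ((sqrt (2 * unit_ball_vol (real DIM('a)) * m * ln (1 / d)))\<^sup>2)"
    using f0 by (simp add: \<omega>_def mult.assoc[symmetric] ennreal_mult[symmetric])
next
  show "0 \<le> sqrt (2 * unit_ball_vol (real DIM('a)) * m * ln (1 / d))" using d by simp
qed

text \<open>Both estimates of \<open>u(x)\<^sup>2\<close> matter: the linear one gives decay where the
  maximal function is small, and the logarithmic one controls the exponential where it is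
  large.\<close>

lemma hedberg_pointwise:
  assumes n: "DIM('a::euclidean_space) = 2 * m" and m: "1 \<le> m"
  shows "\<exists>D>0. \<forall>(u :: 'a \<Rightarrow> real) f. radial_pairing m u f \<longrightarrow>
    (\<integral>\<^sup>+y. ennreal ((u y)\<^sup>2) \<partial>lborel) \<le> 1 \<longrightarrow> (\<integral>\<^sup>+y. ennreal ((f y)\<^sup>2) \<partial>lborel) \<le> 1 \<longrightarrow>
    (AE x in lborel. \<forall>\<mu>\<ge>0. hl_max (\<lambda>y. ennreal (f y)) x = ennreal \<mu> \<longrightarrow>
      (u x)\<^sup>2 \<le> D * \<mu> \<and> (1 \<le> \<mu> \<longrightarrow> (u x)\<^sup>2 \<le> D * (1 + ln \<mu>)))"
proof -
  obtain C where C: "0 < C" and bound: "\<forall>(u :: 'a \<Rightarrow> real) f. radial_pairing m u f \<longrightarrow>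
    (AE x in lborel. \<forall>r>0. ennreal \<bar>u x\<bar> \<le> ennreal C *
      (ennreal (1 / r ^ (2 * m)) * (\<integral>\<^sup>+y\<in>ball x r. ennreal \<bar>u y\<bar> \<partial>lborel)
        + (\<integral>\<^sup>+y\<in>ball x r. ennreal (f y / norm (y - x) ^ m) \<partial>lborel)))"
    using pointwise_potential_bound[OF n m] by (elim exE conjE) (rule that)
  define \<omega> where "\<omega> = unit_ball_vol (real DIM('a))"
  have om: "0 \<le> \<omega>" by (simp add: \<omega>_def)
  define P where "P = sqrt \<omega> + 2 ^ (m + 1)"
  have P: "0 < P" "sqrt \<omega> \<le> P" "2 ^ (m + 1) \<le> P" using om by (auto simp: P_def add_nonneg_pos)
  define D where "D = 4 * (C * P)\<^sup>2 + 4 * C\<^sup>2 * \<omega>"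
  have D: "0 < D" using C P om by (simp add: D_def add_pos_nonneg)
  have "AE x in lborel. \<forall>\<mu>\<ge>0. hl_max (\<lambda>y. ennreal (f y)) x = ennreal \<mu> \<longrightarrow>
      (u x)\<^sup>2 \<le> D * \<mu> \<and> (1 \<le> \<mu> \<longrightarrow> (u x)\<^sup>2 \<le> D * (1 + ln \<mu>))"
    if pair: "radial_pairing m u f" and u1: "(\<integral>\<^sup>+y. ennreal ((u y)\<^sup>2) \<partial>lborel) \<le> 1"
      and f1: "(\<integral>\<^sup>+y. ennreal ((f y)\<^sup>2) \<partial>lborel) \<le> 1"
    for u f :: "'a \<Rightarrow> real"
  proof -
    note u [measurable] = radial_pairingD(1)[OF pair] and f [measurable] = radial_pairingD(2)[OF pair]
    note f0 = radial_pairingD(3)[OF pair]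
    show ?thesis
      using bound[rule_format, OF pair]
  proof (eventually_elim, intro allI impI conjI)
    fix x :: 'a and \<mu> :: real
    assume x: "\<forall>r>0. ennreal \<bar>u x\<bar> \<le> ennreal C *
      (ennreal (1 / r ^ (2 * m)) * (\<integral>\<^sup>+y\<in>ball x r. ennreal \<bar>u y\<bar> \<partial>lborel)
        + (\<integral>\<^sup>+y\<in>ball x r. ennreal (f y / norm (y - x) ^ m) \<partial>lborel))"
      and \<mu>: "0 \<le> \<mu>" "hl_max (\<lambda>y. ennreal (f y)) x = ennreal \<mu>"
    have [measurable]: "ball x s \<in> sets borel" for s :: real by simp
    have gen: "\<bar>u x\<bar> \<le> C * (sqrt \<omega> / r ^ m + V)"
      if r: "0 < r" and V: "0 \<le> V" "(\<integral>\<^sup>+y\<in>ball x r. ennreal (f y / norm (y - x) ^ m) \<partial>lborel) \<le> ennreal V" for r V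
    proof -
      have "ennreal \<bar>u x\<bar> \<le> ennreal C * (ennreal (1 / r ^ (2 * m)) * ennreal (sqrt \<omega> * r ^ m) + ennreal V)"
        using ball_L1_le_L2[OF n u u1 r, of x] V(2) x[rule_format, OF r] unfolding \<omega>_def
        by (elim order_trans) (intro mult_left_mono add_mono; simp)
      also have "\<dots> = ennreal (C * (1 / r ^ (2 * m) * (sqrt \<omega> * r ^ m) + V))"
        using C r V(1) om by (simp add: ennreal_mult[symmetric] ennreal_plus[symmetric] del: ennreal_plus)
      also have "1 / r ^ (2 * m) * (sqrt \<omega> * r ^ m) = sqrt \<omega> / r ^ m"
        using r by (simp add: mult_2 power_add)
      finally show ?thesis using C r V(1) om by (subst (asm) ennreal_le_iff) auto
    qed
    have rad: "(\<integral>\<^sup>+y\<in>ball x r. ennreal (f y / norm (y - x) ^ m) \<partial>lborel) \<le> ennreal (2 ^ (m + 1) * r ^ m * \<mu>)"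
      if "0 < r" for r
      using riesz_potential_hl_bound[OF n m f f0 that, of x] \<mu> that by (simp add: ennreal_mult'')
    \<comment> \<open>Every positive \<open>\<rho>\<close> is \<open>r\<^sup>m\<close> for some radius
      \<open>r\<close>.\<close>
    have \<rho>: "\<bar>u x\<bar> \<le> C * P * (1 / \<rho> + \<rho> * \<mu>)" if \<rho>: "0 < \<rho>" for \<rho>
    proof -
      define r where "r = root m \<rho>"
      have r: "0 < r" "r ^ m = \<rho>" using \<rho> m by (auto simp: r_def real_root_pow_pos2)
      have "\<bar>u x\<bar> \<le> C * (sqrt \<omega> / \<rho> + 2 ^ (m + 1) * \<rho> * \<mu>)"
        using gen[OF r(1) _ rad[OF r(1)]] r \<mu> \<rho> by simp
      also have "\<dots> \<le> C * (P / \<rho> + P * \<rho> * \<mu>)"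
        using C P \<rho> \<mu> by (intro mult_left_mono add_mono divide_right_mono mult_right_mono) auto
      finally show ?thesis by (simp add: algebra_simps)
    qed
    show "(u x)\<^sup>2 \<le> D * \<mu>"
    proof (cases "\<mu> = 0")
      case True
      have "u x = 0"
      proof (rule ccontr)
        assume "u x \<noteq> 0"
        then have ux: "0 < \<bar>u x\<bar>" by simp
        have CP: "0 < C * P" using C P by simp
        then have "\<bar>u x\<bar> \<le> C * P * (1 / (2 * (C * P) / \<bar>u x\<bar>) + 2 * (C * P) / \<bar>u x\<bar> * \<mu>)"
          by (intro \<rho> divide_pos_pos) (use CP ux in auto)
        also have "\<dots> = \<bar>u x\<bar> / 2" using True CP C P by (simp add: field_simps)
        finally show False using ux by simp
      qed
      then show ?thesis using True by simp
    next
      case False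
      then have s: "0 < sqrt \<mu>" "sqrt \<mu> * sqrt \<mu> = \<mu>" using \<mu> by auto
      \<comment> \<open>The choice \<open>\<rho> = r\<^sup>m = \<mu>\<^bsup>-1/2\<^esup>\<close> balances both
        terms.\<close>
      have "\<bar>u x\<bar> \<le> C * P * (1 / (1 / sqrt \<mu>) + 1 / sqrt \<mu> * \<mu>)"
        by (rule \<rho>) (use s in simp)
      also have "1 / sqrt \<mu> * \<mu> = sqrt \<mu>" using s by (simp add: field_simps)
      finally have "\<bar>u x\<bar> \<le> 2 * (C * P) * sqrt \<mu>" by (simp add: mult_ac)
      then have "\<bar>u x\<bar>\<^sup>2 \<le> (2 * (C * P) * sqrt \<mu>)\<^sup>2" by (rule power_mono) simp
      also have "\<dots> = 4 * (C * P)\<^sup>2 * \<mu>" using \<mu> by (simp add: power_mult_distrib)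
      also have "\<dots> \<le> D * \<mu>" using \<mu> om by (intro mult_right_mono) (auto simp: D_def)
      finally show ?thesis by simp
    qed
    assume \<mu>1: "1 \<le> \<mu>"
    \<comment> \<open>Inside radius \<open>d\<close> the maximal function contributes \<open>d\<^sup>m \<mu> =
      1\<close>; the annulus contributes the logarithm.\<close>
    define d where "d = root m (1 / \<mu>)"
    have d: "0 < d" "d \<le> 1" "d ^ m = 1 / \<mu>"
      using \<mu>1 m by (auto simp: d_def real_root_pow_pos2 real_root_le_1_iff)
    have "real m * ln d = ln (1 / \<mu>)" using d m by (simp add: ln_realpow[symmetric])
    then have lnd: "real m * ln (1 / d) = ln \<mu>" using d \<mu>1 by (simp add: ln_div)
    have ln0: "0 \<le> ln \<mu>" using \<mu>1 by simp
    have "(\<integral>\<^sup>+y\<in>ball x 1. ennreal (f y / norm (y - x) ^ m) \<partial>lborel)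
       \<le> (\<integral>\<^sup>+y. ennreal (f y / norm (y - x) ^ m) * indicator (ball x d) y
            + ennreal (f y / norm (y - x) ^ m) * indicator (ball x 1 - ball x d) y \<partial>lborel)"
      by (intro nn_integral_mono) (auto split: split_indicator)
    also have "\<dots> = (\<integral>\<^sup>+y\<in>ball x d. ennreal (f y / norm (y - x) ^ m) \<partial>lborel)
         + (\<integral>\<^sup>+y\<in>ball x 1 - ball x d. ennreal (f y / norm (y - x) ^ m) \<partial>lborel)"
      by (rule nn_integral_add) auto
    also have "\<dots> \<le> ennreal (2 ^ (m + 1) * d ^ m * \<mu>) + ennreal (sqrt (2 * \<omega> * m * ln (1 / d)))"
      using annulus_potential_bound[OF n m f f0 f1 d(1,2), of x]
      unfolding \<omega>_def by (intro add_mono rad d(1)) simp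
    also have "\<dots> = ennreal (2 ^ (m + 1) + sqrt (2 * \<omega> * ln \<mu>))"
      using d(3) \<mu>1 om ln0 lnd by (simp add: mult.assoc)
    finally have "\<bar>u x\<bar> \<le> C * (sqrt \<omega> / 1 ^ m + (2 ^ (m + 1) + sqrt (2 * \<omega> * ln \<mu>)))"
      by (intro gen) (use om ln0 in auto)
    then have "\<bar>u x\<bar> \<le> C * (P + sqrt (2 * \<omega> * ln \<mu>))" by (simp add: P_def add.assoc)
    then have "\<bar>u x\<bar>\<^sup>2 \<le> (C * (P + sqrt (2 * \<omega> * ln \<mu>)))\<^sup>2" by (rule power_mono) simp
    also have "\<dots> = C\<^sup>2 * (P + sqrt (2 * \<omega> * ln \<mu>))\<^sup>2" by (simp add: power_mult_distrib)
    also have "\<dots> \<le> C\<^sup>2 * (2 * P\<^sup>2 + 2 * (sqrt (2 * \<omega> * ln \<mu>))\<^sup>2)"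
      using sum_squares_bound[of P "sqrt (2 * \<omega> * ln \<mu>)"] by (intro mult_left_mono) (auto simp: power2_sum)
    also have "(sqrt (2 * \<omega> * ln \<mu>))\<^sup>2 = 2 * \<omega> * ln \<mu>" using om ln0 by simp
    also have "C\<^sup>2 * (2 * P\<^sup>2 + 2 * (2 * \<omega> * ln \<mu>)) = 2 * (C * P)\<^sup>2 + (4 * C\<^sup>2 * \<omega>) * ln \<mu>"
      by (simp add: algebra_simps power_mult_distrib)
    also have "\<dots> \<le> D + D * ln \<mu>"
      using ln0 om by (intro add_mono mult_right_mono) (auto simp: D_def)
    finally show "(u x)\<^sup>2 \<le> D * (1 + ln \<mu>)" by (simp add: algebra_simps)
  qed
  qed
  then show ?thesis using D by blast
qed

section \<open>The exponential remainder\<close>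

lemma exp_remainder_le: "0 \<le> y \<Longrightarrow> exp y - 1 - y \<le> y\<^sup>2 * exp (y::real)"
proof -
  assume y: "0 \<le> y"
  have "exp y * (1 - y\<^sup>2) \<le> 1 + y"
  proof (cases "1 \<le> y")
    case True
    then have "1 \<le> y\<^sup>2" by simp
    then have "exp y * (1 - y\<^sup>2) \<le> 0" by (simp add: mult_nonneg_nonpos)
    then show ?thesis using y by linarith
  next
    case False
    have "1 - y \<le> exp (- y)" using exp_ge_add_one_self[of "- y"] by simp
    then have "exp y * (1 - y) \<le> exp y * exp (- y)" by (intro mult_left_mono) auto
    then have "exp y * (1 - y) \<le> 1" by (simp add: exp_minus)
    then have "exp y * (1 - y) * (1 + y) \<le> 1 * (1 + y)" using y by (intro mult_right_mono) auto
    then show ?thesis by (simp add: algebra_simps power2_eq_square)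
  qed
  then show ?thesis by (simp add: algebra_simps)
qed

text \<open>For \<open>\<mu> \<le> 1\<close> the exponential is bounded and the square of \<open>v \<le>
  D\<mu>\<close> suffices. For \<open>\<mu> > 1\<close> the exponential costs a factor
  \<open>3\<mu>\<close> by the logarithmic bound, and \<open>(1 + log \<mu>)\<^sup>2 \<le>
  4\<mu>\<close>.\<close>

lemma exp_remainder_hedberg:
  fixes v \<mu> b D :: real
  assumes b: "0 \<le> b" and D: "0 < D" and bD: "b * D \<le> 1" and v: "0 \<le> v" "v \<le> D * \<mu>" and \<mu>: "0 \<le> \<mu>"
    and vln: "1 \<le> \<mu> \<Longrightarrow> v \<le> D * (1 + ln \<mu>)"
  shows "exp (b * v) - 1 - b * v \<le> 12 * (b * D)\<^sup>2 * \<mu>\<^sup>2"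
proof -
  define y where "y = b * v"
  have y: "0 \<le> y" using b v by (simp add: y_def)
  have main: "y\<^sup>2 * exp y \<le> 12 * (b * D)\<^sup>2 * \<mu>\<^sup>2"
  proof (cases "\<mu> \<le> 1")
    case True
    have yb: "y \<le> (b * D) * \<mu>" using mult_left_mono[OF v(2) b] by (simp add: y_def mult.assoc)
    also have "\<dots> \<le> 1 * 1" using bD True b D \<mu> by (intro mult_mono) auto
    finally have "exp y \<le> exp 1" by simp
    then have "exp y \<le> 3" using exp_le by linarith
    moreover have "y\<^sup>2 \<le> ((b * D) * \<mu>)\<^sup>2" using yb y by (rule power_mono)
    ultimately have "y\<^sup>2 * exp y \<le> ((b * D) * \<mu>)\<^sup>2 * 3" by (intro mult_mono) auto
    also have "\<dots> \<le> 12 * (b * D)\<^sup>2 * \<mu>\<^sup>2" by (simp add: power_mult_distrib)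
    finally show ?thesis .
  next
    case False
    then have \<mu>1: "1 < \<mu>" by simp
    define l where "l = 1 + ln \<mu>"
    have l: "0 \<le> l" using \<mu>1 by (simp add: l_def)
    have yb: "y \<le> (b * D) * l"
      using mult_left_mono[OF vln b] \<mu>1 by (simp add: y_def l_def mult.assoc)
    also have "\<dots> \<le> 1 * l" using bD l by (intro mult_right_mono) auto
    finally have "exp y \<le> exp l" by simp
    also have "\<dots> = exp 1 * \<mu>" using \<mu>1 by (simp add: l_def exp_add)
    also have "\<dots> \<le> 3 * \<mu>" using exp_le \<mu>1 by (intro mult_right_mono) auto
    finally have e: "exp y \<le> 3 * \<mu>" .
    have "ln (sqrt \<mu>) \<le> sqrt \<mu> - 1" using \<mu>1 by (intro ln_le_minus_one) simp
    then have "l \<le> 2 * sqrt \<mu>" using \<mu>1 by (simp add: l_def ln_sqrt)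
    then have "l\<^sup>2 \<le> (2 * sqrt \<mu>)\<^sup>2" using l by (rule power_mono)
    then have l2: "l\<^sup>2 \<le> 4 * \<mu>" using \<mu> by (simp add: power_mult_distrib)
    have "y\<^sup>2 \<le> ((b * D) * l)\<^sup>2" using yb y by (rule power_mono)
    also have "\<dots> \<le> (b * D)\<^sup>2 * (4 * \<mu>)" using l2 by (simp add: power_mult_distrib mult_left_mono)
    finally have "y\<^sup>2 * exp y \<le> ((b * D)\<^sup>2 * (4 * \<mu>)) * (3 * \<mu>)"
      using e \<mu> by (intro mult_mono) auto
    then show ?thesis by (simp add: power2_eq_square mult_ac)
  qed
  then show ?thesis using exp_remainder_le[OF y] unfolding y_def by linarith
qed

lemma exp_remainder_integral_bound:
  assumes n: "DIM('a::euclidean_space) = 2 * m" and m: "1 \<le> m"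
  shows "\<exists>A>0. \<exists>b0>0. \<forall>(u :: 'a \<Rightarrow> real) f b. radial_pairing m u f \<longrightarrow>
    (\<integral>\<^sup>+y. ennreal ((u y)\<^sup>2) \<partial>lborel) \<le> 1 \<longrightarrow> (\<integral>\<^sup>+y. ennreal ((f y)\<^sup>2) \<partial>lborel) \<le> 1 \<longrightarrow>
    0 \<le> b \<longrightarrow> b \<le> b0 \<longrightarrow>
    (\<integral>\<^sup>+x. ennreal (exp (b * (u x)\<^sup>2) - 1 - b * (u x)\<^sup>2) \<partial>lborel)
      \<le> ennreal (A * b\<^sup>2) * (\<integral>\<^sup>+y. ennreal ((f y)\<^sup>2) \<partial>lborel)"
proof -
  obtain D where D: "0 < D" and hedberg: "\<forall>(u :: 'a \<Rightarrow> real) f. radial_pairing m u f \<longrightarrow>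
    (\<integral>\<^sup>+y. ennreal ((u y)\<^sup>2) \<partial>lborel) \<le> 1 \<longrightarrow> (\<integral>\<^sup>+y. ennreal ((f y)\<^sup>2) \<partial>lborel) \<le> 1 \<longrightarrow>
    (AE x in lborel. \<forall>\<mu>\<ge>0. hl_max (\<lambda>y. ennreal (f y)) x = ennreal \<mu> \<longrightarrow>
      (u x)\<^sup>2 \<le> D * \<mu> \<and> (1 \<le> \<mu> \<longrightarrow> (u x)\<^sup>2 \<le> D * (1 + ln \<mu>)))"
    using hedberg_pointwise[OF n m] by (elim exE conjE) (rule that)
  define H where "H = 8 * (unit_ball_vol (real DIM('a)))\<^sup>2 * 5 ^ DIM('a)"
  have "unit_ball_vol (real DIM('a)) \<noteq> 0"
    by (metis less_irrefl unit_ball_vol_pos of_nat_0_le_iff)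
  then have H: "0 < H" by (simp add: H_def)
  define A where "A = 12 * D\<^sup>2 * H"
  have A: "0 < A" using D H by (simp add: A_def)
  have "(\<integral>\<^sup>+x. ennreal (exp (b * (u x)\<^sup>2) - 1 - b * (u x)\<^sup>2) \<partial>lborel)
      \<le> ennreal (A * b\<^sup>2) * (\<integral>\<^sup>+y. ennreal ((f y)\<^sup>2) \<partial>lborel)"
    if pair: "radial_pairing m u f" and u1: "(\<integral>\<^sup>+y. ennreal ((u y)\<^sup>2) \<partial>lborel) \<le> 1"
      and f1: "(\<integral>\<^sup>+y. ennreal ((f y)\<^sup>2) \<partial>lborel) \<le> 1" and b: "0 \<le> b" "b \<le> 1 / D"
    for u f :: "'a \<Rightarrow> real" and b
  proof -
    note u [measurable] = radial_pairingD(1)[OF pair] and f [measurable] = radial_pairingD(2)[OF pair]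
    note f0 = radial_pairingD(3)[OF pair]
    let ?M = "hl_max (\<lambda>y. ennreal (f y))"
    have sq: "(\<integral>\<^sup>+y. (ennreal (f y))\<^sup>2 \<partial>lborel) = (\<integral>\<^sup>+y. ennreal ((f y)\<^sup>2) \<partial>lborel)"
      using f0 by (simp add: ennreal_power)
    have L2: "(\<integral>\<^sup>+x. (?M x)\<^sup>2 \<partial>lborel) \<le> ennreal H * (\<integral>\<^sup>+y. ennreal ((f y)\<^sup>2) \<partial>lborel)"
      using hl_max_L2_bound[of "\<lambda>y. ennreal (f y)"] unfolding sq H_def by simp
    also have "\<dots> \<le> ennreal H * 1" using f1 by (rule mult_left_mono) simp
    finally have "(\<integral>\<^sup>+x. (?M x)\<^sup>2 \<partial>lborel) \<noteq> \<infinity>" by (auto simp: top_unique)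
    then have fin: "AE x in lborel. (?M x)\<^sup>2 \<noteq> \<infinity>" by (intro nn_integral_PInf_AE) auto
    have "(\<integral>\<^sup>+x. ennreal (exp (b * (u x)\<^sup>2) - 1 - b * (u x)\<^sup>2) \<partial>lborel)
       \<le> (\<integral>\<^sup>+x. ennreal (12 * (b * D)\<^sup>2) * (?M x)\<^sup>2 \<partial>lborel)"
    proof (rule nn_integral_mono_AE)
      show "AE x in lborel. ennreal (exp (b * (u x)\<^sup>2) - 1 - b * (u x)\<^sup>2) \<le> ennreal (12 * (b * D)\<^sup>2) * (?M x)\<^sup>2"
        using fin hedberg[rule_format, OF pair u1 f1]
      proof eventually_elim
        fix x assume x: "(?M x)\<^sup>2 \<noteq> \<infinity>" and hb: "\<forall>\<mu>\<ge>0. ?M x = ennreal \<mu> \<longrightarrow>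
          (u x)\<^sup>2 \<le> D * \<mu> \<and> (1 \<le> \<mu> \<longrightarrow> (u x)\<^sup>2 \<le> D * (1 + ln \<mu>))"
        have "?M x \<noteq> top" using x by (auto simp: power2_eq_square)
        then obtain \<mu> where \<mu>: "0 \<le> \<mu>" "?M x = ennreal \<mu>" by (cases "?M x") auto
        have "exp (b * (u x)\<^sup>2) - 1 - b * (u x)\<^sup>2 \<le> 12 * (b * D)\<^sup>2 * \<mu>\<^sup>2"
          by (rule exp_remainder_hedberg) (use b D hb \<mu> in \<open>auto simp: field_simps\<close>)
        then show "ennreal (exp (b * (u x)\<^sup>2) - 1 - b * (u x)\<^sup>2) \<le> ennreal (12 * (b * D)\<^sup>2) * (?M x)\<^sup>2"
          using \<mu> by (simp add: ennreal_power ennreal_mult[symmetric] ennreal_leI)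
      qed
    qed
    also have "\<dots> = ennreal (12 * (b * D)\<^sup>2) * (\<integral>\<^sup>+x. (?M x)\<^sup>2 \<partial>lborel)"
      by (rule nn_integral_cmult) measurable
    also have "\<dots> \<le> ennreal (12 * (b * D)\<^sup>2) * (ennreal H * (\<integral>\<^sup>+y. ennreal ((f y)\<^sup>2) \<partial>lborel))"
      by (rule mult_left_mono[OF L2]) simp
    also have "\<dots> = ennreal (A * b\<^sup>2) * (\<integral>\<^sup>+y. ennreal ((f y)\<^sup>2) \<partial>lborel)"
    proof -
      have "ennreal (12 * (b * D)\<^sup>2) * ennreal H = ennreal (A * b\<^sup>2)"
        using H by (subst ennreal_mult[symmetric]) (auto simp: A_def power_mult_distrib mult_ac)
      then show ?thesis by (simp add: mult.assoc[symmetric])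
    qed
    finally show ?thesis .
  qed
  then show ?thesis using A D by (intro exI[of _ A] conjI exI[of _ "1 / D"]) auto
qed

lemma L2_norm_square:
  "(L2_norm f)\<^sup>2 = (LINT x|lebesgue. (f x)\<^sup>2)"
  unfolding L2_norm_def by (intro real_sqrt_pow2 Bochner_Integration.integral_nonneg) simp

lemma nn_integral_square_L2_norm:
  assumes "square_integrable f"
  shows "(\<integral>\<^sup>+x. ennreal ((f x)\<^sup>2) \<partial>lebesgue) = ennreal ((L2_norm f)\<^sup>2)"
  using assms unfolding L2_norm_square square_integrable_def
  by (intro nn_integral_eq_integral) auto

lemma adams_remainder_bound:
  assumes n: "CARD('n::finite) = 2 * m" and m: "1 \<le> m"
  shows "\<exists>A>0. \<exists>b0>0. \<forall>(u :: real^'n \<Rightarrow> real) b. u \<in> admissible m \<longrightarrow> 0 \<le> b \<longrightarrow> b \<le> b0 \<longrightarrow>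
    (\<integral>\<^sup>+x. ennreal (exp (b * (u x)\<^sup>2) - 1 - b * (u x)\<^sup>2) \<partial>lebesgue)
      \<le> ennreal (A * b\<^sup>2 * (L2_norm (abs_nabla_pow m u))\<^sup>2)"
proof -
  have d: "DIM(real^'n) = 2 * m" using n by simp
  obtain A b0 where A: "0 < A" "0 < b0" and bound: "\<forall>(u :: real^'n \<Rightarrow> real) f b. radial_pairing m u f \<longrightarrow>
    (\<integral>\<^sup>+y. ennreal ((u y)\<^sup>2) \<partial>lborel) \<le> 1 \<longrightarrow> (\<integral>\<^sup>+y. ennreal ((f y)\<^sup>2) \<partial>lborel) \<le> 1 \<longrightarrow>
    0 \<le> b \<longrightarrow> b \<le> b0 \<longrightarrow>
    (\<integral>\<^sup>+x. ennreal (exp (b * (u x)\<^sup>2) - 1 - b * (u x)\<^sup>2) \<partial>lborel)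
      \<le> ennreal (A * b\<^sup>2) * (\<integral>\<^sup>+y. ennreal ((f y)\<^sup>2) \<partial>lborel)"
    using exp_remainder_integral_bound[OF d m] by (elim exE conjE) (rule that)
  have "(\<integral>\<^sup>+x. ennreal (exp (b * (u x)\<^sup>2) - 1 - b * (u x)\<^sup>2) \<partial>lebesgue)
      \<le> ennreal (A * b\<^sup>2 * (L2_norm (abs_nabla_pow m u))\<^sup>2)"
    if ad: "u \<in> admissible m" and b: "0 \<le> b" "b \<le> b0" for u :: "real^'n \<Rightarrow> real" and b
  proof -
    have u: "u \<in> sobolev m" "(L2_norm (abs_nabla_pow m u))\<^sup>2 + (L2_norm u)\<^sup>2 \<le> 1"
      using ad by (auto simp: admissible_def)
    have le1: "(L2_norm u)\<^sup>2 \<le> 1" "(L2_norm (abs_nabla_pow m u))\<^sup>2 \<le> 1"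
      using u(2) zero_le_power2[of "L2_norm u"] zero_le_power2[of "L2_norm (abs_nabla_pow m u)"]
      by linarith+
    have squ: "square_integrable u" using u(1) by (simp add: sobolev_def)
    have sqf: "square_integrable (abs_nabla_pow m u)" by (rule sobolev_abs_nabla_pow_dual(1)[OF n m u(1)])
    obtain v f where v: "AE x in lebesgue. u x = v x"
      and f: "AE x in lebesgue. abs_nabla_pow m u x = f x" and pair: "radial_pairing m v f"
      using sobolev_borel_pair[OF n m u(1)] by blast
    have "(\<integral>\<^sup>+y. ennreal ((v y)\<^sup>2) \<partial>lborel) = (\<integral>\<^sup>+y. ennreal ((u y)\<^sup>2) \<partial>lebesgue)"
      unfolding nn_integral_completion[of lborel, symmetric]
      using v by (intro nn_integral_cong_AE) (auto elim: eventually_mono)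
    then have v1: "(\<integral>\<^sup>+y. ennreal ((v y)\<^sup>2) \<partial>lborel) \<le> 1"
      using nn_integral_square_L2_norm[OF squ] le1(1) by simp
    have feq: "(\<integral>\<^sup>+y. ennreal ((f y)\<^sup>2) \<partial>lborel) = ennreal ((L2_norm (abs_nabla_pow m u))\<^sup>2)"
      unfolding nn_integral_square_L2_norm[OF sqf, symmetric]
      unfolding nn_integral_completion[of lborel, symmetric]
      using f by (intro nn_integral_cong_AE) (auto elim: eventually_mono)
    then have f1: "(\<integral>\<^sup>+y. ennreal ((f y)\<^sup>2) \<partial>lborel) \<le> 1"
      using le1(2) by simp
    have "(\<integral>\<^sup>+x. ennreal (exp (b * (u x)\<^sup>2) - 1 - b * (u x)\<^sup>2) \<partial>lebesgue)
       = (\<integral>\<^sup>+x. ennreal (exp (b * (v x)\<^sup>2) - 1 - b * (v x)\<^sup>2) \<partial>lebesgue)"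
      using v by (intro nn_integral_cong_AE) (auto elim: eventually_mono)
    also have "\<dots> = (\<integral>\<^sup>+x. ennreal (exp (b * (v x)\<^sup>2) - 1 - b * (v x)\<^sup>2) \<partial>lborel)"
      by (rule nn_integral_completion)
    also have "\<dots> \<le> ennreal (A * b\<^sup>2) * (\<integral>\<^sup>+y. ennreal ((f y)\<^sup>2) \<partial>lborel)"
      by (rule bound[rule_format, OF pair v1 f1 b])
    also have "\<dots> = ennreal (A * b\<^sup>2 * (L2_norm (abs_nabla_pow m u))\<^sup>2)"
      unfolding feq using A by (simp add: ennreal_mult)
    finally show ?thesis .
  qed
  then show ?thesis using A by blast
qed

section \<open>Spreading bumps\<close>

lemma test_function_square_integrable:
  assumes "test_function \<phi>"
  shows "square_integrable \<phi>"
proof -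
  obtain R where R: "\<And>x. R < norm x \<Longrightarrow> \<phi> x = 0" using assms by (auto simp: test_function_iff)
  have "continuous_on UNIV \<phi>" by (rule smooth_fun_continuous_on[OF test_function_smooth[OF assms]])
  then have "integrable lborel (\<lambda>x. (\<phi> x)\<^sup>2)"
    by (intro continuous_bounded_support_integrable[where R = R] continuous_intros) (auto simp: R)
  then have "integrable lebesgue (\<lambda>x. (\<phi> x)\<^sup>2)"
    using test_function_borel[OF assms] by (subst integrable_completion) auto
  then show ?thesis using test_function_measurable[OF assms] by (simp add: square_integrable_def)
qed

lemma test_function_locally_integrable:
  fixes \<phi> :: "real^'n::finite \<Rightarrow> real"
  assumes "test_function \<phi>"
  shows "locally_integrable \<phi>"
  unfolding locally_integrable_def
proof (intro allI impI)
  fix K :: "(real^'n) set" assume K: "compact K"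
  have c: "continuous_on UNIV \<phi>" by (rule smooth_fun_continuous_on[OF test_function_smooth[OF assms]])
  have "integrable lborel (\<lambda>x. indicator K x *\<^sub>R \<phi> x)"
    by (rule borel_integrable_compact[OF K continuous_on_subset[OF c]]) auto
  then show "set_integrable lebesgue K \<phi>"
    unfolding set_integrable_def using K test_function_borel[OF assms]
    by (subst integrable_completion) (auto simp: compact_imp_closed borel_measurable_integrable)
qed

lemma integral_test_functions_lebesgue:
  assumes "test_function \<phi>" "test_function \<psi>"
  shows "(LINT x|lebesgue. \<phi> x * \<psi> x) = (\<integral>x. \<phi> x * \<psi> x \<partial>lborel)"
  using test_function_borel[OF assms(1)] test_function_borel[OF assms(2)]
  by (intro integral_completion) (simp add: borel_measurable_times)

text \<open>Integration by parts moves the outermost derivative first, which reverses the order of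
  differentiation.\<close>

lemma test_function_has_weak_deriv:
  fixes \<phi> :: "real^'n::finite \<Rightarrow> real"
  assumes "test_function \<phi>"
  shows "has_weak_deriv \<nu> \<phi> (iter_deriv (rev \<nu>) \<phi>)"
  unfolding has_weak_deriv_def
proof (intro conjI allI impI)
  show "locally_integrable \<phi>" "locally_integrable (iter_deriv (rev \<nu>) \<phi>)"
    using assms by (auto intro: test_function_locally_integrable test_function_iter_deriv)
  fix \<psi> :: "real^'n \<Rightarrow> real" assume \<psi>: "test_function \<psi>"
  show "(LINT x|lebesgue. \<phi> x * iter_deriv \<nu> \<psi> x)
     = (- 1) ^ length \<nu> * (LINT x|lebesgue. iter_deriv (rev \<nu>) \<phi> x * \<psi> x)"
    using assms
  proof (induction \<nu> arbitrary: \<phi>)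
    case (Cons i \<nu>)
    have t: "test_function (partial_deriv i \<phi>)" "test_function (iter_deriv \<nu> \<psi>)"
        "test_function (partial_deriv i (iter_deriv \<nu> \<psi>))"
      using Cons.prems \<psi> by (auto intro: test_function_partial_deriv test_function_iter_deriv)
    have "(LINT x|lebesgue. \<phi> x * iter_deriv (i # \<nu>) \<psi> x)
       = - (LINT x|lebesgue. partial_deriv i \<phi> x * iter_deriv \<nu> \<psi> x)"
      using test_function_integration_by_parts[OF Cons.prems t(2)]
      by (simp add: integral_test_functions_lebesgue Cons.prems t)
    also have "\<dots> = - ((- 1) ^ length \<nu> * (LINT x|lebesgue. iter_deriv (rev \<nu>) (partial_deriv i \<phi>) x * \<psi> x))"
      by (simp only: Cons.IH[OF t(1)])
    finally show ?case by (simp add: iter_deriv_append)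
  qed simp
qed

lemma test_function_sobolev:
  fixes \<phi> :: "real^'n::finite \<Rightarrow> real"
  assumes "test_function \<phi>"
  shows "\<phi> \<in> sobolev m"
  unfolding sobolev_def
  using test_function_square_integrable[OF assms] test_function_has_weak_deriv[OF assms]
    test_function_square_integrable[OF test_function_iter_deriv[OF assms]] by blast

lemma lap_symmetric:
  assumes \<phi>: "test_function \<phi>" and \<psi>: "test_function \<psi>"
  shows "(LINT x|lebesgue. \<phi> x * lap \<psi> x) = (LINT x|lebesgue. lap \<phi> x * \<psi> x)"
proof -
  have "(LINT x|lebesgue. \<phi> x * lap \<psi> x) = (\<Sum>i\<in>UNIV. LINT x|lebesgue. \<phi> x * iter_deriv [i, i] \<psi> x)"
    unfolding lap_def sum_distrib_left
    by (intro Bochner_Integration.integral_sum integrable_mult_test test_function_locally_integrable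
        test_function_iter_deriv \<phi> \<psi>)
  also have "\<dots> = (\<Sum>i\<in>UNIV. LINT x|lebesgue. iter_deriv [i, i] \<phi> x * \<psi> x)"
    using has_weak_deriv_test[OF test_function_has_weak_deriv[OF \<phi>] \<psi>]
    by (intro sum.cong refl) (simp del: iter_deriv_simps)
  also have "\<dots> = (LINT x|lebesgue. lap \<phi> x * \<psi> x)"
    unfolding lap_def sum_distrib_right
    by (intro Bochner_Integration.integral_sum[symmetric] integrable_mult_test test_function_locally_integrable
        test_function_iter_deriv \<phi> \<psi>)
  finally show ?thesis .
qed

lemma lap_pow_symmetric:
  assumes "test_function \<phi>"
  shows "test_function \<psi> \<Longrightarrow> (LINT x|lebesgue. \<phi> x * (lap ^^ k) \<psi> x) = (LINT x|lebesgue. (lap ^^ k) \<phi> x * \<psi> x)"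
proof (induction k arbitrary: \<psi>)
  case (Suc k)
  have "(LINT x|lebesgue. \<phi> x * (lap ^^ Suc k) \<psi> x) = (LINT x|lebesgue. \<phi> x * (lap ^^ k) (lap \<psi>) x)"
    by (simp only: funpow_Suc_right o_apply)
  also have "\<dots> = (LINT x|lebesgue. (lap ^^ k) \<phi> x * lap \<psi> x)"
    by (rule Suc.IH[OF test_function_lap[OF Suc.prems]])
  also have "\<dots> = (LINT x|lebesgue. lap ((lap ^^ k) \<phi>) x * \<psi> x)"
    by (rule lap_symmetric[OF test_function_lap_pow[OF assms] Suc.prems])
  finally show ?case by simp
qed simp

text \<open>The definition of \<open>\<nabla>\<^sup>m\<close> selects arbitrary weak derivatives at each
  step, but testing against all test functions pins them down almost everywhere.\<close>

lemma abs_nabla_pow_test_function: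
  fixes \<phi> :: "real^'n::finite \<Rightarrow> real"
  assumes n: "CARD('n) = 2 * m" and m: "1 \<le> m" and \<phi>: "test_function \<phi>"
  shows "AE x in lebesgue. abs_nabla_pow m \<phi> x = dual_size m ((lap ^^ (m div 2)) \<phi>) x"
proof -
  define k where "k = m div 2"
  let ?w = "(weak_laplacian ^^ k) \<phi>" and ?c = "(lap ^^ k) \<phi>"
  have k: "2 * k \<le> m" by (simp add: k_def)
  have s: "\<phi> \<in> sobolev m" by (rule test_function_sobolev[OF \<phi>])
  have tc: "test_function ?c" by (rule test_function_lap_pow[OF \<phi>])
  obtain v where "has_weak_deriv [] ?w v"
    using sobolev_weak_laplacian_pow_derivs[OF s, of k "[]"] k by auto
  then have li: "locally_integrable ?w" by (rule has_weak_deriv_locally_integrable)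
  have wc: "(LINT x|lebesgue. ?w x * \<psi> x) = (LINT x|lebesgue. ?c x * \<psi> x)" if "test_function \<psi>" for \<psi>
    using weak_laplacian_pow_test[OF s k that] lap_pow_symmetric[OF \<phi> that] by simp
  show ?thesis
  proof (cases "even m")
    case True
    have "AE x in lebesgue. ?w x = ?c x"
      by (rule fundamental_lemma_eq[OF n m li test_function_locally_integrable[OF tc] wc])
    then show ?thesis
      by eventually_elim (use True in \<open>simp add: abs_nabla_pow_def dual_size_def k_def\<close>)
  next
    case False
    then have k1: "2 * k + 1 \<le> m" "(m - 1) div 2 = k" by (auto simp: k_def elim!: oddE)
    have "AE x in lebesgue. weak_deriv [i] ?w x = partial_deriv i ?c x" for i
    proof -
      obtain v where "has_weak_deriv [i] ?w v"
        using sobolev_weak_laplacian_pow_derivs[OF s, of k "[i]"] k1 by auto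
      then have z: "has_weak_deriv [i] ?w (weak_deriv [i] ?w)" by (rule weak_derivI)
      show ?thesis
      proof (rule fundamental_lemma_eq[OF n m has_weak_deriv_locally_integrable(2)[OF z]])
        show "locally_integrable (partial_deriv i ?c)"
          by (intro test_function_locally_integrable test_function_partial_deriv tc)
        fix \<psi> :: "real^'n \<Rightarrow> real" assume \<psi>: "test_function \<psi>"
        have "(LINT x|lebesgue. weak_deriv [i] ?w x * \<psi> x) = - (LINT x|lebesgue. ?w x * partial_deriv i \<psi> x)"
          using has_weak_deriv_test[OF z \<psi>] by simp
        also have "\<dots> = - (LINT x|lebesgue. ?c x * partial_deriv i \<psi> x)"
          by (simp only: wc[OF test_function_partial_deriv[OF \<psi>]])
        also have "\<dots> = (LINT x|lebesgue. partial_deriv i ?c x * \<psi> x)"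
          using has_weak_deriv_test[OF test_function_has_weak_deriv[OF tc, of "[i]"] \<psi>] by simp
        finally show "(LINT x|lebesgue. weak_deriv [i] ?w x * \<psi> x) = (LINT x|lebesgue. partial_deriv i ?c x * \<psi> x)" .
      qed
    qed
    then have "AE x in lebesgue. \<forall>i\<in>UNIV. weak_deriv [i] ?w x = partial_deriv i ?c x"
      by (intro AE_finite_allI) auto
    then show ?thesis
      by eventually_elim (use False k1(2) in \<open>simp add: abs_nabla_pow_def dual_size_def weak_grad_def k_def\<close>)
  qed
qed

lemma radial_lap_affine:
  assumes H: "smooth1 H"
  shows "deriv (\<lambda>q. c * H (b * q)) q = c * b * deriv H (b * q)"
    and "radial_lap n (\<lambda>q. c * H (b * q)) = (\<lambda>q. (c * b) * radial_lap n H (b * q))"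
proof -
  have d: "deriv (\<lambda>q. c * H (b * q)) = (\<lambda>q. (c * b) * deriv H (b * q))" if H: "smooth1 H" for c H
  proof
    fix q
    have "((\<lambda>q. b * q) has_real_derivative b) (at q)" by (auto intro!: derivative_eq_intros)
    from DERIV_cmult[OF DERIV_chain2[OF smooth1_has_deriv[OF H] this], of c]
    show "deriv (\<lambda>q. c * H (b * q)) q = (c * b) * deriv H (b * q)"
      by (intro DERIV_imp_deriv) (simp add: mult_ac)
  qed
  show "deriv (\<lambda>q. c * H (b * q)) q = c * b * deriv H (b * q)" by (simp add: d[OF H])
  show "radial_lap n (\<lambda>q. c * H (b * q)) = (\<lambda>q. (c * b) * radial_lap n H (b * q))"
    by (rule ext) (simp only: radial_lap_def d[OF H] d[OF smooth1_deriv[OF H]], simp add: algebra_simps)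
qed

lemma radial_lap_pow_affine:
  assumes "smooth1 H"
  shows "(radial_lap n ^^ k) (\<lambda>q. c * H (b * q)) = (\<lambda>q. (c * b ^ k) * (radial_lap n ^^ k) H (b * q))"
proof (induction k)
  case (Suc k)
  have "(radial_lap n ^^ Suc k) (\<lambda>q. c * H (b * q)) = radial_lap n (\<lambda>q. (c * b ^ k) * (radial_lap n ^^ k) H (b * q))"
    using Suc by simp
  also have "\<dots> = (\<lambda>q. ((c * b ^ k) * b) * radial_lap n ((radial_lap n ^^ k) H) (b * q))"
    by (rule radial_lap_affine(2)[OF smooth1_radial_lap_pow[OF assms]])
  finally show ?case by (simp only: power_Suc2 mult.assoc funpow.simps o_apply)
qed simp

lemma lborel_integral_radial_scaling:
  fixes g :: "real \<Rightarrow> real"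
  assumes n: "DIM('a::euclidean_space) = 2 * m" and [measurable]: "g \<in> borel_measurable borel" and b: "0 < b"
  shows "(\<integral>y. g ((norm (y::'a))\<^sup>2) \<partial>lborel) = b ^ m * (\<integral>y. g (b * (norm (y::'a))\<^sup>2) \<partial>lborel)"
proof -
  have "(lborel :: 'a measure) = density (distr lborel borel (\<lambda>x. 0 + sqrt b *\<^sub>R x)) (\<lambda>_. ennreal (\<bar>sqrt b\<bar> ^ DIM('a)))"
    by (rule lborel_affine) (use b in simp)
  then have "(\<integral>y. g ((norm (y::'a))\<^sup>2) \<partial>lborel)
     = (\<integral>y. g ((norm (y::'a))\<^sup>2) \<partial>density (distr lborel borel (\<lambda>x. 0 + sqrt b *\<^sub>R x)) (\<lambda>_. ennreal (\<bar>sqrt b\<bar> ^ DIM('a))))"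
    by (rule arg_cong)
  also have "\<dots> = (\<integral>y. (\<bar>sqrt b\<bar> ^ DIM('a)) *\<^sub>R g ((norm (y::'a))\<^sup>2) \<partial>distr lborel borel (\<lambda>x. 0 + sqrt b *\<^sub>R x))"
    by (rule integral_density) auto
  also have "\<dots> = (\<integral>y. (\<bar>sqrt b\<bar> ^ DIM('a)) *\<^sub>R g ((norm (0 + sqrt b *\<^sub>R (y::'a)))\<^sup>2) \<partial>lborel)"
    by (rule integral_distr) auto
  also have "\<dots> = b ^ m * (\<integral>y. g (b * (norm (y::'a))\<^sup>2) \<partial>lborel)"
    using b by (simp add: n power_mult power_mult_distrib)
  finally show ?thesis .
qed

text \<open>Take \<open>u(y) = c \<phi>(\<surd>b y)\<close> for a bump \<open>\<phi>\<close>. Then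
  \<open>\<parallel>u\<parallel>\<^sub>2\<^sup>2 = c\<^sup>2 b\<^bsup>-m\<^esup>
  \<parallel>\<phi>\<parallel>\<^sub>2\<^sup>2\<close>, whereas
  \<open>\<parallel>\<nabla>\<^sup>m u\<parallel>\<^sub>2\<^sup>2 = c\<^sup>2
  \<parallel>\<nabla>\<^sup>m \<phi>\<parallel>\<^sub>2\<^sup>2\<close> does not see
  \<open>b\<close>: in dimension \<open>2m\<close> the \<open>m\<close>-th gradient is scale
  invariant.\<close>

lemma admissible_with_large_L2_norm:
  assumes n: "CARD('n::finite) = 2 * m" and m: "1 \<le> m" and e: "0 < e" "e < 1"
  shows "\<exists>u \<in> (admissible m :: (real^'n \<Rightarrow> real) set). (L2_norm u)\<^sup>2 = 1 - e"
proof -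
  have d: "DIM(real^'n) = 2 * m" using n by simp
  define k where "k = m div 2"
  let ?f = "\<lambda>y :: real^'n. bump_profile ((norm y)\<^sup>2)"
  define J where "J = (radial_lap (2 * m) ^^ k) bump_profile"
  have J: "smooth1 J" unfolding J_def by (rule smooth1_radial_lap_pow[OF smooth1_bump_profile])
  define P where "P = dual_profile m J"
  have bm: "H \<in> borel_measurable borel" if "smooth1 H" for H
    using smooth1_continuous_on[OF that, of UNIV] by (rule borel_measurable_continuous_onI)
  have [measurable]: "bump_profile \<in> borel_measurable borel" by (rule bm[OF smooth1_bump_profile])
  have [measurable]: "P \<in> borel_measurable borel"
    using bm[OF J] bm[OF smooth1_deriv[OF J]] unfolding P_def dual_profile_def[abs_def] by measurable
  define N where "N = (\<integral>y. (?f y)\<^sup>2 \<partial>lborel)"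
  define g0 where "g0 = (\<integral>(y::real^'n). (P ((norm y)\<^sup>2))\<^sup>2 \<partial>lborel)"
  have g0: "0 \<le> g0" unfolding g0_def by (intro Bochner_Integration.integral_nonneg) auto
  have N: "0 < N"
  proof -
    have t: "test_function ?f"
      using test_function_radial[OF smooth1_bump_profile bump_profile_zero, of 1 0] by simp
    have i: "integrable lborel (\<lambda>y. (?f y)\<^sup>2)"
      using test_function_square_integrable[OF t] by (simp add: square_integrable_def integrable_completion)
    have "N \<noteq> 0"
    proof
      assume "N = 0"
      then have "AE y in lborel. (?f y)\<^sup>2 = 0"
        using integral_nonneg_eq_0_iff_AE[OF i] by (simp add: N_def)
      then have "AE y in lborel. y \<notin> ball (0 :: real^'n) 1"
      proof eventually_elim
        fix y :: "real^'n" assume "(?f y)\<^sup>2 = 0"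
        then have "\<not> (norm y)\<^sup>2 < 1" using bump_profile_pos[of "(norm y)\<^sup>2"] by auto
        then show "y \<notin> ball 0 1" by (auto simp: power_less_one_iff abs_square_less_1)
      qed
      then have "emeasure lborel (ball (0 :: real^'n) 1) = 0"
        by (subst (asm) AE_iff_measurable[where N = "ball 0 1"]) auto
      then show False
        using unit_ball_vol_pos[of "real DIM(real^'n)"]
        by (simp add: emeasure_ball_power ennreal_eq_0_iff del: unit_ball_vol_pos)
    qed
    moreover have "0 \<le> N" unfolding N_def by (intro Bochner_Integration.integral_nonneg) auto
    ultimately show ?thesis by simp
  qed
  \<comment> \<open>The value of \<open>b\<^sup>m\<close>: small enough that the gradient term below is at most
    \<open>e\<close>, also if \<open>g0 = 0\<close>.\<close>
  define \<tau> where "\<tau> = e * N / (g0 + 1)"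
  have \<tau>: "0 < \<tau>" using e N g0 by (simp add: \<tau>_def)
  define b where "b = root m \<tau>"
  have b: "0 < b" "b ^ m = \<tau>" using \<tau> m by (auto simp: b_def real_root_pow_pos2)
  define c where "c = sqrt ((1 - e) * \<tau> / N)"
  have c2: "c\<^sup>2 = (1 - e) * \<tau> / N" "0 \<le> c" using e \<tau> N by (auto simp: c_def)
  define H where "H q = c * bump_profile (b * q)" for q
  have H: "smooth1 H" "\<And>q. 1 / b \<le> q \<Longrightarrow> H q = 0"
    using smooth1_affine[OF smooth1_bump_profile, of c 0 b] b
    by (auto simp: H_def[abs_def] bump_profile_zero field_simps)
  let ?u = "\<lambda>y :: real^'n. H ((norm y)\<^sup>2)"
  have tu: "test_function ?u" using test_function_radial[where x = "0 :: real^'n", OF H] by simp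
  have L2u: "(L2_norm ?u)\<^sup>2 = 1 - e"
  proof -
    have "(L2_norm ?u)\<^sup>2 = (\<integral>y. (?u y)\<^sup>2 \<partial>lborel)"
      unfolding L2_norm_square using test_function_borel[OF tu] by (intro integral_completion) simp
    also have "\<dots> = c\<^sup>2 * (\<integral>(y::real^'n). (bump_profile (b * (norm y)\<^sup>2))\<^sup>2 \<partial>lborel)"
      by (simp add: H_def power_mult_distrib)
    also have "b ^ m * (\<integral>(y::real^'n). (bump_profile (b * (norm y)\<^sup>2))\<^sup>2 \<partial>lborel) = N"
      unfolding N_def by (rule lborel_integral_radial_scaling[OF d _ b(1), symmetric, of "\<lambda>q. (bump_profile q)\<^sup>2"]) measurable
    then have "(\<integral>(y::real^'n). (bump_profile (b * (norm y)\<^sup>2))\<^sup>2 \<partial>lborel) = N / \<tau>"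
      using b \<tau> by (simp add: field_simps)
    finally show ?thesis using c2 \<tau> N by simp
  qed
  have grad: "(L2_norm (abs_nabla_pow m ?u))\<^sup>2 \<le> e"
  proof -
    have pw: "(dual_size m ((lap ^^ k) ?u) y)\<^sup>2 = c\<^sup>2 * \<tau> * (P (b * (norm y)\<^sup>2))\<^sup>2" for y
    proof -
      let ?F = "\<lambda>q. (c * b ^ k) * J (b * q)"
      have F: "smooth1 ?F" using smooth1_affine[OF J, of "c * b ^ k" 0 b] by simp
      have "(lap ^^ k) ?u = (\<lambda>y. ?F ((norm y)\<^sup>2))"
        using lap_pow_radial[OF H(1), of k "0 :: real^'n"] n
        by (simp add: H_def[abs_def] radial_lap_pow_affine[OF smooth1_bump_profile] J_def)
      then have ds: "dual_size m ((lap ^^ k) ?u) y = dual_profile m ?F ((norm y)\<^sup>2)"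
        using norm_gradient_radial[OF F, of 0 y] by (simp add: dual_size_def dual_profile_def)
      show ?thesis
      proof (cases "even m")
        case True
        then have "m = k + k" by (auto simp: k_def)
        then have "\<tau> = (b ^ k)\<^sup>2" using b(2) by (simp add: power_add power2_eq_square)
        then show ?thesis unfolding ds P_def using True
          by (simp add: dual_profile_def power_mult_distrib)
      next
        case False
        then have "m = k + k + 1" by (auto simp: k_def elim!: oddE)
        then have \<tau>b: "\<tau> = b ^ k * b ^ k * b" using b(2) by (simp add: power_add mult_ac)
        have "dual_profile m ?F ((norm y)\<^sup>2) = 2 * norm y * \<bar>c * b ^ k * b * deriv J (b * (norm y)\<^sup>2)\<bar>"
          using False radial_lap_affine(1)[OF J, of "c * b ^ k" b "(norm y)\<^sup>2"]
          by (simp add: dual_profile_def)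
        then have "(dual_profile m ?F ((norm y)\<^sup>2))\<^sup>2 = 4 * (norm y)\<^sup>2 * (c * b ^ k * b * deriv J (b * (norm y)\<^sup>2))\<^sup>2"
          by (simp add: power_mult_distrib)
        moreover have "(P (b * (norm y)\<^sup>2))\<^sup>2 = 4 * (b * (norm y)\<^sup>2) * (deriv J (b * (norm y)\<^sup>2))\<^sup>2"
          using False b by (simp add: P_def dual_profile_def power_mult_distrib)
        ultimately show ?thesis unfolding ds \<tau>b by (simp add: power2_eq_square mult_ac)
      qed
    qed
    have "(L2_norm (abs_nabla_pow m ?u))\<^sup>2 = (LINT y|lebesgue. (abs_nabla_pow m ?u y)\<^sup>2)"
      by (rule L2_norm_square)
    also have "\<dots> = (LINT y|lebesgue. c\<^sup>2 * \<tau> * (P (b * (norm (y::real^'n))\<^sup>2))\<^sup>2)"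
    proof (rule integral_cong_AE)
      show "(\<lambda>y. (abs_nabla_pow m ?u y)\<^sup>2) \<in> borel_measurable lebesgue"
        using sobolev_abs_nabla_pow_dual(1)[OF n m test_function_sobolev[OF tu]]
        by (auto simp: square_integrable_def intro: borel_measurable_power)
      show "(\<lambda>y :: real^'n. c\<^sup>2 * \<tau> * (P (b * (norm y)\<^sup>2))\<^sup>2) \<in> borel_measurable lebesgue"
        by (rule borel_measurable_lebesgueI) measurable
      show "AE y in lebesgue. (abs_nabla_pow m ?u y)\<^sup>2 = c\<^sup>2 * \<tau> * (P (b * (norm y)\<^sup>2))\<^sup>2"
        using abs_nabla_pow_test_function[OF n m tu]
        by eventually_elim (simp add: pw[unfolded k_def])
    qed
    also have "\<dots> = (\<integral>(y::real^'n). c\<^sup>2 * \<tau> * (P (b * (norm y)\<^sup>2))\<^sup>2 \<partial>lborel)"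
      by (rule integral_completion) measurable
    also have "\<dots> = c\<^sup>2 * (b ^ m * (\<integral>(y::real^'n). (P (b * (norm y)\<^sup>2))\<^sup>2 \<partial>lborel))"
      by (simp add: b(2))
    also have "b ^ m * (\<integral>(y::real^'n). (P (b * (norm y)\<^sup>2))\<^sup>2 \<partial>lborel) = g0"
      unfolding g0_def by (rule lborel_integral_radial_scaling[OF d _ b(1), symmetric, of "\<lambda>q. (P q)\<^sup>2"]) measurable
    also have "c\<^sup>2 * g0 = (1 - e) * (e * (g0 / (g0 + 1)))"
      using N by (simp add: c2 \<tau>_def)
    also have "\<dots> \<le> 1 * (e * 1)"
      using e g0 by (intro mult_mono) auto
    finally show ?thesis by simp
  qed
  have "?u \<in> admissible m"
    using test_function_sobolev[OF tu] L2u grad by (simp add: admissible_def)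
  then show ?thesis using L2u by blast
qed

section \<open>Comparison with the vanishing level\<close>

definition adams_factor :: "real \<Rightarrow> real \<Rightarrow> real \<Rightarrow> real" where
  "adams_factor \<alpha> \<gamma> s = (1 + \<alpha> * s) / (1 - \<gamma> * \<alpha> * s)"

lemma AD_functional_adams_factor:
  "AD_functional \<beta> \<alpha> \<gamma> v =
    (\<integral>\<^sup>+x. ennreal (exp (\<beta> * adams_factor \<alpha> \<gamma> ((L2_norm v)\<^sup>2) * (v x)\<^sup>2) - 1) \<partial>lebesgue)"
  by (simp add: AD_functional_def adams_factor_def)

lemma adams_factor_bounds:
  assumes "0 < \<alpha>" "0 \<le> \<gamma>" "\<gamma> < 1 / \<alpha> - 1" "\<alpha> < 1" "0 \<le> s" "s \<le> 1"
  shows "0 < 1 - \<gamma> * \<alpha> * s" "0 < adams_factor \<alpha> \<gamma> s" "adams_factor \<alpha> \<gamma> s \<le> adams_factor \<alpha> \<gamma> 1"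
proof -
  have ga: "0 \<le> \<gamma> * \<alpha>" "\<gamma> * \<alpha> < 1" using assms by (auto simp: field_simps)
  have den: "1 - \<gamma> * \<alpha> * 1 \<le> 1 - \<gamma> * \<alpha> * s" using mult_left_mono[OF assms(6) ga(1)] by simp
  then show pos: "0 < 1 - \<gamma> * \<alpha> * s" using ga(2) by linarith
  then show "0 < adams_factor \<alpha> \<gamma> s"
    using assms by (simp add: adams_factor_def add_pos_nonneg)
  show "adams_factor \<alpha> \<gamma> s \<le> adams_factor \<alpha> \<gamma> 1"
    unfolding adams_factor_def
    by (intro frac_le den) (use assms ga in \<open>auto simp: mult_left_le\<close>)
qed

lemma admissibleD:
  assumes "v \<in> admissible m"
  shows "square_integrable v" "(L2_norm v)\<^sup>2 \<le> 1"
    "(L2_norm (abs_nabla_pow m v))\<^sup>2 + (L2_norm v)\<^sup>2 \<le> 1"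
proof -
  show "square_integrable v" using assms by (auto simp: admissible_def sobolev_def)
  show le: "(L2_norm (abs_nabla_pow m v))\<^sup>2 + (L2_norm v)\<^sup>2 \<le> 1"
    using assms by (auto simp: admissible_def)
  show "(L2_norm v)\<^sup>2 \<le> 1"
    using le zero_le_power2[of "L2_norm (abs_nabla_pow m v)"] by linarith
qed

lemma nn_integral_cmult_square:
  assumes "0 \<le> c" "square_integrable v"
  shows "(\<integral>\<^sup>+x. ennreal (c * (v x)\<^sup>2) \<partial>lebesgue) = ennreal (c * (L2_norm v)\<^sup>2)"
proof -
  have [measurable]: "v \<in> borel_measurable lebesgue" using assms(2) by (simp add: square_integrable_def)
  have "(\<integral>\<^sup>+x. ennreal (c * (v x)\<^sup>2) \<partial>lebesgue) = ennreal c * (\<integral>\<^sup>+x. ennreal ((v x)\<^sup>2) \<partial>lebesgue)"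
    using assms(1) by (simp add: ennreal_mult nn_integral_cmult)
  then show ?thesis using nn_integral_square_L2_norm[OF assms(2)] assms(1) by (simp add: ennreal_mult)
qed

text \<open>Since \<open>e\<^sup>y - 1 \<ge> y\<close>, a spread bump of squared norm \<open>1 -
  e\<close> has functional at least \<open>\<beta> h(1 - e) (1 - e)\<close>, where
  \<open>h\<close> is \<open>adams_factor \<alpha> \<gamma>\<close>. The limit \<open>e
  \<rightarrow> 0\<close> gives the level of vanishing sequences.\<close>

lemma AD_ge_vanishing_level:
  assumes n: "CARD('n::finite) = 2 * m" and m: "1 \<le> m" and \<beta>: "0 < \<beta>"
    and par: "0 < \<alpha>" "0 \<le> \<gamma>" "\<gamma> < 1 / \<alpha> - 1" "\<alpha> < 1"
  shows "ennreal (\<beta> * adams_factor \<alpha> \<gamma> 1) \<le> AD TYPE('n) m \<beta> \<alpha> \<gamma>"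
proof (rule tendsto_upperbound)
  let ?h = "adams_factor \<alpha> \<gamma>"
  have "((\<lambda>e. \<beta> * ?h (1 - e) * (1 - e)) \<longlongrightarrow> \<beta> * ?h (1 - 0) * (1 - 0)) (at_right 0)"
    unfolding adams_factor_def
    by (intro tendsto_intros) (use adams_factor_bounds(1)[OF par, of 1] in auto)
  then show "((\<lambda>e. ennreal (\<beta> * ?h (1 - e) * (1 - e))) \<longlongrightarrow> ennreal (\<beta> * ?h 1)) (at_right 0)"
    by (intro tendsto_ennrealI) simp
  have "ennreal (\<beta> * ?h (1 - e) * (1 - e)) \<le> AD TYPE('n) m \<beta> \<alpha> \<gamma>" if e: "0 < e" "e < 1" for e
  proof -
    obtain v :: "real^'n \<Rightarrow> real" where v: "v \<in> admissible m" "(L2_norm v)\<^sup>2 = 1 - e"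
      using admissible_with_large_L2_norm[OF n m e] by blast
    have c: "0 \<le> \<beta> * ?h (1 - e)"
      using \<beta> adams_factor_bounds(2)[OF par, of "1 - e"] e by simp
    have "ennreal (\<beta> * ?h (1 - e) * (1 - e)) = (\<integral>\<^sup>+x. ennreal (\<beta> * ?h (1 - e) * (v x)\<^sup>2) \<partial>lebesgue)"
      using nn_integral_cmult_square[OF c admissibleD(1)[OF v(1)]] v(2) by simp
    also have "\<dots> \<le> AD_functional \<beta> \<alpha> \<gamma> v"
      unfolding AD_functional_adams_factor v(2)
    proof (intro nn_integral_mono ennreal_leI)
      fix x
      show "\<beta> * ?h (1 - e) * (v x)\<^sup>2 \<le> exp (\<beta> * ?h (1 - e) * (v x)\<^sup>2) - 1"
        using exp_ge_add_one_self[of "\<beta> * ?h (1 - e) * (v x)\<^sup>2"] by linarith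
    qed
    also have "\<dots> \<le> AD TYPE('n) m \<beta> \<alpha> \<gamma>" unfolding AD_def by (rule SUP_upper[OF v(1)])
    finally show ?thesis .
  qed
  then show "\<forall>\<^sub>F e in at_right 0. ennreal (\<beta> * ?h (1 - e) * (1 - e)) \<le> AD TYPE('n) m \<beta> \<alpha> \<gamma>"
    by (auto simp: eventually_at_right_field intro!: exI[of _ 1])
qed simp

lemma exp_split_integral:
  assumes "0 \<le> b" and sq: "square_integrable u"
  shows "(\<integral>\<^sup>+x. ennreal (exp (b * (u x)\<^sup>2) - 1) \<partial>lebesgue) =
    ennreal (b * (L2_norm u)\<^sup>2) + (\<integral>\<^sup>+x. ennreal (exp (b * (u x)\<^sup>2) - 1 - b * (u x)\<^sup>2) \<partial>lebesgue)"
proof -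
  have [measurable]: "u \<in> borel_measurable lebesgue" using sq by (simp add: square_integrable_def)
  have "(\<integral>\<^sup>+x. ennreal (exp (b * (u x)\<^sup>2) - 1) \<partial>lebesgue)
     = (\<integral>\<^sup>+x. ennreal (b * (u x)\<^sup>2) + ennreal (exp (b * (u x)\<^sup>2) - 1 - b * (u x)\<^sup>2) \<partial>lebesgue)"
  proof (intro nn_integral_cong)
    fix x
    have "0 \<le> exp (b * (u x)\<^sup>2) - 1 - b * (u x)\<^sup>2"
      using exp_ge_add_one_self[of "b * (u x)\<^sup>2"] by linarith
    then show "ennreal (exp (b * (u x)\<^sup>2) - 1)
        = ennreal (b * (u x)\<^sup>2) + ennreal (exp (b * (u x)\<^sup>2) - 1 - b * (u x)\<^sup>2)"
      using assms(1) by (simp add: ennreal_plus[symmetric] del: ennreal_plus)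
  qed
  also have "\<dots> = (\<integral>\<^sup>+x. ennreal (b * (u x)\<^sup>2) \<partial>lebesgue)
      + (\<integral>\<^sup>+x. ennreal (exp (b * (u x)\<^sup>2) - 1 - b * (u x)\<^sup>2) \<partial>lebesgue)"
    by (rule nn_integral_add) measurable
  finally show ?thesis by (simp add: nn_integral_cmult_square[OF assms])
qed

lemma L2_norm_zero_of_exp_remainder_zero:
  assumes b: "0 < b" and sq: "square_integrable u"
    and zero: "(\<integral>\<^sup>+x. ennreal (exp (b * (u x)\<^sup>2) - 1 - b * (u x)\<^sup>2) \<partial>lebesgue) = 0"
  shows "(L2_norm u)\<^sup>2 = 0"
proof -
  have [measurable]: "u \<in> borel_measurable lebesgue" using sq by (simp add: square_integrable_def)
  have "AE x in lebesgue. ennreal (exp (b * (u x)\<^sup>2) - 1 - b * (u x)\<^sup>2) = 0"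
    using zero by (subst (asm) nn_integral_0_iff_AE) auto
  then have "AE x in lebesgue. (u x)\<^sup>2 = 0"
  proof eventually_elim
    fix x assume "ennreal (exp (b * (u x)\<^sup>2) - 1 - b * (u x)\<^sup>2) = 0"
    then have "exp (b * (u x)\<^sup>2) - 1 - b * (u x)\<^sup>2 \<le> 0" by (simp add: ennreal_eq_0_iff)
    then have "(b * (u x)\<^sup>2)\<^sup>2 \<le> 0"
      using exp_lower_Taylor_quadratic[OF mult_nonneg_nonneg[OF less_imp_le[OF b] zero_le_power2[of "u x"]]] by linarith
    then show "(u x)\<^sup>2 = 0" using b by simp
  qed
  then show ?thesis unfolding L2_norm_square by (rule integral_eq_zero_AE)
qed

text \<open>With \<open>b = \<beta> h(s)\<close>, where \<open>h\<close> is \<open>adams_factor \<alpha>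
  \<gamma>\<close>, the functional is at most \<open>b (s + A b g)\<close>, and \<open>s + A b
  g < s + g \<le> 1\<close> as soon as \<open>A b < 1\<close> and \<open>g > 0\<close>.\<close>

lemma AD_functional_less_vanishing_level:
  assumes n: "CARD('n::finite) = 2 * m" and m: "1 \<le> m"
    and par: "0 < \<alpha>" "0 \<le> \<gamma>" "\<gamma> < 1 / \<alpha> - 1" "\<alpha> < 1"
  shows "\<exists>B>0. \<forall>\<beta> (u :: real^'n \<Rightarrow> real). 0 < \<beta> \<longrightarrow> \<beta> < B \<longrightarrow> u \<in> admissible m \<longrightarrow>
    AD_functional \<beta> \<alpha> \<gamma> u < ennreal (\<beta> * adams_factor \<alpha> \<gamma> 1)"
proof -
  let ?h = "adams_factor \<alpha> \<gamma>"
  have h1: "0 < ?h 1" by (rule adams_factor_bounds(2)[OF par]) auto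
  obtain A b0 where A: "0 < A" and b0: "0 < b0"
    and rem: "\<forall>(u :: real^'n \<Rightarrow> real) b. u \<in> admissible m \<longrightarrow> 0 \<le> b \<longrightarrow> b \<le> b0 \<longrightarrow>
      (\<integral>\<^sup>+x. ennreal (exp (b * (u x)\<^sup>2) - 1 - b * (u x)\<^sup>2) \<partial>lebesgue)
        \<le> ennreal (A * b\<^sup>2 * (L2_norm (abs_nabla_pow m u))\<^sup>2)"
    using adams_remainder_bound[OF n m] by (elim exE conjE) (rule that)
  define B where "B = min (b0 / ?h 1) (1 / (A * ?h 1))"
  have B: "0 < B" "B \<le> b0 / ?h 1" "B \<le> 1 / (A * ?h 1)" using b0 h1 A by (auto simp: B_def)
  have "AD_functional \<beta> \<alpha> \<gamma> u < ennreal (\<beta> * ?h 1)"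
    if \<beta>: "0 < \<beta>" "\<beta> < B" and u: "u \<in> admissible m" for \<beta> and u :: "real^'n \<Rightarrow> real"
  proof -
    define s where "s = (L2_norm u)\<^sup>2"
    define g where "g = (L2_norm (abs_nabla_pow m u))\<^sup>2"
    have sg: "0 \<le> s" "0 \<le> g" "g + s \<le> 1" using admissibleD(3)[OF u] by (auto simp: s_def g_def)
    then have s1: "s \<le> 1" by linarith
    define b where "b = \<beta> * ?h s"
    have b: "0 < b" "b \<le> \<beta> * ?h 1"
      using \<beta> adams_factor_bounds(2,3)[OF par sg(1) s1] by (auto simp: b_def intro: mult_left_mono)
    have \<beta>h: "0 < \<beta> * ?h 1" "\<beta> * ?h 1 \<le> b0" "A * (\<beta> * ?h 1) < 1"
    proof -
      have "\<beta> < b0 / ?h 1" "\<beta> < 1 / (A * ?h 1)" using \<beta> B by auto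
      then show "0 < \<beta> * ?h 1" "\<beta> * ?h 1 \<le> b0" "A * (\<beta> * ?h 1) < 1"
        using \<beta> A h1 by (auto simp: field_simps)
    qed
    have R: "(\<integral>\<^sup>+x. ennreal (exp (b * (u x)\<^sup>2) - 1 - b * (u x)\<^sup>2) \<partial>lebesgue) \<le> ennreal (A * b\<^sup>2 * g)"
      unfolding g_def by (rule rem[rule_format, OF u]) (use b \<beta>h in auto)
    have "AD_functional \<beta> \<alpha> \<gamma> u
        = ennreal (b * s) + (\<integral>\<^sup>+x. ennreal (exp (b * (u x)\<^sup>2) - 1 - b * (u x)\<^sup>2) \<partial>lebesgue)"
      using exp_split_integral[OF _ admissibleD(1)[OF u], of b] b(1)
      unfolding AD_functional_adams_factor b_def s_def by simp
    also have "\<dots> \<le> ennreal (b * s) + ennreal (A * b\<^sup>2 * g)" by (rule add_left_mono[OF R])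
    also have "\<dots> = ennreal (b * s + A * b\<^sup>2 * g)" using b sg A by simp
    finally have le: "AD_functional \<beta> \<alpha> \<gamma> u \<le> ennreal (b * s + A * b\<^sup>2 * g)" .
    have "s + A * b * g < 1"
    proof (cases "g = 0")
      case False
      then have g: "0 < g" using sg by simp
      have "A * b < 1" using mult_left_mono[OF b(2), of A] A \<beta>h(3) by linarith
      then have "A * b * g < 1 * g" using g by (rule mult_strict_right_mono)
      then show ?thesis using sg by linarith
    next
      case True
      \<comment> \<open>Otherwise the remainder vanishes and \<open>u = 0\<close>.\<close>
      have "s \<noteq> 1"
        using L2_norm_zero_of_exp_remainder_zero[OF b(1) admissibleD(1)[OF u]] R True
        by (auto simp: s_def)
      then show ?thesis using True s1 by simp
    qed
    then have "b * (s + A * b * g) < b * 1" using b(1) by (rule mult_strict_left_mono)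
    then have "b * s + A * b\<^sup>2 * g < \<beta> * ?h 1"
      using b(2) by (simp add: algebra_simps power2_eq_square)
    then have "ennreal (b * s + A * b\<^sup>2 * g) < ennreal (\<beta> * ?h 1)"
      by (rule ennreal_lessI[OF \<beta>h(1)])
    with le show ?thesis by (rule le_less_trans)
  qed
  then show ?thesis using B(1) by blast
qed

theorem theorem1p3:
  fixes m :: nat and \<alpha> \<gamma> :: real
  assumes "m \<ge> 1" and "CARD('n::finite) = 2 * m"
    and "0 < \<alpha>" and "\<alpha> < 1"
    and "0 \<le> \<gamma>" and "\<gamma> < 1 / \<alpha> - 1"
  shows "\<exists>b. 0 < b \<and> b < adams_const m \<and>
           (\<forall>\<beta>. 0 < \<beta> \<and> \<beta> < b \<longrightarrow>
              \<not> (\<exists>u \<in> (admissible m :: (real^'n \<Rightarrow> real) set).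
                    AD_functional \<beta> \<alpha> \<gamma> u = AD TYPE('n) m \<beta> \<alpha> \<gamma>))"
proof -
  obtain B where B: "0 < B" and less: "\<forall>\<beta> (u :: real^'n \<Rightarrow> real).
      0 < \<beta> \<longrightarrow> \<beta> < B \<longrightarrow> u \<in> admissible m \<longrightarrow>
      AD_functional \<beta> \<alpha> \<gamma> u < ennreal (\<beta> * adams_factor \<alpha> \<gamma> 1)"
    using AD_functional_less_vanishing_level[OF assms(2,1,3,5,6,4)] by (elim exE conjE) (rule that)
  have ge: "ennreal (\<beta> * adams_factor \<alpha> \<gamma> 1) \<le> AD TYPE('n) m \<beta> \<alpha> \<gamma>" if "0 < \<beta>" for \<beta>
    by (rule AD_ge_vanishing_level[OF assms(2,1) that assms(3,5,6,4)])
  have ac: "0 < adams_const m" by (simp add: adams_const_def)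
  show ?thesis
  proof (intro exI[of _ "min B (adams_const m / 2)"] conjI allI impI notI)
    fix \<beta> assume \<beta>: "0 < \<beta> \<and> \<beta> < min B (adams_const m / 2)"
      and "\<exists>u \<in> (admissible m :: (real^'n \<Rightarrow> real) set).
        AD_functional \<beta> \<alpha> \<gamma> u = AD TYPE('n) m \<beta> \<alpha> \<gamma>"
    then obtain u :: "real^'n \<Rightarrow> real" where u: "u \<in> admissible m"
      "AD_functional \<beta> \<alpha> \<gamma> u = AD TYPE('n) m \<beta> \<alpha> \<gamma>" by blast
    have "AD_functional \<beta> \<alpha> \<gamma> u < ennreal (\<beta> * adams_factor \<alpha> \<gamma> 1)"
      using less[rule_format, of \<beta> u] \<beta> u(1) by simp
    then show False using ge[of \<beta>] \<beta> u(2) by simp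
  qed (use B ac in auto)
qed

end
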